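(* Let $n\ge 1$. There exists a unique basis $\{P_{\pmb\lambda}^{(q,t)}(x^{(1)},\ldots,x^{(n)})\}_{\pmb\lambda}$ of the $\mathbb Q(q,t)$-vector space of multi-symmetric functions in $x^{(1)},\dots,x^{(n)}$, indexed by multi-partitions $\pmb\lambda$ (i.e. $n$-tuples of partitions), such that 1) for every $\pmb\lambda$, $P_{\pmb\lambda}^{(q,t)}(x^{(1)},\ldots,x^{(n)})=m_{\pmb\lambda}(x^{(1)},\ldots,x^{(n)})+\text{lower terms}$, where "lower terms" means a $\mathbb Q(q,t)$-linear combination of $m_{\pmb\mu}(x^{(1)},\ldots,x^{(n)})$ with $\pmb\mu<\pmb\lambda$ in the dominance ordering on multi-partitions; 2) $\langle\!\langle P_{\pmb\lambda}^{(q,t)},P_{\pmb\mu}^{(q,t)}\rangle\!\rangle_{q,t,n}=0$ if $\pmb\lambda\ne\pmb\mu$, where $\langle\!\langle\cdot,\cdot\rangle\!\rangle_{q,t,n}$ is the $\mathbb Q(q,t)$-bilinear scalar product given by $$\langle\!\langle p_{\pmb\lambda},p_{\pmb\mu}\rangle\!\rangle_{q,t,n}=\delta_{\pmb\lambda,\pmb\mu}\,q^{(n-1)|\overline{\pmb\lambda}|-n(\overline{\pmb\lambda})}\,z_{\lambda^{(1)}}\cdots z_{\lambda^{(n)}}\prod_{i=1}^{\ell(\lambda^{(n)})}\frac{1-q^{\lambda^{(n)}_i}}{1-t^{\lambda^{(n)}_i}}.$$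
   Context: For $i=1,\dots,n$ let $x^{(i)}=(x^{(i)}_1,x^{(i)}_2,\dots)$ be an infinite alphabet. A multi-partition is an $n$-tuple of partitions $\pmb\lambda=(\lambda^{(1)},\dots,\lambda^{(n)})$. With $m_\lambda$, $p_\lambda$ the usual monomial and power-sum symmetric functions, set $m_{\pmb\lambda}(x^{(1)},\dots,x^{(n)})=m_{\lambda^{(1)}}(x^{(1)})\cdots m_{\lambda^{(n)}}(x^{(n)})$ and $p_{\pmb\lambda}(x^{(1)},\dots,x^{(n)})=p_{\lambda^{(1)}}(x^{(1)})\,p_{\lambda^{(2)}}(x^{(1)},x^{(2)})\cdots p_{\lambda^{(n)}}(x^{(1)},\dots,x^{(n)})$ (the $k$-th factor is evaluated in the union of the alphabets $x^{(1)},\dots,x^{(k)}$). The space of multi-symmetric functions is the $\mathbb Q(q,t)$-vector space with basis $\{m_{\pmb\lambda}\}$; $\{p_{\pmb\lambda}\}$ is also a basis. Dominance ordering: $\pmb\mu\le\pmb\lambda$ iff $\big(\sum_{i<k}|\mu^{(i)}|\big)+\mu^{(k)}_1+\cdots+\mu^{(k)}_j\le\big(\sum_{i<k}|\lambda^{(i)}|\big)+\lambda^{(k)}_1+\cdots+\lambda^{(k)}_j$ for all $j$ and $k$. $\overline{\pmb\lambda}=(|\lambda^{(1)}|,\dots,|\lambda^{(n)}|)$; for a composition $\alpha\in\mathbb N^n$, $|\alpha|=\alpha_1+\cdots+\alpha_n$ and $n(\alpha)=\sum_i(i-1)\alpha_i$. For a partition $\lambda$, $\ell(\lambda)$ is the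 number of nonzero parts and $z_\lambda=\prod_{i\ge1}i^{m_i(\lambda)}m_i(\lambda)!$, where $m_i(\lambda)$ is the number of parts equal to $i$. *)

theory Defs
  imports
    "HOL-Library.Poly_Mapping"
    "HOL-Library.FuncSet"
    "HOL-Library.Multiset"
    "HOL-Computational_Algebra.Polynomial_Factorial"
begin

text \<open>
  A series assigns a coefficient to every monomial, and a monomial is a finitely supported
  exponent function on the variables. No finiteness is required of a series, so that
  symmetric functions in infinite alphabets are elements of this ring.
\<close>

typedef ('v, 'a) mfps = "UNIV :: (('v \<Rightarrow>\<^sub>0 nat) \<Rightarrow> 'a) set"
  morphisms mcoeff Abs_mfps ..

setup_lifting type_definition_mfps

lemma mfps_eqI: "(\<And>e. mcoeff f e = mcoeff g e) \<Longrightarrow> f = g"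
  by transfer auto

definition splits :: "('v \<Rightarrow>\<^sub>0 nat) \<Rightarrow> (('v \<Rightarrow>\<^sub>0 nat) \<times> ('v \<Rightarrow>\<^sub>0 nat)) set" where
  "splits e = {(a, b). a + b = e}"

lemma finite_splits: "finite (splits e)"
proof -
  let ?F = "{f. \<forall>x. (x \<in> Poly_Mapping.keys e \<longrightarrow> f x \<in> {..Max (range (Poly_Mapping.lookup e))}) \<and>
                   (x \<notin> Poly_Mapping.keys e \<longrightarrow> f x = (0::nat))}"
  have fin: "finite ?F"
    by (rule finite_set_of_finite_funs) auto
  have rng: "finite (range (Poly_Mapping.lookup e))"
  proof -
    have "range (Poly_Mapping.lookup e) \<subseteq> insert 0 (Poly_Mapping.lookup e ` Poly_Mapping.keys e)"
      by (auto simp: in_keys_iff)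
    then show ?thesis by (rule finite_subset) simp
  qed
  have "(\<lambda>(a, b). (Poly_Mapping.lookup a, Poly_Mapping.lookup b)) ` splits e \<subseteq> ?F \<times> ?F"
  proof -
    have "Poly_Mapping.lookup a x \<le> Max (range (Poly_Mapping.lookup (a + b)))"
      "Poly_Mapping.lookup b x \<le> Max (range (Poly_Mapping.lookup (a + b)))"
      if "a + b = e" for a b x
    proof -
      have "Poly_Mapping.lookup (a + b) x \<le> Max (range (Poly_Mapping.lookup (a + b)))"
        using rng that by (intro Max_ge) auto
      then show "Poly_Mapping.lookup a x \<le> Max (range (Poly_Mapping.lookup (a + b)))"
        "Poly_Mapping.lookup b x \<le> Max (range (Poly_Mapping.lookup (a + b)))"
        by (auto simp: lookup_add)
    qed
    then show ?thesis
      by (auto simp: splits_def in_keys_iff lookup_add)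
  qed
  then have "finite ((\<lambda>(a, b). (Poly_Mapping.lookup a, Poly_Mapping.lookup b)) ` splits e)"
    by (rule finite_subset) (use fin in blast)
  moreover have "inj_on (\<lambda>(a, b). (Poly_Mapping.lookup a, Poly_Mapping.lookup b)) (splits e)"
    by (auto simp: inj_on_def lookup_inject)
  ultimately show ?thesis
    by (rule finite_imageD)
qed

instantiation mfps :: (type, comm_ring_1) comm_ring_1
begin

lift_definition zero_mfps :: "('a, 'b) mfps" is "\<lambda>e. 0" .
lift_definition one_mfps :: "('a, 'b) mfps" is "\<lambda>e. if e = 0 then 1 else 0" .
lift_definition plus_mfps :: "('a, 'b) mfps \<Rightarrow> ('a, 'b) mfps \<Rightarrow> ('a, 'b) mfps"
  is "\<lambda>f g e. f e + g e" .
lift_definition minus_mfps :: "('a, 'b) mfps \<Rightarrow> ('a, 'b) mfps \<Rightarrow> ('a, 'b) mfps"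
  is "\<lambda>f g e. f e - g e" .
lift_definition uminus_mfps :: "('a, 'b) mfps \<Rightarrow> ('a, 'b) mfps"
  is "\<lambda>f e. - f e" .
lift_definition times_mfps :: "('a, 'b) mfps \<Rightarrow> ('a, 'b) mfps \<Rightarrow> ('a, 'b) mfps"
  is "\<lambda>f g e. \<Sum>(a, b)\<in>splits e. f a * g b" .

instance
proof
  fix f g h :: "('a, 'b) mfps"
  show "f * g * h = f * (g * h)"
  proof transfer
    fix f g h :: "('a \<Rightarrow>\<^sub>0 nat) \<Rightarrow> 'b"
    show "(\<lambda>e. \<Sum>(a, b)\<in>splits e. (\<Sum>(a, b)\<in>splits a. f a * g b) * h b) =
          (\<lambda>e. \<Sum>(a, b)\<in>splits e. f a * (\<Sum>(a, b)\<in>splits b. g a * h b))"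
    proof
      fix e
      have "(\<Sum>(a, b)\<in>splits e. (\<Sum>(a, b)\<in>splits a. f a * g b) * h b) =
            (\<Sum>x\<in>splits e. \<Sum>y\<in>splits (fst x). f (fst y) * g (snd y) * h (snd x))"
        by (simp add: case_prod_beta sum_distrib_right)
      also have "\<dots> = (\<Sum>(x, y)\<in>(SIGMA x:splits e. splits (fst x)). f (fst y) * g (snd y) * h (snd x))"
        by (rule sum.Sigma) (auto simp: finite_splits)
      also have "\<dots> = (\<Sum>(x, y)\<in>(SIGMA x:splits e. splits (snd x)). f (fst x) * (g (fst y) * h (snd y)))"
        by (rule sum.reindex_bij_witness
              [where i = "\<lambda>((a, b), (c, d)). ((a + c, d), (a, c))"
                 and j = "\<lambda>((a, b), (c, d)). ((c, d + b), (d, b))"])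
           (auto simp: splits_def add.assoc mult.assoc)
      also have "\<dots> = (\<Sum>x\<in>splits e. \<Sum>y\<in>splits (snd x). f (fst x) * (g (fst y) * h (snd y)))"
        by (rule sum.Sigma [symmetric]) (auto simp: finite_splits)
      also have "\<dots> = (\<Sum>(a, b)\<in>splits e. f a * (\<Sum>(a, b)\<in>splits b. g a * h b))"
        by (simp add: case_prod_beta sum_distrib_left)
      finally show "(\<Sum>(a, b)\<in>splits e. (\<Sum>(a, b)\<in>splits a. f a * g b) * h b) =
        (\<Sum>(a, b)\<in>splits e. f a * (\<Sum>(a, b)\<in>splits b. g a * h b))" .
    qed
  qed
  show "f * g = g * f"
  proof transfer
    fix f g :: "('a \<Rightarrow>\<^sub>0 nat) \<Rightarrow> 'b"
    show "(\<lambda>e. \<Sum>(a, b)\<in>splits e. f a * g b) = (\<lambda>e. \<Sum>(a, b)\<in>splits e. g a * f b)"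
    proof
      fix e
      show "(\<Sum>(a, b)\<in>splits e. f a * g b) = (\<Sum>(a, b)\<in>splits e. g a * f b)"
        by (rule sum.reindex_bij_witness [where i = prod.swap and j = prod.swap])
           (auto simp: splits_def add.commute mult.commute)
    qed
  qed
  show "1 * f = f"
  proof transfer
    fix f :: "('a \<Rightarrow>\<^sub>0 nat) \<Rightarrow> 'b"
    show "(\<lambda>e. \<Sum>(a, b)\<in>splits e. (if a = 0 then 1 else 0) * f b) = f"
    proof
      fix e
      have "(\<Sum>(a, b)\<in>splits e. (if a = 0 then 1 else 0) * f b) =
            (\<Sum>(a, b)\<in>{(0 :: 'a \<Rightarrow>\<^sub>0 nat, e)}. (if a = 0 then 1 else 0) * f b)"
        by (rule sum.mono_neutral_right) (auto simp: finite_splits, auto simp: splits_def split: if_splits)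
      then show "(\<Sum>(a, b)\<in>splits e. (if a = 0 then 1 else 0) * f b) = f e"
        by simp
    qed
  qed
  show "(f + g) * h = f * h + g * h"
    by transfer (simp add: fun_eq_iff case_prod_beta sum.distrib distrib_right)
  show "(0 :: ('a, 'b) mfps) \<noteq> 1"
    by transfer (simp add: fun_eq_iff)
qed (transfer; simp add: fun_eq_iff add_ac)+

end

lift_definition mscale :: "'a \<Rightarrow> ('v, 'a::comm_ring_1) mfps \<Rightarrow> ('v, 'a) mfps"
  is "\<lambda>c f e. c * f e" .

global_interpretation mfps: vector_space "mscale :: 'a::field \<Rightarrow> ('v, 'a) mfps \<Rightarrow> ('v, 'a) mfps"
  by standard (transfer; simp add: fun_eq_iff algebra_simps)+

text \<open>
  A partition is the weakly decreasing list of its nonzero parts, so \<open>length\<close> is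
  the number of nonzero parts, \<open>sum_list\<close> is the size, and \<open>sum_list (take j \<nu>)\<close>
  is the sum of the \<open>j\<close> largest parts even if \<open>j\<close> exceeds the length.
\<close>

definition is_partition :: "nat list \<Rightarrow> bool" where
  "is_partition \<nu> \<longleftrightarrow> sorted_wrt (\<ge>) \<nu> \<and> 0 \<notin> set \<nu>"

text \<open>Components, and later alphabets, are numbered from \<open>0\<close> to \<open>n - 1\<close>.\<close>

definition multipartitions :: "nat \<Rightarrow> nat list list set" where
  "multipartitions n = {\<Lambda>. length \<Lambda> = n \<and> (\<forall>\<nu>\<in>set \<Lambda>. is_partition \<nu>)}"

text \<open>The order does not require the total sizes to agree.\<close>

definition dominance_le :: "nat \<Rightarrow> nat list list \<Rightarrow> nat list list \<Rightarrow> bool" where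
  "dominance_le n M \<Lambda> \<longleftrightarrow>
     (\<forall>k<n. \<forall>j. (\<Sum>i<k. sum_list (M ! i)) + sum_list (take j (M ! k))
              \<le> (\<Sum>i<k. sum_list (\<Lambda> ! i)) + sum_list (take j (\<Lambda> ! k)))"

definition dominance_less :: "nat \<Rightarrow> nat list list \<Rightarrow> nat list list \<Rightarrow> bool" where
  "dominance_less n M \<Lambda> \<longleftrightarrow> dominance_le n M \<Lambda> \<and> M \<noteq> \<Lambda>"

definition z_part :: "nat list \<Rightarrow> nat" where
  "z_part \<nu> = (\<Prod>i\<in>set \<nu>. i ^ count_list \<nu> i * fact (count_list \<nu> i))"

definition size_comp :: "nat list list \<Rightarrow> nat list" where
  "size_comp \<Lambda> = map sum_list \<Lambda>"

text \<open>With entries numbered from \<open>0\<close>, the weight \<open>i - 1\<close> becomes \<open>i\<close>.\<close>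

definition n_stat :: "nat list \<Rightarrow> nat" where
  "n_stat \<alpha> = (\<Sum>i<length \<alpha>. i * \<alpha> ! i)"

text \<open>The outer polynomial variable is \<open>q\<close> and the inner one is \<open>t\<close>.\<close>

type_synonym qt_field = "rat poly poly fract"

definition q_var :: qt_field where
  "q_var = to_fract [:0, 1:]"

definition t_var :: qt_field where
  "t_var = to_fract [:[:0, 1:]:]"

text \<open>The variable \<open>(i, j)\<close> is the \<open>j\<close>-th letter of the alphabet \<open>i\<close>.\<close>

type_synonym mseries = "(nat \<times> nat, qt_field) mfps"

text \<open>
  The monomial symmetric function of one alphabet is the sum of all distinct monomials in that
  alphabet whose nonzero exponents are, with multiplicity, the parts of the partition.
\<close>

definition monomial_sym :: "nat \<Rightarrow> nat list \<Rightarrow> mseries" where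
  "monomial_sym i \<nu> = Abs_mfps (\<lambda>e.
     if fst ` Poly_Mapping.keys e \<subseteq> {i} \<and>
        image_mset (Poly_Mapping.lookup e) (mset_set (Poly_Mapping.keys e)) = mset \<nu>
     then 1 else 0)"

definition multi_m :: "nat \<Rightarrow> nat list list \<Rightarrow> mseries" where
  "multi_m n \<Lambda> = (\<Prod>i<n. monomial_sym i (\<Lambda> ! i))"

text \<open>The power sum of degree \<open>r\<close>, for \<open>r > 0\<close>, in the union of the alphabets \<open>0, \<dots>, k\<close>.\<close>

definition power_sum :: "nat \<Rightarrow> nat \<Rightarrow> mseries" where
  "power_sum k r = Abs_mfps (\<lambda>e. if \<exists>i\<le>k. \<exists>j. e = Poly_Mapping.single (i, j) r then 1 else 0)"

definition multi_p :: "nat \<Rightarrow> nat list list \<Rightarrow> mseries" where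
  "multi_p n \<Lambda> = (\<Prod>k<n. \<Prod>r\<leftarrow>\<Lambda> ! k. power_sum k r)"

definition msym :: "nat \<Rightarrow> mseries set" where
  "msym n = mfps.span (multi_m n ` multipartitions n)"

definition is_basis_of :: "nat list list set \<Rightarrow> (nat list list \<Rightarrow> mseries) \<Rightarrow> mseries set \<Rightarrow> bool" where
  "is_basis_of I b V \<longleftrightarrow> inj_on b I \<and> mfps.independent (b ` I) \<and> mfps.span (b ` I) = V"

definition p_pairing :: "nat \<Rightarrow> nat list list \<Rightarrow> nat list list \<Rightarrow> qt_field" where
  "p_pairing n \<Lambda> M =
     (if \<Lambda> = M then
        q_var powi (int (n - 1) * int (sum_list (size_comp \<Lambda>)) - int (n_stat (size_comp \<Lambda>)))
        * of_nat (\<Prod>i<n. z_part (\<Lambda> ! i))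
        * (\<Prod>r\<leftarrow>\<Lambda> ! (n - 1). (1 - q_var ^ r) / (1 - t_var ^ r))
      else 0)"

definition p_coeff :: "nat \<Rightarrow> mseries \<Rightarrow> nat list list \<Rightarrow> qt_field" where
  "p_coeff n f \<Lambda> = mfps.representation (multi_p n ` multipartitions n) f (multi_p n \<Lambda>)"

definition p_support :: "nat \<Rightarrow> mseries \<Rightarrow> nat list list set" where
  "p_support n f = {\<Lambda> \<in> multipartitions n. p_coeff n f \<Lambda> \<noteq> 0}"

text \<open>
  The bilinear extension of \<open>p_pairing\<close> from the basis of the \<open>multi_p n \<Lambda>\<close>. An element
  of \<open>msym n\<close> has only finitely many nonzero coordinates, so the sums are finite.
\<close>

definition scalar_prod :: "nat \<Rightarrow> mseries \<Rightarrow> mseries \<Rightarrow> qt_field" where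
  "scalar_prod n f g =
     (\<Sum>\<Lambda>\<in>p_support n f. \<Sum>M\<in>p_support n g. p_coeff n f \<Lambda> * p_coeff n g M * p_pairing n \<Lambda> M)"

end

theory Submission
  imports Defs "HOL-Computational_Algebra.Formal_Power_Series"
begin

text \<open>
  The field of rational functions in \<open>q\<close> and \<open>t\<close> is ordered so that \<open>q\<close> and \<open>t\<close> exceed every
  constant. In that order every norm \<open>\<langle>\<langle>p_\<Lambda>,
  p_\<Lambda>\<rangle>\<rangle>\<close> is positive, because \<open>1 - q^r\<close> and \<open>1 - t^r\<close> are both
  negative; hence the scalar product is positive definite. Lower sets of the dominance order
  are finite, so orthogonal projection yields for each \<open>\<Lambda>\<close> exactly one vector
  \<open>P_\<Lambda>\<close> in \<open>m_\<Lambda> + span {m_M | M < \<Lambda>}\<close> that is orthogonal to this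
  span. A basis with the two required properties must consist of these vectors
  (\<open>orthogonal_imp_gram_schmidt\<close>, \<open>gram_schmidt_unique\<close>). What
  needs an argument is that they are orthogonal to each other also when \<open>\<Lambda>\<close> and \<open>M\<close>
  are incomparable.

  That argument uses operators \<open>E_0, ..., E_{n-1}\<close> on multi-symmetric functions that are
  self-adjoint and triangular: \<open>E_k m_\<Lambda>\<close> is \<open>e_k(\<Lambda>) m_\<Lambda>\<close> plus lower
  terms. Then \<open>E_k P_\<Lambda> - e_k(\<Lambda>) P_\<Lambda>\<close> lies in the span of the \<open>m_M\<close>
  with \<open>M < \<Lambda>\<close> and is orthogonal to it, so it is zero: \<open>P_\<Lambda>\<close> is an
  eigenvector. With \<open>\<tau>_k = q^{n-1-k} t\<close>, \<open>\<kappa>_0 = q\<close> and \<open>\<kappa>_k = q \<tau>_k\<close>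
  for \<open>k > 0\<close>, the eigenvalue is \<open>\<tau>^{-l} + (1 - 1/\<tau>) (\<kappa>^{\<nu>_1} +
  \<kappa>^{\<nu>_2} / \<tau> + ... + \<kappa>^{\<nu>_l} / \<tau>^{l-1})\<close>, where \<open>\<nu>\<close> is
  the component \<open>k\<close> of \<open>\<Lambda>\<close>, \<open>l\<close> is its length, \<open>\<kappa> = \<kappa>_k\<close> and \<open>\<tau> =
  \<tau>_k\<close>. Since \<open>\<kappa>\<close> and \<open>\<tau>\<close> are at least \<open>2\<close>, it determines \<open>\<nu>\<close>
  (\<open>eigenval_inj\<close>), so the \<open>n\<close> eigenvalues determine \<open>\<Lambda>\<close>, and
  eigenvectors of a self-adjoint operator for different eigenvalues are orthogonal
  (\<open>orthogonal_if_eigen\<close>).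

  The operators are vertex operators, that is, Macdonald's operator in plethystic form: \<open>E_k
  f\<close> is the constant term in \<open>z\<close> of \<open>exp (\<Sum>_r v_r z^r / r)\<close> times \<open>f\<close> with its power
  sums shifted by multiples of \<open>z^{-r}\<close>. Here \<open>v_r\<close> is the sum of \<open>1 - \<tau>_i^{-r}\<close> times
  the power sum of degree \<open>r\<close> of the alphabet \<open>i\<close>, over \<open>i \<ge> k\<close>; the shift adds
  \<open>\<kappa>_k^r - 1\<close> to the power sums of the alphabet \<open>k\<close> and \<open>q^r - \<kappa>_k^r\<close> to those
  of the alphabet \<open>k - 1\<close>. Multiplication by a coefficient of the exponential is, up to a
  scalar, adjoint to taking a coefficient of the shift
  (\<open>pair_exp_coeff_shift\<close>). This reduces self-adjointness to one scalar
  identity for each power sum (\<open>balance\<close>), which is what dictates the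
  constants.

  Triangularity (\<open>vertex_op_triangular\<close>) is checked on finite alphabets. If the
  letters of the alphabets before \<open>l\<close> and \<open>j\<close> letters of the alphabet \<open>l\<close> are multiplied by
  a variable \<open>s\<close>, then the degree in \<open>s\<close> of a monomial symmetric function \<open>m_M\<close> is at most
  the partial sum of \<open>M\<close> that the dominance order compares, and with enough other letters it
  is equal to it. So it suffices that \<open>E_k\<close> does not increase the bound on the degree
  (\<open>vertex_op_letters_degree\<close>). The diagonal coefficient is computed by
  splitting off the largest part (\<open>letter_coeff_vertex_op\<close>).

  All computations take place in the ring of polynomials in the power sums, where the scalar
  product and the shifts are defined generator by generator. The homomorphism
  \<open>theta\<close> into series is injective on it, takes monomials to the \<open>p_\<Lambda>\<close>
  and certain polynomials, given by a recursion, to the \<open>m_\<Lambda>\<close>.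
\<close>

section \<open>Ring homomorphisms as functions\<close>

text \<open>
  Both rings vary from lemma to lemma (polynomials, power series, polynomials over
  polynomials), so a homomorphism is a predicate on functions.
\<close>

definition rhom :: "('a::comm_ring_1 \<Rightarrow> 'b::comm_ring_1) \<Rightarrow> bool" where
  "rhom h \<longleftrightarrow> h 1 = 1 \<and> (\<forall>x y. h (x + y) = h x + h y) \<and> (\<forall>x y. h (x * y) = h x * h y)"

lemma rhomI: "h 1 = 1 \<Longrightarrow> (\<And>x y. h (x + y) = h x + h y) \<Longrightarrow> (\<And>x y. h (x * y) = h x * h y) \<Longrightarrow> rhom h"
  by (simp add: rhom_def)

lemma rhom_1: "rhom h \<Longrightarrow> h 1 = 1"
  and rhom_add: "rhom h \<Longrightarrow> h (x + y) = h x + h y"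
  and rhom_mult: "rhom h \<Longrightarrow> h (x * y) = h x * h y"
  by (simp_all add: rhom_def)

lemma rhom_0: "rhom h \<Longrightarrow> h 0 = 0"
  using rhom_add [of h 0 0] by simp

lemma rhom_uminus: "rhom h \<Longrightarrow> h (- x) = - h x"
  using rhom_add [of h x "-x"] by (simp add: rhom_0 eq_neg_iff_add_eq_0 add.commute)

lemma rhom_diff: "rhom h \<Longrightarrow> h (x - y) = h x - h y"
  using rhom_add [of h x "-y"] by (simp add: rhom_uminus)

lemma rhom_sum: "rhom h \<Longrightarrow> h (sum f A) = (\<Sum>a\<in>A. h (f a))"
  by (induct A rule: infinite_finite_induct) (simp_all add: rhom_0 rhom_add)

lemma rhom_sum_list: "rhom h \<Longrightarrow> h (sum_list xs) = (\<Sum>x\<leftarrow>xs. h x)"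
  by (induct xs) (simp_all add: rhom_0 rhom_add)

lemma rhom_power: "rhom h \<Longrightarrow> h (x ^ k) = h x ^ k"
  by (induct k) (simp_all add: rhom_1 rhom_mult)

lemma rhom_prod_mset: "rhom h \<Longrightarrow> h (prod_mset M) = (\<Prod>x\<in>#M. h x)"
  by (induct M) (simp_all add: rhom_1 rhom_mult)

lemma rhom_of_nat: "rhom h \<Longrightarrow> h (of_nat k) = of_nat k"
  by (induct k) (simp_all add: rhom_1 rhom_0 rhom_add)

lemma rhom_comp: "rhom g \<Longrightarrow> rhom h \<Longrightarrow> rhom (\<lambda>x. g (h x))"
  by (simp add: rhom_def)

lemma rhom_const_poly: "rhom (\<lambda>c. [:c:])"
  by (rule rhomI) (simp_all add: one_pCons)

lemma rhom_map_poly: "rhom h \<Longrightarrow> rhom (map_poly h)"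
  by (intro rhomI poly_eqI)
     (simp_all add: coeff_map_poly rhom_0 rhom_1 rhom_add coeff_mult rhom_sum rhom_mult)

lemma rhom_poly: "rhom (\<lambda>p. poly p x)"
  by (rule rhomI) simp_all

section \<open>Augmented monomial symmetric functions\<close>

text \<open>
  Pairs are a colour (the number of an alphabet) and a part. The part of \<open>x\<close> is added in
  turn to each part of the same colour.
\<close>

fun merges :: "nat \<times> nat \<Rightarrow> (nat \<times> nat) list \<Rightarrow> (nat \<times> nat) list list" where
  "merges x [] = []"
| "merges x (y # L) =
     (if fst x = fst y then [(fst x, snd x + snd y) # L] else []) @ map ((#) y) (merges x L)"

lemma length_merges: "M \<in> set (merges x L) \<Longrightarrow> length M = length L"
  by (induct L arbitrary: M) (auto split: if_splits)

lemma colors_merges: "M \<in> set (merges x L) \<Longrightarrow> map fst M = map fst L \<and> fst x \<in> fst ` set L"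
  by (induct L arbitrary: M) (auto split: if_splits)

lemma size_merges: "M \<in> set (merges x L) \<Longrightarrow> sum_list (map snd M) = snd x + sum_list (map snd L)"
  by (induct L arbitrary: M) (auto split: if_splits)

text \<open>
  The monomial symmetric function of a list of coloured parts, multiplied by the factorials
  of the multiplicities, as a universal polynomial in the power sums \<open>\<xi> (i, r)\<close> of the
  alphabets. For actual letters it is the sum, over all choices of pairwise distinct letters
  of the prescribed colours, of the product of their powers. The recursion is the rule for
  multiplying it by one power sum: the new letter either differs from the previous ones or
  coincides with one of them. As the \<open>\<xi>\<close> may lie in any commutative ring, the same
  polynomial serves for infinite alphabets, for finitely many letters, and for shifted power
  sums.
\<close>

function aug_mono :: "(nat \<times> nat \<Rightarrow> 'r::comm_ring_1) \<Rightarrow> (nat \<times> nat) list \<Rightarrow> 'r" where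
  "aug_mono \<xi> [] = 1"
| "aug_mono \<xi> (x # L) = \<xi> x * aug_mono \<xi> L - (\<Sum>M\<leftarrow>merges x L. aug_mono \<xi> M)"
  by pat_completeness auto
termination
  by (relation "measure (\<lambda>(_, L). length L)") (auto dest: length_merges)

lemma length_induct': "(\<And>L. (\<And>M. length M < length L \<Longrightarrow> P M) \<Longrightarrow> P L) \<Longrightarrow> P L"
  by (rule length_induct) blast

lemma aug_mono_rhom: "rhom h \<Longrightarrow> h (aug_mono \<xi> L) = aug_mono (\<lambda>v. h (\<xi> v)) L"
proof (induct L rule: length_induct')
  case (1 L)
  show ?case
  proof (cases L)
    case (Cons x L')
    have "(\<Sum>M\<leftarrow>merges x L'. h (aug_mono \<xi> M)) = (\<Sum>M\<leftarrow>merges x L'. aug_mono (\<lambda>v. h (\<xi> v)) M)"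
      using 1 Cons by (intro arg_cong[of _ _ sum_list] map_cong) (auto dest: length_merges)
    then show ?thesis
      using 1 Cons by (simp add: rhom_diff rhom_mult rhom_sum_list o_def)
  qed (simp add: rhom_1 1)
qed

lemma aug_mono_cong: "(\<And>v. fst v \<in> fst ` set L \<Longrightarrow> \<xi> v = \<eta> v) \<Longrightarrow> aug_mono \<xi> L = aug_mono \<eta> L"
proof (induct L rule: length_induct')
  case (1 L)
  show ?case
  proof (cases L)
    case (Cons x L')
    have "aug_mono \<xi> M = aug_mono \<eta> M" if "M \<in> set (merges x L')" for M
    proof -
      have "fst ` set M = fst ` set L'"
        using colors_merges [OF that] by (metis list.set_map)
      then show ?thesis using that 1(2) Cons by (intro 1(1)) (auto dest: length_merges)
    qed
    then have "(\<Sum>M\<leftarrow>merges x L'. aug_mono \<xi> M) = (\<Sum>M\<leftarrow>merges x L'. aug_mono \<eta> M)"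
      by (intro arg_cong[of _ _ sum_list] map_cong) auto
    moreover have "aug_mono \<xi> L' = aug_mono \<eta> L'" using 1 Cons by simp
    moreover have "\<xi> x = \<eta> x" using 1(2) Cons by simp
    ultimately show ?thesis using Cons by simp
  qed simp
qed

lemma merges_mset:
  "mset (map mset (merges x L)) =
   image_mset (\<lambda>y. add_mset (fst x, snd x + snd y) (mset L - {#y#})) (filter_mset (\<lambda>y. fst x = fst y) (mset L))"
proof (induct L)
  case (Cons z L)
  have "mset (map mset (map ((#) z) (merges x L))) = image_mset (add_mset z) (mset (map mset (merges x L)))"
    by (simp add: o_def image_mset.compositionality)
  also have "\<dots> = image_mset (\<lambda>y. add_mset (fst x, snd x + snd y) (mset (z # L) - {#y#})) (filter_mset (\<lambda>y. fst x = fst y) (mset L))"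
    unfolding Cons image_mset.compositionality
    by (rule image_mset_cong) (auto simp: o_def add_mset_commute)
  finally show ?case by simp
qed simp

lemma sum_list_merges_cong:
  assumes "\<And>M. M \<in> set (merges x L) \<Longrightarrow> f M = g (mset M)"
  shows "(\<Sum>M\<leftarrow>merges x L. f M) =
    (\<Sum>y\<in>#filter_mset (\<lambda>y. fst x = fst y) (mset L). g (add_mset (fst x, snd x + snd y) (mset L - {#y#})))"
proof -
  have "(\<Sum>M\<leftarrow>merges x L. f M) = (\<Sum>M\<leftarrow>merges x L. g (mset M))"
    using assms by (intro arg_cong[of _ _ sum_list] map_cong) auto
  also have "\<dots> = (\<Sum>C\<in>#mset (map mset (merges x L)). g C)"
    by (simp flip: sum_mset_sum_list add: image_mset.compositionality o_def)
  finally show ?thesis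
    by (simp add: merges_mset image_mset.compositionality o_def del: mset_map)
qed

text \<open>
  Merging two parts one after the other into the remaining ones gives the same lists in
  either order; this is why the recursion for \<open>aug_mono\<close> does not depend on the order of the
  parts.
\<close>

lemma merges_merges_commute:
  "(\<Sum>M\<leftarrow>merges x L. \<Sum>N\<leftarrow>merges y M. f N) = (\<Sum>M\<leftarrow>merges y L. \<Sum>N\<leftarrow>merges x M. (f N :: 'r::comm_monoid_add))"
proof (induct L arbitrary: f)
  case (Cons z L)
  show ?case
    using Cons[of "\<lambda>N. f (z # N)"]
    by (auto simp: o_def sum_list_addf ac_simps)
qed simp

lemma aug_mono_swap: "aug_mono \<xi> (x # y # L) = aug_mono \<xi> (y # x # L)"
proof -
  have "aug_mono \<xi> (x # y # L) = \<xi> x * \<xi> y * aug_mono \<xi> L - \<xi> x * (\<Sum>M\<leftarrow>merges y L. aug_mono \<xi> M)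
     - (if fst x = fst y then aug_mono \<xi> ((fst x, snd x + snd y) # L) else 0)
     - (\<xi> y * (\<Sum>M\<leftarrow>merges x L. aug_mono \<xi> M) - (\<Sum>M\<leftarrow>merges x L. \<Sum>N\<leftarrow>merges y M. aug_mono \<xi> N))" for x y
    by (simp add: o_def algebra_simps sum_list_subtractf sum_list_const_mult)
  from this[of x y] this[of y x] merges_merges_commute[of "aug_mono \<xi>" y x L] show ?thesis
    by (cases "fst x = fst y")
       (simp_all only: if_True if_False eq_commute[of "fst y" "fst x"], simp_all only: algebra_simps add_0)
qed

lemma aug_mono_perm: "mset L = mset L' \<Longrightarrow> aug_mono \<xi> L = aug_mono \<xi> L'"
proof (induct L arbitrary: L' rule: length_induct')
  case (1 L)
  have cong: "aug_mono \<xi> (x # A) = aug_mono \<xi> (x # B)" if "mset A = mset B" "length A < length L" for x A B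
  proof -
    \<comment> \<open>By induction, a shorter list can be replaced by any function of its multiset, which
      makes the two sums over merged lists comparable.\<close>
    define g where "g C = aug_mono \<xi> (SOME N. mset N = C)" for C
    have g: "aug_mono \<xi> M = g (mset M)" if "length M < length L" for M
      unfolding g_def by (rule 1(1)[OF that], rule sym, rule someI[of "\<lambda>N. mset N = mset M"], rule refl)
    have lB: "length B = length A" using that(1) by (metis size_mset)
    have "(\<Sum>M\<leftarrow>merges x A. aug_mono \<xi> M) =
        (\<Sum>y\<in>#filter_mset (\<lambda>y. fst x = fst y) (mset A). g (add_mset (fst x, snd x + snd y) (mset A - {#y#})))"
      by (rule sum_list_merges_cong) (use that in \<open>auto intro!: g dest: length_merges\<close>)
    moreover have "(\<Sum>M\<leftarrow>merges x B. aug_mono \<xi> M) =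
        (\<Sum>y\<in>#filter_mset (\<lambda>y. fst x = fst y) (mset B). g (add_mset (fst x, snd x + snd y) (mset B - {#y#})))"
      by (rule sum_list_merges_cong) (use that lB in \<open>auto intro!: g dest: length_merges\<close>)
    ultimately have "(\<Sum>M\<leftarrow>merges x A. aug_mono \<xi> M) = (\<Sum>M\<leftarrow>merges x B. aug_mono \<xi> M)"
      using that(1) by simp
    moreover have "aug_mono \<xi> A = aug_mono \<xi> B" using that by (intro 1(1)) auto
    ultimately show ?thesis by simp
  qed
  show ?case
  proof (cases L)
    case Nil
    then show ?thesis using 1(2) by simp
  next
    case (Cons x A)
    then obtain x' A' where L': "L' = x' # A'" using 1(2) by (cases L') auto
    show ?thesis
    proof (cases "x = x'")
      case True
      then have "mset A = mset A'" "length A < length L" using Cons L' 1(2) by auto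
      from cong[OF this, of x] show ?thesis using Cons L' True by (simp only:)
    next
      case False
      then obtain B where B: "mset A = add_mset x' (mset B)" "mset A' = add_mset x (mset B)"
        using 1(2) Cons L' by (auto simp: add_eq_conv_ex) (metis ex_mset)
      have "length A' = length A" using mset_eq_length[OF 1(2)] Cons L' by simp
      then have "aug_mono \<xi> L = aug_mono \<xi> (x # x' # B)"
        unfolding Cons by (intro cong) (use Cons B in simp_all)
      moreover have "aug_mono \<xi> L' = aug_mono \<xi> (x' # x # B)"
        unfolding L' by (rule cong) (use Cons B \<open>length A' = length A\<close> in simp_all)
      ultimately show ?thesis using aug_mono_swap[of \<xi> x x' B] by (simp only:)
    qed
  qed
qed

fun list_splits :: "'a list \<Rightarrow> ('a list \<times> 'a list) list" where
  "list_splits [] = [([], [])]"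
| "list_splits (x # L) = map (\<lambda>(J, K). (x # J, K)) (list_splits L) @ map (\<lambda>(J, K). (J, x # K)) (list_splits L)"

lemma list_splits_mset: "(J, K) \<in> set (list_splits L) \<Longrightarrow> mset L = mset J + mset K"
  by (induct L arbitrary: J K) auto

lemma list_splits_merges:
  "(\<Sum>M\<leftarrow>merges x L. \<Sum>(J, K)\<leftarrow>list_splits M. F J K) =
   (\<Sum>(J, K)\<leftarrow>list_splits L. (\<Sum>J'\<leftarrow>merges x J. F J' K) + (\<Sum>K'\<leftarrow>merges x K. (F J K' :: 'r::comm_monoid_add)))"
proof (induct L arbitrary: F)
  case (Cons y L)
  show ?case
    using Cons[of "\<lambda>J K. F (y # J) K"] Cons[of "\<lambda>J K. F J (y # K)"]
    by (auto simp: o_def sum_list_addf case_prod_unfold ac_simps)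
qed simp

text \<open>
  For the disjoint union of two systems of letters, each part takes its letter from one of
  the two systems.
\<close>

lemma aug_mono_add: "aug_mono (\<lambda>v. \<xi> v + \<eta> v) L = (\<Sum>(J, K)\<leftarrow>list_splits L. aug_mono \<xi> J * aug_mono \<eta> K)"
proof (induct L rule: length_induct')
  case (1 L)
  show ?case
  proof (cases L)
    case (Cons x A)
    have "(\<Sum>M\<leftarrow>merges x A. aug_mono (\<lambda>v. \<xi> v + \<eta> v) M) = (\<Sum>M\<leftarrow>merges x A. \<Sum>(J, K)\<leftarrow>list_splits M. aug_mono \<xi> J * aug_mono \<eta> K)"
      using 1 Cons by (intro arg_cong[of _ _ sum_list] map_cong) (auto dest: length_merges)
    also have "\<dots> = (\<Sum>(J, K)\<leftarrow>list_splits A. (\<Sum>J'\<leftarrow>merges x J. aug_mono \<xi> J' * aug_mono \<eta> K) + (\<Sum>K'\<leftarrow>merges x K. aug_mono \<xi> J * aug_mono \<eta> K'))"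
      by (rule list_splits_merges)
    finally show ?thesis
      using 1 Cons
      by (simp add: o_def case_prod_unfold sum_list_addf sum_list_subtractf algebra_simps
          sum_list_const_mult sum_list_mult_const)
  qed simp
qed

definition letter :: "nat \<Rightarrow> 'r \<Rightarrow> nat \<times> nat \<Rightarrow> 'r::comm_ring_1" where
  "letter i Y = (\<lambda>(c, r). if c = i then Y ^ r else 0)"

lemma aug_mono_letter_single: "aug_mono (letter i Y) [y] = (if fst y = i then Y ^ snd y else 0)"
  by (simp add: letter_def case_prod_unfold)

text \<open>
  Two parts cannot occupy distinct letters when there is a single letter.
\<close>

lemma aug_mono_letter_ge2: "length L \<ge> 2 \<Longrightarrow> aug_mono (letter i Y) L = 0"
proof (induct L rule: length_induct')
  case (1 L)
  then obtain x y A where L: "L = x # y # A" by (metis Suc_le_length_iff numeral_2_eq_2)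
  show ?case
  proof (cases A)
    case Nil
    then show ?thesis using L by (auto simp: letter_def case_prod_unfold power_add)
  next
    case (Cons z B)
    have "aug_mono (letter i Y) (y # A) = 0" using L Cons by (intro 1(1)) auto
    moreover have "(\<Sum>M\<leftarrow>merges x (y # A). aug_mono (letter i Y) M) = (\<Sum>M\<leftarrow>merges x (y # A). 0)"
    proof (intro arg_cong[of _ _ sum_list] map_cong refl)
      fix M assume "M \<in> set (merges x (y # A))"
      from length_merges[OF this] show "aug_mono (letter i Y) M = 0"
        using L Cons by (intro 1(1)) auto
    qed
    ultimately show ?thesis unfolding L aug_mono.simps(2)[of _ x] by (simp only: sum_list_0 mult_zero_right diff_zero)
  qed
qed

fun removals :: "'a list \<Rightarrow> ('a \<times> 'a list) list" where
  "removals [] = []"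
| "removals (x # L) = (x, L) # map (\<lambda>(y, M). (y, x # M)) (removals L)"

lemma removals_mset: "(y, M) \<in> set (removals L) \<Longrightarrow> mset L = add_mset y (mset M)"
  by (induct L arbitrary: M) auto

lemma list_splits_trivial:
  assumes "\<And>K. K \<noteq> [] \<Longrightarrow> g K = (0::'r::comm_ring_1)"
  shows "(\<Sum>(J, K)\<leftarrow>list_splits L. f J * g K) = f L * g []"
proof (induct L arbitrary: f)
  case (Cons x L)
  have "(\<Sum>(J, K)\<leftarrow>list_splits L. f J * g (x # K)) = 0"
    by (simp add: assms case_prod_unfold)
  with Cons[of "\<lambda>J. f (x # J)"] show ?case
    by (simp add: o_def case_prod_unfold)
qed simp

lemma list_splits_removals:
  assumes "\<And>K. length K \<ge> 2 \<Longrightarrow> g K = (0::'r::comm_ring_1)"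
  shows "(\<Sum>(J, K)\<leftarrow>list_splits L. f J * g K) = f L * g [] + (\<Sum>(y, M)\<leftarrow>removals L. f M * g [y])"
proof (induct L arbitrary: f)
  case (Cons x L)
  have "(\<Sum>(J, K)\<leftarrow>list_splits L. f J * g (x # K)) = f L * g [x]"
    by (rule list_splits_trivial) (auto intro!: assms simp: Suc_le_eq)
  with Cons[of "\<lambda>J. f (x # J)"] show ?case
    by (simp add: o_def case_prod_unfold)
qed simp

text \<open>
  A new letter is used by at most one of the parts.
\<close>

lemma aug_mono_add_letter:
  "aug_mono (\<lambda>v. \<xi> v + letter i Y v) L =
   aug_mono \<xi> L + (\<Sum>(y, M)\<leftarrow>removals L. if fst y = i then Y ^ snd y * aug_mono \<xi> M else 0)"
  unfolding aug_mono_add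
  by (subst list_splits_removals[of "aug_mono (letter i Y)"])
     (auto simp: aug_mono_letter_ge2 aug_mono_letter_single case_prod_unfold mult.commute simp del: aug_mono.simps(2)
       intro!: arg_cong[of _ _ sum_list])

lemma aug_mono_vanish0:
  assumes "\<And>r. \<xi> (l, r) = 0" "l \<in> fst ` set L"
  shows "aug_mono \<xi> L = 0"
  using assms(2)
proof (induct L rule: length_induct')
  case (1 L)
  then obtain x A where L: "L = x # A" by (cases L) auto
  have "aug_mono \<xi> M = 0" if "M \<in> set (merges x A)" for M
  proof (rule 1(1))
    show "length M < length L" using that L by (auto dest: length_merges)
    have "fst ` set M = fst ` set A" "fst x \<in> fst ` set A"
      using colors_merges [OF that] by (metis list.set_map) (use colors_merges [OF that] in simp)
    then show "l \<in> fst ` set M" using 1(2) L by auto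
  qed
  then have "(\<Sum>M\<leftarrow>merges x A. aug_mono \<xi> M) = (\<Sum>M\<leftarrow>merges x A. 0)"
    by (intro arg_cong[of _ _ sum_list] map_cong) auto
  moreover have "\<xi> x * aug_mono \<xi> A = 0"
  proof (cases "fst x = l")
    case True then show ?thesis using assms(1) by (cases x) auto
  next
    case False then show ?thesis using 1 L by auto
  qed
  ultimately show ?case using L by simp
qed

text \<open>
  There is no choice of distinct letters when there are more parts of a colour than letters
  of that colour.
\<close>

lemma aug_mono_vanish:
  assumes "\<And>r. \<xi> (l, r) = (\<Sum>y\<leftarrow>ys. y ^ r)" "length (filter (\<lambda>v. fst v = l) L) > length ys"
  shows "aug_mono \<xi> L = 0"
  using assms
proof (induct ys arbitrary: L \<xi>)
  case Nil
  then have "filter (\<lambda>v. fst v = l) L \<noteq> []" by auto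
  then have "l \<in> fst ` set L" by (auto simp: filter_empty_conv)
  then show ?case using aug_mono_vanish0[of \<xi> l L] Nil(1) by simp
next
  case (Cons y ys)
  let ?\<xi> = "\<lambda>v. \<xi> v - letter l y v"
  have *: "aug_mono ?\<xi> M = 0" if "length (filter (\<lambda>v. fst v = l) M) > length ys" for M
    by (rule Cons(1)) (use that Cons(2) in \<open>auto simp: letter_def\<close>)
  have "aug_mono \<xi> L = aug_mono (\<lambda>v. ?\<xi> v + letter l y v) L" by simp
  also have "\<dots> = 0 + (\<Sum>(z, M)\<leftarrow>removals L. 0)"
    unfolding aug_mono_add_letter
  proof (intro arg_cong2[of _ _ _ _ "(+)"] arg_cong[of _ _ sum_list] map_cong refl *, goal_cases)
    case 1 then show ?case using Cons(3) by simp
  next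
    case (2 zM)
    obtain z M where zM: "zM = (z, M)" by (rule prod.exhaust)
    have "mset L = mset (z # M)" using 2 zM removals_mset by force
    then have "length (filter (\<lambda>v. fst v = l) L) = length (filter (\<lambda>v. fst v = l) (z # M))"
      by (metis mset_filter size_mset)
    then have "length (filter (\<lambda>v. fst v = l) M) > length ys" using Cons(3) by (auto split: if_splits)
    then show ?case using zM * by simp
  qed
  finally show ?case by (simp add: case_prod_unfold)
qed

text \<open>
  Bounds on degrees are needed for polynomials in one variable and for two different weights
  on polynomials in two variables; the axioms cover these cases.
\<close>

definition filtration :: "(nat \<Rightarrow> 'r::comm_ring_1 set) \<Rightarrow> bool" where
  "filtration F \<longleftrightarrow> 1 \<in> F 0 \<and> (\<forall>d. 0 \<in> F d) \<and> (\<forall>d. \<forall>x\<in>F d. \<forall>y\<in>F d. x + y \<in> F d) \<and> (\<forall>d. \<forall>x\<in>F d. - x \<in> F d)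
     \<and> (\<forall>d e. \<forall>x\<in>F d. \<forall>y\<in>F e. x * y \<in> F (d + e)) \<and> (\<forall>d e. d \<le> e \<longrightarrow> F d \<subseteq> F e)"

lemma filtration_mult: "filtration F \<Longrightarrow> x \<in> F d \<Longrightarrow> y \<in> F e \<Longrightarrow> x * y \<in> F (d + e)"
  and filtration_0: "filtration F \<Longrightarrow> 0 \<in> F d"
  by (auto simp: filtration_def)

lemma filtration_mono: "filtration F \<Longrightarrow> x \<in> F d \<Longrightarrow> d \<le> e \<Longrightarrow> x \<in> F e"
  unfolding filtration_def by blast

lemma filtration_diff: "filtration F \<Longrightarrow> x \<in> F d \<Longrightarrow> y \<in> F d \<Longrightarrow> x - y \<in> F d"
  unfolding filtration_def by (metis add_uminus_conv_diff)

lemma filtration_sum_list: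
  "filtration F \<Longrightarrow> (\<And>x. x \<in> set xs \<Longrightarrow> f x \<in> F d) \<Longrightarrow> (\<Sum>x\<leftarrow>xs. f x) \<in> F d"
  by (induct xs) (auto simp: filtration_def)

lemma filtration_power: "filtration F \<Longrightarrow> x \<in> F 1 \<Longrightarrow> x ^ r \<in> F r"
proof (induct r)
  case (Suc r)
  then show ?case using filtration_mult[of F x 1 "x ^ r" r] by simp
qed (auto simp: filtration_def)

lemma aug_mono_filtration:
  assumes "filtration F" "\<And>i r. i \<in> fst ` set L \<Longrightarrow> \<xi> (i, r) \<in> F r"
  shows "aug_mono \<xi> L \<in> F (sum_list (map snd L))"
  using assms(2)
proof (induct L rule: length_induct')
  case (1 L)
  show ?case
  proof (cases L)
    case Nil then show ?thesis using assms by (simp add: filtration_def)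
  next
    case (Cons x A)
    have "aug_mono \<xi> A \<in> F (sum_list (map snd A))" using 1 Cons by auto
    moreover have "\<xi> x \<in> F (snd x)" using 1(2)[of "fst x" "snd x"] Cons by simp
    ultimately have "\<xi> x * aug_mono \<xi> A \<in> F (sum_list (map snd L))"
      using assms Cons by (simp add: filtration_def)
    moreover have "aug_mono \<xi> M \<in> F (sum_list (map snd L))" if "M \<in> set (merges x A)" for M
    proof -
      have "fst ` set M = fst ` set A"
        using colors_merges [OF that] by (metis list.set_map)
      then have "aug_mono \<xi> M \<in> F (sum_list (map snd M))"
        using that 1(2) Cons by (intro 1(1)) (auto dest: length_merges)
      then show ?thesis using size_merges[OF that] Cons by simp
    qed
    ultimately show ?thesis using Cons assms(1)
      by (auto intro!: filtration_diff filtration_sum_list)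
  qed
qed

text \<open>
  The source of all upper bounds by partial sums of parts. The power sums in \<open>\<xi>\<close> carry
  the degree: \<open>ys\<close> are the letters of colour \<open>l\<close>, and there are none of larger colour, so
  the parts that can be placed there are limited in number. The remaining contribution
  \<open>\<eta>\<close> has degree zero.
\<close>

lemma aug_mono_bound:
  assumes F: "filtration F"
    and S1: "\<And>i r. i < l \<Longrightarrow> \<xi> (i, r) \<in> F r"
    and S2: "\<And>r. \<xi> (l, r) = (\<Sum>y\<leftarrow>ys. y ^ r)" "\<And>y. y \<in> set ys \<Longrightarrow> y \<in> F 1"
    and S3: "\<And>i r. i > l \<Longrightarrow> \<xi> (i, r) = 0"
    and Z: "\<And>v. \<eta> v \<in> F 0"
    and d: "\<And>J. mset J \<subseteq># mset L \<Longrightarrow> \<forall>v\<in>set J. fst v \<le> l \<Longrightarrow>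
       length (filter (\<lambda>v. fst v = l) J) \<le> length ys \<Longrightarrow> sum_list (map snd J) \<le> d"
  shows "aug_mono (\<lambda>v. \<xi> v + \<eta> v) L \<in> F d"
  unfolding aug_mono_add
proof (rule filtration_sum_list[OF F], clarify)
  fix J K assume JK: "(J, K) \<in> set (list_splits L)"
  have K: "aug_mono \<eta> K \<in> F 0"
  proof -
    let ?G = "\<lambda>_. F 0"
    have "filtration ?G" using F filtration_mult[OF F, of _ 0 _ 0] by (auto simp: filtration_def)
    from aug_mono_filtration[OF this] show ?thesis using Z by auto
  qed
  show "aug_mono \<xi> J * aug_mono \<eta> K \<in> F d"
  proof (cases "(\<forall>v\<in>set J. fst v \<le> l) \<and> length (filter (\<lambda>v. fst v = l) J) \<le> length ys")
    case True
    have "mset J \<subseteq># mset L" using list_splits_mset[OF JK] by simp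
    then have le: "sum_list (map snd J) \<le> d" using d True by blast
    have "aug_mono \<xi> J \<in> F (sum_list (map snd J))"
    proof (rule aug_mono_filtration[OF F])
      fix i r assume "i \<in> fst ` set J"
      then consider "i < l" | "i = l" using True by force
      then show "\<xi> (i, r) \<in> F r"
      proof cases
        case 2
        then show ?thesis unfolding 2 S2(1)
          by (intro filtration_sum_list[OF F] filtration_power[OF F] S2(2))
      qed (rule S1)
    qed
    then have "aug_mono \<xi> J * aug_mono \<eta> K \<in> F (sum_list (map snd J))"
      using filtration_mult[OF F _ K] by simp
    then show ?thesis using le by (rule filtration_mono[OF F])
  next
    case False
    have "aug_mono \<xi> J = 0"
    proof (cases "\<forall>v\<in>set J. fst v \<le> l")
      case True
      then show ?thesis using False S2(1) by (intro aug_mono_vanish[of _ l ys]) auto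
    next
      case False
      then obtain v where "v \<in> set J" "fst v > l" by force
      then show ?thesis using S3 by (intro aug_mono_vanish0[of _ "fst v"]) auto
    qed
    then show ?thesis by (simp add: filtration_0[OF F])
  qed
qed

section \<open>Polynomials in the power sums\<close>

text \<open>
  The monomials of the polynomial ring are multisets of pairs. The generator \<open>(k, r)\<close> stands
  for the power sum of degree \<open>r\<close> in the union of the alphabets up to \<open>k\<close>, as in the
  definition of the \<open>p_\<Lambda>\<close>.
\<close>

type_synonym 'k pring = "(nat \<times> nat) multiset \<Rightarrow>\<^sub>0 'k"

definition cst :: "'k::comm_ring_1 \<Rightarrow> 'k pring" where
  "cst c = Poly_Mapping.single {#} c"

definition gen :: "nat \<times> nat \<Rightarrow> 'k::comm_ring_1 pring" where
  "gen v = Poly_Mapping.single {#v#} 1"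

definition gen_subst :: "('k::comm_ring_1 \<Rightarrow> 'r::comm_ring_1) \<Rightarrow> (nat \<times> nat \<Rightarrow> 'r) \<Rightarrow> 'k pring \<Rightarrow> 'r" where
  "gen_subst \<iota> \<pi> f = (\<Sum>C\<in>Poly_Mapping.keys f. \<iota> (Poly_Mapping.lookup f C) * (\<Prod>v\<in>#C. \<pi> v))"

lemma rhom_cst: "rhom cst"
  by (rule rhomI) (simp_all add: cst_def single_add mult_single flip: zero_multiset_def)

lemma cst_1 [simp]: "cst 1 = 1" and cst_0 [simp]: "cst 0 = 0"
  using rhom_1[OF rhom_cst] rhom_0[OF rhom_cst] by auto

lemma prod_gen: "(\<Prod>v\<in>#C. gen v) = (Poly_Mapping.single C 1 :: 'k::comm_ring_1 pring)"
  by (induct C) (simp_all add: gen_def mult_single flip: zero_multiset_def)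

lemma single_eq: "Poly_Mapping.single C c = cst c * (\<Prod>v\<in>#C. gen v)"
  by (simp add: prod_gen cst_def mult_single)

lemma pring_induct [case_names single add]:
  assumes "\<And>C c. P (Poly_Mapping.single C c)" "\<And>f g. P f \<Longrightarrow> P g \<Longrightarrow> P (f + g)"
  shows "P (f :: 'k::comm_ring_1 pring)"
proof (induct f rule: update_induct)
  case const
  show ?case using assms(1)[of "{#}" 0] by simp
next
  case (update f a b)
  have "Poly_Mapping.update a b f = f + Poly_Mapping.single a b"
    using update(1) by (intro poly_mapping_eqI) (auto simp: lookup_update lookup_add lookup_single in_keys_iff when_def)
  then show ?case using assms update by simp
qed

lemma gen_subst_eq_sum:
  assumes "finite S" "Poly_Mapping.keys f \<subseteq> S" "rhom \<iota>"
  shows "gen_subst \<iota> \<pi> f = (\<Sum>C\<in>S. \<iota> (Poly_Mapping.lookup f C) * (\<Prod>v\<in>#C. \<pi> v))"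
  unfolding gen_subst_def
  by (rule sum.mono_neutral_left) (use assms in \<open>auto simp: in_keys_iff rhom_0\<close>)

lemma gen_subst_single: "rhom \<iota> \<Longrightarrow> gen_subst \<iota> \<pi> (Poly_Mapping.single C c) = \<iota> c * (\<Prod>v\<in>#C. \<pi> v)"
  by (subst gen_subst_eq_sum[of "{C}"]) auto

lemma gen_subst_add: "rhom \<iota> \<Longrightarrow> gen_subst \<iota> \<pi> (f + g) = gen_subst \<iota> \<pi> f + gen_subst \<iota> \<pi> g"
proof -
  assume h: "rhom \<iota>"
  let ?S = "Poly_Mapping.keys f \<union> Poly_Mapping.keys g"
  show ?thesis
    using keys_add[of f g] h
    by (subst (1 2 3) gen_subst_eq_sum[of ?S]) (auto simp: lookup_add rhom_add sum.distrib algebra_simps)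
qed

lemma rhom_gen_subst: assumes h: "rhom \<iota>" shows "rhom (gen_subst \<iota> \<pi>)"
proof (rule rhomI)
  show "gen_subst \<iota> \<pi> 1 = 1"
    using gen_subst_single[OF h, of \<pi> "{#}" 1] by (simp add: rhom_1 h flip: zero_multiset_def)
  show "gen_subst \<iota> \<pi> (f + g) = gen_subst \<iota> \<pi> f + gen_subst \<iota> \<pi> g" for f g
    by (rule gen_subst_add[OF h])
  show "gen_subst \<iota> \<pi> (f * g) = gen_subst \<iota> \<pi> f * gen_subst \<iota> \<pi> g" for f g
  proof (induct f rule: pring_induct)
    case (single C c)
    show ?case
      by (induct g rule: pring_induct)
         (simp_all add: mult_single gen_subst_single gen_subst_add rhom_mult h algebra_simps)
  qed (simp add: distrib_right gen_subst_add h)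
qed

lemma gen_subst_cst: "rhom \<iota> \<Longrightarrow> gen_subst \<iota> \<pi> (cst c) = \<iota> c"
  by (simp add: cst_def gen_subst_single)

lemma gen_subst_gen: "rhom \<iota> \<Longrightarrow> gen_subst \<iota> \<pi> (gen v) = \<pi> v"
  by (simp add: gen_def gen_subst_single rhom_1)

text \<open>
  The power sum of one single alphabet, as a difference of two generators.
\<close>

definition alphabet_gen :: "nat \<times> nat \<Rightarrow> 'k::comm_ring_1 pring" where
  "alphabet_gen v = gen v - (if fst v = 0 then 0 else gen (fst v - 1, snd v))"

text \<open>
  The homomorphism that sends the power sums of the single alphabets to \<open>\<xi>\<close>, and the
  coefficients along \<open>\<iota>\<close>.
\<close>

definition alphabet_subst :: "('k::comm_ring_1 \<Rightarrow> 'r::comm_ring_1) \<Rightarrow> (nat \<times> nat \<Rightarrow> 'r) \<Rightarrow> 'k pring \<Rightarrow> 'r" where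
  "alphabet_subst \<iota> \<xi> = gen_subst \<iota> (\<lambda>v. \<Sum>i\<le>fst v. \<xi> (i, snd v))"

lemma rhom_alphabet_subst: "rhom \<iota> \<Longrightarrow> rhom (alphabet_subst \<iota> \<xi>)"
  unfolding alphabet_subst_def by (rule rhom_gen_subst)

lemma alphabet_subst_cst: "rhom \<iota> \<Longrightarrow> alphabet_subst \<iota> \<xi> (cst c) = \<iota> c"
  by (simp add: alphabet_subst_def gen_subst_cst)

lemma alphabet_subst_alphabet_gen: "rhom \<iota> \<Longrightarrow> alphabet_subst \<iota> \<xi> (alphabet_gen v) = \<xi> v"
proof -
  assume h: "rhom \<iota>"
  note [simp] = rhom_diff[OF rhom_gen_subst[OF h]] rhom_0[OF rhom_gen_subst[OF h]] gen_subst_gen[OF h]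
  obtain k r where v: "v = (k, r)" by force
  show ?thesis unfolding v alphabet_subst_def alphabet_gen_def by (cases k) auto
qed

lemma gen_sum_alphabet_gen: "gen (k, r) = (\<Sum>i\<le>k. alphabet_gen (i, r))"
  by (induct k) (simp_all add: alphabet_gen_def)

lemma rhom_eqI:
  fixes g h :: "'k::comm_ring_1 pring \<Rightarrow> 'r::comm_ring_1"
  assumes "rhom g" "rhom h" "\<And>c. g (cst c) = h (cst c)" "\<And>v. g (alphabet_gen v) = h (alphabet_gen v)"
  shows "g f = h f"
proof (induct f rule: pring_induct)
  case (single C c)
  have "g (gen v) = h (gen v)" for v
    using gen_sum_alphabet_gen[of "fst v" "snd v", where ?'a = 'k] assms by (simp add: rhom_sum)
  then show ?case
    using assms by (simp add: single_eq rhom_mult rhom_prod_mset image_mset.compositionality o_def)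
qed (use assms in \<open>simp add: rhom_add\<close>)

definition amono :: "(nat \<times> nat) list \<Rightarrow> 'k::comm_ring_1 pring" where
  "amono L = aug_mono alphabet_gen L"

lemma alphabet_subst_amono: "rhom \<iota> \<Longrightarrow> alphabet_subst \<iota> \<xi> (amono L) = aug_mono \<xi> L"
  unfolding amono_def by (subst aug_mono_rhom[OF rhom_alphabet_subst]) (simp_all add: alphabet_subst_alphabet_gen)

lemma alphabet_gen_amono: "alphabet_gen x * amono L = amono (x # L) + (\<Sum>M\<leftarrow>merges x L. amono M)"
  by (simp add: amono_def)

section \<open>Series in infinite alphabets\<close>

definition mconst :: "'k::comm_ring_1 \<Rightarrow> ('v, 'k) mfps" where
  "mconst c = mscale c 1"

lemma mcoeff_mscale: "mcoeff (mscale c f) e = c * mcoeff f e"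
  by transfer simp

lemma mcoeff_1: "mcoeff 1 e = (if e = 0 then 1 else 0)"
  by transfer simp

lemma mcoeff_times: "mcoeff (f * g) e = (\<Sum>(a, b)\<in>splits e. mcoeff f a * mcoeff g b)"
  by transfer simp

lemma mcoeff_add: "mcoeff (f + g) e = mcoeff f e + mcoeff g e"
  by transfer simp

lemma mcoeff_diff: "mcoeff (f - g) e = mcoeff f e - mcoeff g e"
  by transfer simp

lemma mcoeff_0: "mcoeff 0 e = 0"
  by transfer simp

lemma mcoeff_Abs: "mcoeff (Abs_mfps F) e = F e"
  by (simp add: Abs_mfps_inverse)

lemma mconst_times: "mconst c * f = mscale c f"
proof -
  have "mscale c g * f = mscale c (g * f)" for g
    by transfer (simp add: fun_eq_iff case_prod_unfold sum_distrib_left mult.assoc)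
  then show ?thesis by (simp add: mconst_def)
qed

lemma rhom_mconst: "rhom (mconst :: 'k::comm_ring_1 \<Rightarrow> ('v, 'k) mfps)"
proof (rule rhomI)
  show "mconst 1 = (1 :: ('v, 'k) mfps)" by (rule mfps_eqI) (simp add: mconst_def mcoeff_mscale)
  show "mconst (x + y) = (mconst x + mconst y :: ('v, 'k) mfps)" for x y
    by (rule mfps_eqI) (simp add: mconst_def mcoeff_mscale mcoeff_add algebra_simps)
  show "mconst (x * y) = (mconst x * mconst y :: ('v, 'k) mfps)" for x y
    by (rule mfps_eqI, subst mconst_times) (simp add: mconst_def mcoeff_mscale algebra_simps)
qed

text \<open>
  The multiset of coloured exponents of a monomial: two monomials have the same one iff
  permuting the letters within the alphabets takes one to the other.
\<close>

definition exponent_mset :: "('c \<times> 'd \<Rightarrow>\<^sub>0 nat) \<Rightarrow> ('c \<times> nat) multiset" where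
  "exponent_mset e = image_mset (\<lambda>v. (fst v, Poly_Mapping.lookup e v)) (mset_set (Poly_Mapping.keys e))"

definition mono_series :: "(nat \<times> nat) multiset \<Rightarrow> (nat \<times> nat, 'k::comm_ring_1) mfps" where
  "mono_series C = Abs_mfps (\<lambda>e. if exponent_mset e = C then 1 else 0)"

definition mult_fact :: "'b multiset \<Rightarrow> nat" where
  "mult_fact C = (\<Prod>v\<in>set_mset C. fact (count C v))"

lemma mult_fact_add: "mult_fact (add_mset x C) = (count C x + 1) * mult_fact C"
proof -
  have "mult_fact (add_mset x C) = (\<Prod>v\<in>insert x (set_mset C). fact (count (add_mset x C) v))"
    by (simp add: mult_fact_def)
  also have "\<dots> = fact (count C x + 1) * (\<Prod>v\<in>set_mset C - {x}. fact (count C v))"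
    by (subst prod.insert_remove) (auto intro!: prod.cong arg_cong2[where f = "(*)"] split: if_splits)
  also have "\<dots> = (count C x + 1) * (fact (count C x) * (\<Prod>v\<in>set_mset C - {x}. fact (count C v)))"
    by (simp add: algebra_simps)
  also have "fact (count C x) * (\<Prod>v\<in>set_mset C - {x}. fact (count C v)) = mult_fact C"
  proof (cases "x \<in># C")
    case True
    then show ?thesis unfolding mult_fact_def by (subst (2) prod.remove[of _ x]) auto
  next
    case False
    then show ?thesis by (simp add: mult_fact_def not_in_iff)
  qed
  finally show ?thesis .
qed

lemma mult_fact_pos: "mult_fact C > 0"
  by (simp add: mult_fact_def prod_pos)

definition alphabet_psum :: "nat \<times> nat \<Rightarrow> (nat \<times> nat, 'k::comm_ring_1) mfps" where
  "alphabet_psum v = Abs_mfps (\<lambda>e. if \<exists>j. e = Poly_Mapping.single (fst v, j) (snd v) then 1 else 0)"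

lemma mcoeff_alphabet_psum_times:
  assumes "r > 0"
  shows "mcoeff (alphabet_psum (i, r) * f) e =
    (\<Sum>v\<in>{v\<in>Poly_Mapping.keys e. fst v = i \<and> Poly_Mapping.lookup e v \<ge> r}. mcoeff f (e - Poly_Mapping.single v r))"
proof -
  let ?V = "{v\<in>Poly_Mapping.keys e. fst v = i \<and> Poly_Mapping.lookup e v \<ge> r}"
  let ?h = "\<lambda>v. (Poly_Mapping.single v r, e - Poly_Mapping.single v r)"
  have split: "Poly_Mapping.single v r + (e - Poly_Mapping.single v r) = e" if "Poly_Mapping.lookup e v \<ge> r" for v
    using that by (intro poly_mapping_eqI) (auto simp: lookup_add lookup_minus lookup_single when_def)
  have inj: "inj_on ?h ?V"
    using assms by (auto simp: inj_on_def poly_mapping_eq_iff fun_eq_iff lookup_single when_def split: if_splits)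
  have "mcoeff (alphabet_psum (i, r) * f) e = (\<Sum>(a, b)\<in>splits e. mcoeff (alphabet_psum (i, r)) a * mcoeff f b)"
    by (rule mcoeff_times)
  also have "\<dots> = (\<Sum>(a, b)\<in>?h ` ?V. mcoeff (alphabet_psum (i, r)) a * mcoeff f b)"
  proof (rule sum.mono_neutral_right)
    show "finite (splits e)" by (rule finite_splits)
    show "?h ` ?V \<subseteq> splits e" using split by (auto simp: splits_def)
    show "\<forall>x\<in>splits e - ?h ` ?V. (case x of (a, b) \<Rightarrow> mcoeff (alphabet_psum (i, r)) a * mcoeff f b) = 0"
    proof clarify
      fix a b assume ab: "(a, b) \<in> splits e" "(a, b) \<notin> ?h ` ?V"
      have "\<not> (\<exists>j. a = Poly_Mapping.single (i, j) r)"
      proof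
        assume "\<exists>j. a = Poly_Mapping.single (i, j) r"
        then obtain j where j: "a = Poly_Mapping.single (i, j) r" ..
        then have e: "e = Poly_Mapping.single (i, j) r + b" using ab by (auto simp: splits_def)
        then have "b = e - Poly_Mapping.single (i, j) r" by simp
        moreover have "(i, j) \<in> ?V" using assms unfolding e by (simp add: in_keys_iff lookup_add)
        ultimately show False using ab(2) j by blast
      qed
      then show "mcoeff (alphabet_psum (i, r)) a * mcoeff f b = 0" by (simp add: alphabet_psum_def mcoeff_Abs)
    qed
  qed
  also have "\<dots> = (\<Sum>v\<in>?V. mcoeff f (e - Poly_Mapping.single v r))"
    by (subst sum.reindex[OF inj]) (auto simp: alphabet_psum_def mcoeff_Abs intro!: sum.cong)
  finally show ?thesis .
qed

lemma exponent_mset_minus_single: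
  assumes "v \<in> Poly_Mapping.keys e" "r > 0" "Poly_Mapping.lookup e v \<ge> r"
  shows "exponent_mset (e - Poly_Mapping.single v r) =
    exponent_mset e - {#(fst v, Poly_Mapping.lookup e v)#} +
    (if Poly_Mapping.lookup e v > r then {#(fst v, Poly_Mapping.lookup e v - r)#} else {#})"
proof -
  let ?e = "e - Poly_Mapping.single v r"
  define K where "K = Poly_Mapping.keys e - {v}"
  have lk: "Poly_Mapping.lookup ?e u = Poly_Mapping.lookup e u - (if u = v then r else 0)" for u
    by (simp add: lookup_minus lookup_single when_def)
  have k: "Poly_Mapping.keys e = insert v K" "finite K" "v \<notin> K" using assms by (auto simp: K_def)
  have k': "Poly_Mapping.keys ?e = (if Poly_Mapping.lookup e v > r then insert v K else K)"
    using assms unfolding in_keys_iff set_eq_iff K_def by (auto simp: lk in_keys_iff simp del: lookup_not_eq_zero_eq_in_keys)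
  have "exponent_mset e = add_mset (fst v, Poly_Mapping.lookup e v)
      (image_mset (\<lambda>v. (fst v, Poly_Mapping.lookup e v)) (mset_set K))"
    unfolding exponent_mset_def k(1) using k(2,3) by simp
  moreover have "image_mset (\<lambda>v. (fst v, Poly_Mapping.lookup ?e v)) (mset_set K) =
     image_mset (\<lambda>v. (fst v, Poly_Mapping.lookup e v)) (mset_set K)"
    by (rule image_mset_cong) (use k(2,3) in \<open>auto simp: lk\<close>)
  then have "exponent_mset ?e = image_mset (\<lambda>v. (fst v, Poly_Mapping.lookup e v)) (mset_set K) +
      (if Poly_Mapping.lookup e v > r then {#(fst v, Poly_Mapping.lookup e v - r)#} else {#})"
    unfolding exponent_mset_def k' using k(2,3) by (simp add: lk)
  ultimately show ?thesis by simp
qed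

lemma sum_mset_count:
  fixes f :: "'b \<Rightarrow> nat"
  assumes "finite S" "set_mset E \<subseteq> S"
  shows "(\<Sum>z\<in>#E. f z) = (\<Sum>z\<in>S. count E z * f z)"
  using assms(2)
proof (induct E)
  case (add x E)
  have "(\<Sum>z\<in>S. count (add_mset x E) z * f z) = (\<Sum>z\<in>S. count E z * f z + (if z = x then f x else 0))"
    by (intro sum.cong) auto
  then show ?case using add assms(1) by (simp add: sum.distrib)
qed simp

text \<open>
  Both sides count ways to relate \<open>C\<close> and \<open>D\<close> by inserting a part of size \<open>r\<close> and colour
  \<open>i\<close>, weighted by multiplicities: on the left one chooses the letter of a monomial of shape
  \<open>D\<close> whose exponent is to be lowered by \<open>r\<close>; on the right one chooses a new letter, or the
  part of \<open>C\<close> that \<open>r\<close> is added to.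
\<close>

lemma merge_count:
  fixes C D :: "(nat \<times> nat) multiset"
  assumes r: "r > 0" and C: "\<And>v. v \<in># C \<Longrightarrow> snd v > 0"
  shows "mult_fact C * (\<Sum>z\<in>#D. of_bool (fst z = i \<and> snd z \<ge> r \<and>
            D - {#z#} + (if snd z > r then {#(fst z, snd z - r)#} else {#}) = C)) =
         mult_fact D * (of_bool (D = add_mset (i, r) C) +
            (\<Sum>y\<in>#filter_mset (\<lambda>y. i = fst y) C. of_bool (D = add_mset (i, r + snd y) (C - {#y#}))))"
proof -
  define P1 where "P1 z \<longleftrightarrow> z = (i, r) \<and> D - {#z#} = C" for z
  define P2 where "P2 z \<longleftrightarrow> fst z = i \<and> snd z > r \<and> add_mset (i, snd z - r) (D - {#z#}) = C" for z
  define Q where "Q y \<longleftrightarrow> fst y = i \<and> D = add_mset (i, r + snd y) (C - {#y#})" for y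
  have sm: "(\<Sum>z\<in>#E. f z) = (\<Sum>z\<in>set_mset E. count E z * f z)" for E and f :: "nat \<times> nat \<Rightarrow> nat"
    by (rule sum_mset_count) auto
  have "(\<Sum>z\<in>#D. of_bool (fst z = i \<and> snd z \<ge> r \<and>
            D - {#z#} + (if snd z > r then {#(fst z, snd z - r)#} else {#}) = C)) =
        (\<Sum>z\<in>#D. of_bool (P1 z) + (of_bool (P2 z) :: nat))"
  proof (intro arg_cong[of _ _ sum_mset] image_mset_cong)
    fix z assume "z \<in># D"
    obtain a b where z: "z = (a, b)" by force
    consider "b < r" | "b = r" | "b > r" by linarith
    then show "of_bool (fst z = i \<and> snd z \<ge> r \<and>
            D - {#z#} + (if snd z > r then {#(fst z, snd z - r)#} else {#}) = C) =
        of_bool (P1 z) + (of_bool (P2 z) :: nat)"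
      by cases (auto simp: z P1_def P2_def)
  qed
  also have "\<dots> = (\<Sum>z\<in>#D. of_bool (P1 z)) + (\<Sum>z\<in>#D. of_bool (P2 z))"
    by (rule sum_mset.distrib)
  finally have eq: "(\<Sum>z\<in>#D. of_bool (fst z = i \<and> snd z \<ge> r \<and>
            D - {#z#} + (if snd z > r then {#(fst z, snd z - r)#} else {#}) = C)) =
     (\<Sum>z\<in>#D. of_bool (P1 z)) + (\<Sum>z\<in>#D. (of_bool (P2 z) :: nat))" .
  have 1: "mult_fact C * (\<Sum>z\<in>#D. of_bool (P1 z)) = mult_fact D * of_bool (D = add_mset (i, r) C)"
  proof -
    have "(\<Sum>z\<in>#D. of_bool (P1 z)) = (\<Sum>z\<in>#D. if z = (i, r) then of_bool (D - {#(i, r)#} = C) else (0::nat))"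
      by (intro arg_cong[of _ _ sum_mset] image_mset_cong) (auto simp: P1_def)
    also have "\<dots> = of_bool (D - {#(i, r)#} = C) * count D (i, r)"
      by (subst sum_mset_delta) simp
    also have "mult_fact C * \<dots> = mult_fact D * of_bool (D = add_mset (i, r) C)"
    proof (cases "(i, r) \<in># D")
      case True
      then obtain E where "D = add_mset (i, r) E" by (rule mset_add)
      then show ?thesis by (auto simp: mult_fact_add)
    next
      case False
      then have "count D (i, r) = 0" "D \<noteq> add_mset (i, r) C" by (auto simp: not_in_iff)
      then show ?thesis by simp
    qed
    finally show ?thesis .
  qed
  have filt: "(\<Sum>y\<in>#filter_mset R M. f y) = (\<Sum>y\<in>#M. if R y then f y else 0)" for R M and f :: "nat \<times> nat \<Rightarrow> nat"
    by (induct M) auto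
  have "mult_fact C * (\<Sum>z\<in>#D. of_bool (P2 z)) = (\<Sum>z\<in>set_mset D. mult_fact C * (count D z * of_bool (P2 z)))"
    unfolding sm sum_distrib_left ..
  also have "\<dots> = (\<Sum>z\<in>{z\<in>set_mset D. P2 z}. mult_fact C * count D z)"
    by (rule sum.mono_neutral_cong_right) auto
  also have "\<dots> = (\<Sum>y\<in>{y\<in>set_mset C. Q y}. mult_fact D * count C y)"
  proof (rule sum.reindex_bij_witness[where i = "\<lambda>y. (i, r + snd y)" and j = "\<lambda>z. (i, snd z - r)"])
    fix z assume z: "z \<in> {z\<in>set_mset D. P2 z}"
    then obtain E where E: "D = add_mset z E" by (auto elim: mset_add)
    from z have P: "z = (i, snd z)" "snd z > r" "C = add_mset (i, snd z - r) E"
      by (auto simp: P2_def E prod_eq_iff)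
    show "(i, r + snd (i, snd z - r)) = z" using P by simp
    show "(i, snd z - r) \<in> {y\<in>set_mset C. Q y}" using P by (simp add: Q_def E)
    show "mult_fact D * count C (i, snd z - r) = mult_fact C * count D z"
      unfolding E P(3) mult_fact_add by (simp add: algebra_simps)
  next
    fix y assume y: "y \<in> {y\<in>set_mset C. Q y}"
    then obtain E where E: "C = add_mset y E" by (auto elim: mset_add)
    have pos: "snd y > 0" using C y by auto
    have Q: "y = (i, snd y)" "D = add_mset (i, r + snd y) E" using y by (auto simp: Q_def E prod_eq_iff)
    show "(i, snd (i, r + snd y) - r) = y" using Q by simp
    show "(i, r + snd y) \<in> {z\<in>set_mset D. P2 z}" using Q pos by (simp add: P2_def E)
  qed
  also have "\<dots> = (\<Sum>y\<in>set_mset C. mult_fact D * (count C y * of_bool (Q y)))"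
    by (rule sum.mono_neutral_cong_left) auto
  also have "\<dots> = mult_fact D * (\<Sum>y\<in>#C. of_bool (Q y))"
    unfolding sm sum_distrib_left ..
  also have "(\<Sum>y\<in>#C. (of_bool (Q y) :: nat)) =
      (\<Sum>y\<in>#filter_mset (\<lambda>y. i = fst y) C. of_bool (D = add_mset (i, r + snd y) (C - {#y#})))"
    unfolding Q_def by (subst filt) (intro arg_cong[of _ _ sum_mset] image_mset_cong, auto)
  finally have 2: "mult_fact C * (\<Sum>z\<in>#D. of_bool (P2 z)) =
    mult_fact D * (\<Sum>y\<in>#filter_mset (\<lambda>y. i = fst y) C. of_bool (D = add_mset (i, r + snd y) (C - {#y#})))" .
  show ?thesis unfolding eq distrib_left 1 2 ..
qed

definition aug_mono_series :: "(nat \<times> nat) multiset \<Rightarrow> (nat \<times> nat, 'k::comm_ring_1) mfps" where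
  "aug_mono_series C = Abs_mfps (\<lambda>e. if exponent_mset e = C then of_nat (mult_fact C) else 0)"

lemma aug_mono_series_altdef: "aug_mono_series C = mscale (of_nat (mult_fact C)) (mono_series C)"
  by (rule mfps_eqI) (simp add: aug_mono_series_def mono_series_def mcoeff_mscale mcoeff_Abs)

lemma mcoeff_aug_mono_series: "mcoeff (aug_mono_series C) e = of_nat (mult_fact C * of_bool (exponent_mset e = C))"
  by (simp add: aug_mono_series_def mcoeff_Abs)

lemma sum_keys_exponent_mset: "(\<Sum>v\<in>Poly_Mapping.keys e. f (fst v, Poly_Mapping.lookup e v)) = (\<Sum>z\<in>#exponent_mset e. f z)"
  by (simp add: exponent_mset_def sum_unfold_sum_mset image_mset.compositionality o_def)

text \<open>
  A monomial of the product arises by raising the exponent of one letter by \<open>r\<close>, and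
  \<open>merge_count\<close> counts the ways in which this yields a given monomial.
\<close>

lemma alphabet_psum_aug_mono_series:
  assumes r: "r > 0" and C: "\<And>v. v \<in># C \<Longrightarrow> snd v > 0"
  shows "alphabet_psum (i, r) * aug_mono_series C = (aug_mono_series (add_mset (i, r) C) :: (nat \<times> nat, 'k::comm_ring_1) mfps) +
     (\<Sum>y\<in>#filter_mset (\<lambda>y. i = fst y) C. aug_mono_series (add_mset (i, r + snd y) (C - {#y#})))"
proof (rule mfps_eqI)
  fix e :: "nat \<times> nat \<Rightarrow>\<^sub>0 nat"
  let ?D = "exponent_mset e"
  have msum: "mcoeff (\<Sum>y\<in>#M. f y) e = (\<Sum>y\<in>#M. mcoeff (f y) e)" for M and f :: "nat \<times> nat \<Rightarrow> (nat \<times> nat, 'k) mfps"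
    by (induct M) (simp_all add: mcoeff_0 mcoeff_add)
  let ?F = "\<lambda>z. fst z = i \<and> snd z \<ge> r"
  let ?G = "\<lambda>z. ?D - {#z#} + (if snd z > r then {#(fst z, snd z - r)#} else {#}) = C"
  have "mcoeff (alphabet_psum (i, r) * (aug_mono_series C :: (nat \<times> nat, 'k) mfps)) e =
      (\<Sum>v\<in>{v\<in>Poly_Mapping.keys e. fst v = i \<and> Poly_Mapping.lookup e v \<ge> r}.
          of_nat (mult_fact C * of_bool (?G (fst v, Poly_Mapping.lookup e v))))"
    unfolding mcoeff_alphabet_psum_times[OF r]
  proof (intro sum.cong refl)
    fix v assume v: "v \<in> {v\<in>Poly_Mapping.keys e. fst v = i \<and> Poly_Mapping.lookup e v \<ge> r}"
    then have "exponent_mset (e - Poly_Mapping.single v r) =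
       ?D - {#(fst v, Poly_Mapping.lookup e v)#} +
      (if Poly_Mapping.lookup e v > r then {#(fst v, Poly_Mapping.lookup e v - r)#} else {#})"
      by (intro exponent_mset_minus_single[OF _ r]) auto
    then show "mcoeff (aug_mono_series C) (e - Poly_Mapping.single v r) =
       of_nat (mult_fact C * of_bool (?G (fst v, Poly_Mapping.lookup e v)))"
      by (simp only: mcoeff_aug_mono_series fst_conv snd_conv)
  qed
  also have "\<dots> = (\<Sum>v\<in>Poly_Mapping.keys e. of_nat (mult_fact C * of_bool (?F (fst v, Poly_Mapping.lookup e v) \<and> ?G (fst v, Poly_Mapping.lookup e v))))"
    by (rule sum.mono_neutral_cong_left) auto
  also have "\<dots> = of_nat (mult_fact C * (\<Sum>z\<in>#?D. of_bool (?F z \<and> ?G z)))"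
    unfolding sum_keys_exponent_mset[of "\<lambda>z. of_nat (mult_fact C * of_bool (?F z \<and> ?G z))"] sum_mset_distrib_left of_nat_sum_mset
    by (simp only: image_mset.compositionality o_def)
  also have "mult_fact C * (\<Sum>z\<in>#?D. of_bool (?F z \<and> ?G z)) = mult_fact ?D * (of_bool (?D = add_mset (i, r) C) +
            (\<Sum>y\<in>#filter_mset (\<lambda>y. i = fst y) C. of_bool (?D = add_mset (i, r + snd y) (C - {#y#}))))"
    unfolding conj_assoc by (rule merge_count[OF r C])
  also have "\<dots> = mult_fact (add_mset (i, r) C) * of_bool (?D = add_mset (i, r) C) +
      (\<Sum>y\<in>#filter_mset (\<lambda>y. i = fst y) C. mult_fact (add_mset (i, r + snd y) (C - {#y#})) * of_bool (?D = add_mset (i, r + snd y) (C - {#y#})))"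
    unfolding distrib_left sum_mset_distrib_left
    by (intro arg_cong2[where f = "(+)"] arg_cong[of _ _ sum_mset] image_mset_cong) auto
  finally show "mcoeff (alphabet_psum (i, r) * aug_mono_series C) e = mcoeff ((aug_mono_series (add_mset (i, r) C) :: (nat \<times> nat, 'k) mfps) +
     (\<Sum>y\<in>#filter_mset (\<lambda>y. i = fst y) C. aug_mono_series (add_mset (i, r + snd y) (C - {#y#})))) e"
    by (simp add: mcoeff_add msum mcoeff_aug_mono_series image_mset.compositionality o_def)
qed

lemma keys_empty_iff: "Poly_Mapping.keys e = {} \<longleftrightarrow> e = 0"
  by (auto simp: poly_mapping_eq_iff fun_eq_iff in_keys_iff)

lemma exponent_mset_empty_iff: "exponent_mset e = {#} \<longleftrightarrow> e = 0"
  by (simp add: exponent_mset_def mset_set_empty_iff keys_empty_iff)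

text \<open>
  The series satisfy the recursion that defines \<open>aug_mono\<close>.
\<close>

lemma aug_mono_alphabet_psum:
  assumes "\<And>v. v \<in> set L \<Longrightarrow> snd v > 0"
  shows "aug_mono alphabet_psum L = (aug_mono_series (mset L) :: (nat \<times> nat, 'k::comm_ring_1) mfps)"
  using assms
proof (induct L rule: length_induct')
  case (1 L)
  show ?case
  proof (cases L)
    case Nil
    show ?thesis
      by (rule mfps_eqI) (simp add: Nil mcoeff_1 mcoeff_aug_mono_series exponent_mset_empty_iff mult_fact_def)
  next
    case (Cons x A)
    have M: "aug_mono alphabet_psum M = (aug_mono_series (mset M) :: (nat \<times> nat, 'k) mfps)" if "M \<in> set (merges x A)" for M
    proof (rule 1(1))
      show "length M < length L" using that Cons by (auto dest: length_merges)
      have "mset M \<in># mset (map mset (merges x A))" using that by simp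
      then obtain y where y: "y \<in># mset A" "mset M = add_mset (fst x, snd x + snd y) (mset A - {#y#})"
        unfolding merges_mset by auto
      show "snd v > 0" if "v \<in> set M" for v
      proof -
        have "v = (fst x, snd x + snd y) \<or> v \<in># mset A"
          using that y(2) by (metis in_diffD insert_iff set_mset_add_mset_insert set_mset_mset)
        then show ?thesis using 1(2)[of x] 1(2)[of v] Cons by auto
      qed
    qed
    have "(\<Sum>M\<leftarrow>merges x A. aug_mono alphabet_psum M) =
        (\<Sum>y\<in>#filter_mset (\<lambda>y. fst x = fst y) (mset A).
            (aug_mono_series (add_mset (fst x, snd x + snd y) (mset A - {#y#})) :: (nat \<times> nat, 'k) mfps))"
      by (rule sum_list_merges_cong[where g = aug_mono_series]) (rule M)
    moreover have "aug_mono alphabet_psum A = (aug_mono_series (mset A) :: (nat \<times> nat, 'k) mfps)" using 1 Cons by simp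
    moreover have "alphabet_psum (fst x, snd x) * aug_mono_series (mset A) = (aug_mono_series (add_mset (fst x, snd x) (mset A)) +
       (\<Sum>y\<in>#filter_mset (\<lambda>y. fst x = fst y) (mset A). aug_mono_series (add_mset (fst x, snd x + snd y) (mset A - {#y#}))) :: (nat \<times> nat, 'k) mfps)"
      using 1(2) Cons by (intro alphabet_psum_aug_mono_series) auto
    ultimately show ?thesis by (simp add: Cons)
  qed
qed

lemma exponent_mset_add:
  assumes "Poly_Mapping.keys a \<inter> Poly_Mapping.keys b = {}"
  shows "exponent_mset (a + b) = exponent_mset a + exponent_mset b"
proof -
  have k: "Poly_Mapping.keys (a + b) = Poly_Mapping.keys a \<union> Poly_Mapping.keys b"
    by (auto simp: in_keys_iff lookup_add simp del: lookup_not_eq_zero_eq_in_keys)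
  have "mset_set (Poly_Mapping.keys a \<union> Poly_Mapping.keys b) =
    mset_set (Poly_Mapping.keys a) + mset_set (Poly_Mapping.keys b)"
    using assms by (intro mset_set_Union) auto
  moreover have "image_mset (\<lambda>v. (fst v, Poly_Mapping.lookup (a + b) v)) (mset_set (Poly_Mapping.keys a)) = exponent_mset a"
    "image_mset (\<lambda>v. (fst v, Poly_Mapping.lookup (a + b) v)) (mset_set (Poly_Mapping.keys b)) = exponent_mset b"
    unfolding exponent_mset_def using assms by (auto intro!: image_mset_cong simp: lookup_add in_keys_iff)
  ultimately show ?thesis by (simp add: exponent_mset_def[of "a + b"] k)
qed

lemma set_exponent_mset: "fst ` set_mset (exponent_mset e) = fst ` Poly_Mapping.keys e"
  by (simp add: exponent_mset_def image_image)

lemma ex_exponent_mset: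
  assumes "\<And>v. v \<in># C \<Longrightarrow> snd v > 0"
  shows "\<exists>e :: nat \<times> nat \<Rightarrow>\<^sub>0 nat. exponent_mset e = C"
  using assms
proof (induct C)
  case empty
  then show ?case by (intro exI[of _ 0]) (simp add: exponent_mset_empty_iff)
next
  case (add x C)
  then obtain e :: "nat \<times> nat \<Rightarrow>\<^sub>0 nat" where e: "exponent_mset e = C" by auto
  obtain i r where x: "x = (i, r)" by force
  have r: "r > 0" using add(2)[of x] x by simp
  obtain j where j: "j \<notin> snd ` Poly_Mapping.keys e"
    using ex_new_if_finite[of "snd ` Poly_Mapping.keys e"] by auto
  have "exponent_mset (Poly_Mapping.single (i, j) r) = {#x#}"
    using r by (simp add: exponent_mset_def x)
  moreover have "exponent_mset (Poly_Mapping.single (i, j) r + e) = exponent_mset (Poly_Mapping.single (i, j) r) + exponent_mset e"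
    using j by (intro exponent_mset_add) (force simp: image_iff)
  ultimately show ?case using e by (intro exI[of _ "Poly_Mapping.single (i, j) r + e"]) simp
qed

lemma filter_mset_left:
  assumes "\<And>v. v \<in># A \<Longrightarrow> P v" "\<And>v. v \<in># B \<Longrightarrow> \<not> P v"
  shows "filter_mset P (A + B) = A"
proof -
  have "filter_mset P A = A" using filter_mset_cong0[of A P "\<lambda>_. True"] assms(1) by simp
  moreover have "filter_mset P B = {#}" using assms(2) by simp
  ultimately show ?thesis by simp
qed

lemma mono_series_times_mono_series:
  assumes "fst ` set_mset C \<inter> fst ` set_mset D = {}"
  shows "mono_series C * mono_series D = (mono_series (C + D) :: (nat \<times> nat, 'k::comm_ring_1) mfps)"
proof (rule mfps_eqI)
  fix e :: "nat \<times> nat \<Rightarrow>\<^sub>0 nat"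
  define res where "res S = Poly_Mapping.mapp (\<lambda>k v. if fst k \<in> S then v else 0) e" for S
  have lres: "Poly_Mapping.lookup (res S) v = (if fst v \<in> S then Poly_Mapping.lookup e v else 0)" for S v
    by (auto simp: res_def lookup_mapp when_def in_keys_iff)
  let ?a = "res (fst ` set_mset C)" and ?b = "res (- (fst ` set_mset C))"
  have ab: "?a + ?b = e"
    by (intro poly_mapping_eqI) (simp add: lookup_add lres)
  have uniq: "a = ?a \<and> b = ?b" if "a + b = e" "exponent_mset a = C" "exponent_mset b = D" for a b
  proof -
    have ka: "Poly_Mapping.lookup a v = 0" if "fst v \<notin> fst ` set_mset C" for v
      using that set_exponent_mset[of a] unfolding \<open>exponent_mset a = C\<close> by (auto simp: image_iff in_keys_iff)
    have kb: "Poly_Mapping.lookup b v = 0" if "fst v \<notin> fst ` set_mset D" for v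
      using that set_exponent_mset[of b] unfolding \<open>exponent_mset b = D\<close> by (auto simp: image_iff in_keys_iff)
    have le: "Poly_Mapping.lookup e v = Poly_Mapping.lookup a v + Poly_Mapping.lookup b v" for v
      using \<open>a + b = e\<close> by (auto simp: lookup_add)
    have "Poly_Mapping.lookup a v = Poly_Mapping.lookup ?a v \<and> Poly_Mapping.lookup b v = Poly_Mapping.lookup ?b v" for v
    proof (cases "fst v \<in> fst ` set_mset C")
      case True
      then have "fst v \<notin> fst ` set_mset D" using assms by blast
      then show ?thesis using True kb[of v] by (simp add: lres le)
    next
      case False
      then show ?thesis using ka[of v] by (simp add: lres le)
    qed
    then show ?thesis by (simp add: poly_mapping_eq_iff fun_eq_iff)
  qed
  have "mcoeff (mono_series C * mono_series D :: (nat \<times> nat, 'k) mfps) e = (\<Sum>(a, b)\<in>splits e. if (a, b) = (?a, ?b) then (if exponent_mset ?a = C \<and> exponent_mset ?b = D then 1 else 0 :: 'k) else 0)"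
    unfolding mcoeff_times mono_series_def mcoeff_Abs
  proof (intro sum.cong refl, clarify)
    fix a b assume "(a, b) \<in> splits e"
    then have "a + b = e" by (simp add: splits_def)
    show "(if exponent_mset a = C then 1 else 0 :: 'k) * (if exponent_mset b = D then 1 else 0) =
      (if (a, b) = (?a, ?b) then if exponent_mset ?a = C \<and> exponent_mset ?b = D then 1 else 0 else 0)"
    proof (cases "exponent_mset a = C \<and> exponent_mset b = D")
      case True
      then show ?thesis using uniq[OF \<open>a + b = e\<close>] by simp
    next
      case False
      then show ?thesis by (cases "(a, b) = (?a, ?b)") auto
    qed
  qed
  also have "\<dots> = (\<Sum>x\<in>splits e. if x = (?a, ?b) then (if exponent_mset ?a = C \<and> exponent_mset ?b = D then 1 else 0) else 0)"
    by (simp only: case_prod_unfold prod.collapse)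
  also have "\<dots> = (if exponent_mset ?a = C \<and> exponent_mset ?b = D then 1 else 0)"
    using ab by (subst sum.delta[OF finite_splits]) (simp add: splits_def)
  also have "\<dots> = (if exponent_mset e = C + D then 1 else 0)"
  proof -
    have "Poly_Mapping.keys ?a \<inter> Poly_Mapping.keys ?b = {}"
      by (auto simp: in_keys_iff lres split: if_splits)
    then have "exponent_mset e = exponent_mset ?a + exponent_mset ?b" using exponent_mset_add ab by metis
    moreover have "exponent_mset ?a = C \<and> exponent_mset ?b = D" if e: "exponent_mset e = C + D"
    proof -
      have "exponent_mset ?a = filter_mset (\<lambda>v. fst v \<in> fst ` set_mset C) (exponent_mset ?a + exponent_mset ?b)"
      proof -
        have "fst v \<in> fst ` set_mset C" if "v \<in># exponent_mset ?a" for v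
          using that by (auto simp: exponent_mset_def in_keys_iff lres split: if_splits)
        moreover have "fst v \<notin> fst ` set_mset C" if vb: "v \<in># exponent_mset ?b" for v
        proof -
          obtain u where u: "u \<in> Poly_Mapping.keys ?b" "fst v = fst u"
            using vb by (auto simp: exponent_mset_def)
          then show ?thesis by (simp add: in_keys_iff lres split: if_splits)
        qed
        ultimately show ?thesis
          by (rule filter_mset_left[symmetric])
      qed
      also have "\<dots> = filter_mset (\<lambda>v. fst v \<in> fst ` set_mset C) (C + D)"
        using e calculation \<open>exponent_mset e = exponent_mset ?a + exponent_mset ?b\<close> by simp
      also have "\<dots> = C"
        using assms by (intro filter_mset_left) auto
      finally have "exponent_mset ?a = C" .
      then show ?thesis using e \<open>exponent_mset e = exponent_mset ?a + exponent_mset ?b\<close> by simp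
    qed
    ultimately show ?thesis by auto
  qed
  finally show "mcoeff (mono_series C * mono_series D) e = mcoeff (mono_series (C + D) :: (nat \<times> nat, 'k) mfps) e"
    by (simp add: mono_series_def mcoeff_Abs)
qed

text \<open>
  The generators go to the power sums, by way of the power sums of the single alphabets.
\<close>

definition theta :: "'k::comm_ring_1 pring \<Rightarrow> (nat \<times> nat, 'k) mfps" where
  "theta = alphabet_subst mconst alphabet_psum"

lemma rhom_theta: "rhom theta"
  unfolding theta_def by (rule rhom_alphabet_subst[OF rhom_mconst])

lemma theta_cst: "theta (cst c * f) = mscale c (theta f)"
  by (simp add: rhom_mult[OF rhom_theta] mconst_times) (simp add: theta_def alphabet_subst_cst rhom_mconst mconst_times)

lemma theta_amono: "(\<And>v. v \<in> set L \<Longrightarrow> snd v > 0) \<Longrightarrow> theta (amono L) = aug_mono_series (mset L)"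
  by (simp add: theta_def alphabet_subst_amono[OF rhom_mconst] aug_mono_alphabet_psum)

lemma theta_gen: "r > 0 \<Longrightarrow> theta (gen (k, r)) = power_sum k r"
proof (rule mfps_eqI)
  fix e :: "nat \<times> nat \<Rightarrow>\<^sub>0 nat"
  assume r: "r > 0"
  have s: "mcoeff (\<Sum>i\<in>A. f i) e = (\<Sum>i\<in>A. mcoeff (f i) e)" for A and f :: "nat \<Rightarrow> mseries"
    by (induct A rule: infinite_finite_induct) (simp_all add: mcoeff_0 mcoeff_add)
  have "theta (gen (k, r)) = (\<Sum>i\<le>k. (alphabet_psum (i, r) :: mseries))"
    unfolding gen_sum_alphabet_gen theta_def by (simp add: rhom_sum[OF rhom_alphabet_subst] rhom_mconst alphabet_subst_alphabet_gen)
  then have "mcoeff (theta (gen (k, r))) e = (\<Sum>i\<le>k. if \<exists>j. e = Poly_Mapping.single (i, j) r then 1 else 0 :: qt_field)"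
    by (simp add: s alphabet_psum_def mcoeff_Abs)
  also have "\<dots> = (if \<exists>i\<le>k. \<exists>j. e = Poly_Mapping.single (i, j) r then 1 else 0)"
  proof (cases "\<exists>i\<le>k. \<exists>j. e = Poly_Mapping.single (i, j) r")
    case True
    then obtain i j where ij: "i \<le> k" "e = Poly_Mapping.single (i, j) r" by blast
    have "(\<exists>j'. e = Poly_Mapping.single (i', j') r) \<longleftrightarrow> i' = i" for i'
    proof
      assume "\<exists>j'. e = Poly_Mapping.single (i', j') r"
      then obtain j' where "e = Poly_Mapping.single (i', j') r" ..
      then have "Poly_Mapping.keys (Poly_Mapping.single (i', j') r) = Poly_Mapping.keys (Poly_Mapping.single (i, j) r)"
        using ij by simp
      then show "i' = i" using r by simp
    qed (use ij in blast)
    then show ?thesis using True ij by simp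
  next
    case False
    then have "(\<Sum>i\<le>k. if \<exists>j. e = Poly_Mapping.single (i, j) r then 1 else 0 :: qt_field) = (\<Sum>i\<le>k. 0)"
      by (intro sum.cong) auto
    then show ?thesis using False by simp
  qed
  finally show "mcoeff (theta (gen (k, r))) e = mcoeff (power_sum k r) e"
    by (simp add: power_sum_def mcoeff_Abs)
qed

text \<open>
  Read as a monomial of the polynomial ring this multiset stands for \<open>p_\<Lambda>\<close>, and read
  as a multiset of coloured exponents it stands for \<open>m_\<Lambda>\<close>.
\<close>

definition parts_mset :: "nat \<Rightarrow> nat list list \<Rightarrow> (nat \<times> nat) multiset" where
  "parts_mset n \<Lambda> = (\<Sum>i<n. image_mset (Pair i) (mset (\<Lambda> ! i)))"

lemma monomial_sym_mono_series: "monomial_sym i \<nu> = mono_series (image_mset (Pair i) (mset \<nu>))"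
proof (rule mfps_eqI)
  fix e :: "nat \<times> nat \<Rightarrow>\<^sub>0 nat"
  have "fst ` Poly_Mapping.keys e \<subseteq> {i} \<and>
        image_mset (Poly_Mapping.lookup e) (mset_set (Poly_Mapping.keys e)) = mset \<nu> \<longleftrightarrow>
        exponent_mset e = image_mset (Pair i) (mset \<nu>)" (is "?L \<longleftrightarrow> ?R")
  proof
    assume L: ?L
    have "exponent_mset e = image_mset (Pair i) (image_mset (Poly_Mapping.lookup e) (mset_set (Poly_Mapping.keys e)))"
      unfolding exponent_mset_def image_mset.compositionality
      by (rule image_mset_cong) (use L in auto)
    with L show ?R by simp
  next
    assume R: ?R
    have "image_mset snd (exponent_mset e) = image_mset (Poly_Mapping.lookup e) (mset_set (Poly_Mapping.keys e))"
      by (simp add: exponent_mset_def image_mset.compositionality o_def)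
    moreover have "image_mset snd (exponent_mset e) = mset \<nu>"
      unfolding R by (simp add: image_mset.compositionality o_def)
    moreover have "fst ` Poly_Mapping.keys e \<subseteq> {i}"
      unfolding set_exponent_mset[symmetric] R by auto
    ultimately show ?L by simp
  qed
  then show "mcoeff (monomial_sym i \<nu>) e = mcoeff (mono_series (image_mset (Pair i) (mset \<nu>))) e"
    by (simp add: monomial_sym_def mono_series_def mcoeff_Abs)
qed

lemma multi_m_mono_series: "multi_m n \<Lambda> = mono_series (parts_mset n \<Lambda>)"
proof -
  have "(\<Prod>i<k. monomial_sym i (\<Lambda> ! i)) = mono_series (parts_mset k \<Lambda>)" for k
  proof (induct k)
    case 0
    show ?case
      by (rule mfps_eqI) (auto simp: parts_mset_def mono_series_def mcoeff_Abs mcoeff_1 exponent_mset_empty_iff)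
  next
    case (Suc k)
    have "fst ` set_mset (parts_mset k \<Lambda>) \<inter> fst ` set_mset (image_mset (Pair k) (mset (\<Lambda> ! k))) = {}"
      by (auto simp: parts_mset_def set_mset_sum)
    from mono_series_times_mono_series[OF this] have "mono_series (parts_mset k \<Lambda>) * monomial_sym k (\<Lambda> ! k) = mono_series (parts_mset (Suc k) \<Lambda>)"
      by (simp add: monomial_sym_mono_series) (simp add: parts_mset_def)
    with Suc show ?case by simp
  qed
  then show ?thesis by (simp add: multi_m_def)
qed

lemma multi_p_theta:
  assumes "\<And>v. v \<in># parts_mset n \<Lambda> \<Longrightarrow> snd v > 0"
  shows "multi_p n \<Lambda> = theta (Poly_Mapping.single (parts_mset n \<Lambda>) 1)"
proof -
  have "theta (\<Prod>v\<in>#parts_mset k \<Lambda>. gen v) = (\<Prod>i<k. \<Prod>r\<leftarrow>\<Lambda> ! i. power_sum i r)" if "k \<le> n" for k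
    using that
  proof (induct k)
    case 0
    show ?case by (simp add: parts_mset_def rhom_1[OF rhom_theta])
  next
    case (Suc k)
    have pos: "r > 0" if "r \<in> set (\<Lambda> ! k)" for r
    proof -
      have "(k, r) \<in># parts_mset n \<Lambda>"
        using that Suc(2) by (auto simp: parts_mset_def set_mset_sum intro!: bexI[of _ k])
      from assms[OF this] show ?thesis by simp
    qed
    have "theta (\<Prod>v\<in>#image_mset (Pair k) (mset (\<Lambda> ! k)). gen v) = (\<Prod>r\<leftarrow>\<Lambda> ! k. theta (gen (k, r)))"
      unfolding rhom_prod_mset[OF rhom_theta] by (simp flip: prod_mset_prod_list add: image_mset.compositionality o_def)
    also have "\<dots> = (\<Prod>r\<leftarrow>\<Lambda> ! k. power_sum k r)"
      by (intro arg_cong[of _ _ prod_list] map_cong refl theta_gen pos)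
    finally show ?case using Suc
      by (simp add: parts_mset_def rhom_mult[OF rhom_theta])
  qed
  from this[of n] show ?thesis by (simp add: multi_p_def prod_gen)
qed

section \<open>Coordinates with respect to the monomial symmetric functions\<close>

definition index_set :: "nat \<Rightarrow> (nat \<times> nat) multiset set" where
  "index_set n = {C. \<forall>v\<in>#C. fst v < n \<and> snd v > 0}"

definition some_list :: "'b multiset \<Rightarrow> 'b list" where
  "some_list C = (SOME L. mset L = C)"

lemma mset_some_list [simp]: "mset (some_list C) = C"
  unfolding some_list_def by (rule someI_ex, rule ex_mset)

lemma amono_some_list: "amono (some_list (mset L)) = amono L"
  unfolding amono_def by (rule aug_mono_perm) simp

text \<open>
  A symmetric series is a combination of orbit sums, whose coefficients can be read off at
  one monomial of each orbit, whichever is chosen.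
\<close>

definition mcoord :: "(nat \<times> nat) multiset \<Rightarrow> 'k::field_char_0 pring \<Rightarrow> 'k" where
  "mcoord C f = mcoeff (theta f) (SOME e. exponent_mset e = C) / of_nat (mult_fact C)"

lemma mcoord_amono:
  assumes C: "\<And>v. v \<in># C \<Longrightarrow> snd v > 0" and L: "\<And>v. v \<in> set L \<Longrightarrow> snd v > 0"
  shows "mcoord C (amono L) = of_bool (mset L = C)"
proof -
  have e: "exponent_mset (SOME e :: nat \<times> nat \<Rightarrow>\<^sub>0 nat. exponent_mset e = C) = C"
    using someI_ex[OF ex_exponent_mset[OF C]] by simp
  have "of_nat (mult_fact C) \<noteq> (0::'a)" using mult_fact_pos[of C] by simp
  moreover have "theta (amono L :: 'a pring) = aug_mono_series (mset L)" by (rule theta_amono) (rule L)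
  ultimately show ?thesis by (simp add: mcoord_def mcoeff_aug_mono_series e)
qed

lemma mcoord_add: "mcoord C (f + g) = mcoord C f + mcoord C g"
  by (simp add: mcoord_def rhom_add[OF rhom_theta] mcoeff_add add_divide_distrib)

lemma mcoord_0: "mcoord C 0 = 0"
  by (simp add: mcoord_def rhom_0[OF rhom_theta] mcoeff_0)

lemma mcoord_diff: "mcoord C (f - g) = mcoord C f - mcoord C g"
  by (simp add: mcoord_def rhom_diff[OF rhom_theta] mcoeff_diff diff_divide_distrib)

lemma mcoord_cst: "mcoord C (cst c * f) = c * mcoord C f"
  by (simp add: mcoord_def theta_cst mcoeff_mscale)

lemma mcoord_sum_list: "mcoord C (\<Sum>x\<leftarrow>xs. f x) = (\<Sum>x\<leftarrow>xs. mcoord C (f x))"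
  by (induct xs) (simp_all add: mcoord_0 mcoord_add)

global_interpretation pr: vector_space "\<lambda>(c::'k::field) (f::'k pring). cst c * f"
  by standard (simp_all add: rhom_add[OF rhom_cst] rhom_mult[OF rhom_cst] algebra_simps)

text \<open>
  Multi-symmetric functions in \<open>n\<close> alphabets: the polynomials in the generators of colour
  below \<open>n\<close> and positive degree.
\<close>

definition Sym :: "nat \<Rightarrow> 'k::field pring set" where
  "Sym n = {f. Poly_Mapping.keys f \<subseteq> index_set n}"

lemma Sym_add: "f \<in> Sym n \<Longrightarrow> g \<in> Sym n \<Longrightarrow> f + g \<in> Sym n"
  using keys_add[of f g] by (auto simp: Sym_def)

lemma Sym_mult: "f \<in> Sym n \<Longrightarrow> g \<in> Sym n \<Longrightarrow> f * g \<in> Sym n"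
  using keys_mult[of f g] by (fastforce simp: Sym_def index_set_def)

lemma Sym_cst: "cst c \<in> Sym n"
  by (simp add: Sym_def cst_def index_set_def)

lemma Sym_gen: "fst v < n \<Longrightarrow> snd v > 0 \<Longrightarrow> gen v \<in> Sym n"
  by (simp add: Sym_def gen_def index_set_def)

lemma Sym_0: "0 \<in> Sym n" and Sym_1: "1 \<in> Sym n"
  using Sym_cst[of 0] Sym_cst[of 1] by auto

lemma Sym_uminus: "f \<in> Sym n \<Longrightarrow> - f \<in> Sym n"
  by (simp add: Sym_def)

lemma Sym_diff: "f \<in> Sym n \<Longrightarrow> g \<in> Sym n \<Longrightarrow> f - g \<in> Sym n"
  using Sym_add[of f n "-g"] Sym_uminus[of g n] by simp

lemma Sym_sum_list: "(\<And>x. x \<in> set xs \<Longrightarrow> f x \<in> Sym n) \<Longrightarrow> (\<Sum>x\<leftarrow>xs. f x) \<in> Sym n"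
  by (induct xs) (auto intro: Sym_add Sym_0)

lemma Sym_alphabet_gen: "fst v < n \<Longrightarrow> snd v > 0 \<Longrightarrow> alphabet_gen v \<in> Sym n"
  unfolding alphabet_gen_def by (auto intro!: Sym_diff Sym_gen Sym_0)

lemma merges_index_set:
  assumes "mset (x # L) \<in> index_set n" "M \<in> set (merges x L)"
  shows "mset M \<in> index_set n"
proof -
  have "mset M \<in># mset (map mset (merges x L))" using assms(2) by simp
  then obtain y where y: "y \<in># mset L" "mset M = add_mset (fst x, snd x + snd y) (mset L - {#y#})"
    unfolding merges_mset by auto
  have "fst v < n \<and> snd v > 0" if "v \<in># mset M" for v
  proof -
    have "v = (fst x, snd x + snd y) \<or> v \<in># mset L"
      using that y(2) by (metis in_diffD insert_iff set_mset_add_mset_insert)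
    then show ?thesis using assms(1) by (auto simp: index_set_def)
  qed
  then show ?thesis by (auto simp: index_set_def)
qed

lemma Sym_amono: "mset L \<in> index_set n \<Longrightarrow> (amono L :: 'k::field pring) \<in> Sym n"
proof (induct L rule: length_induct')
  case (1 L)
  show ?case
  proof (cases L)
    case Nil then show ?thesis by (simp add: amono_def Sym_1)
  next
    case (Cons x A)
    have "(alphabet_gen x :: 'k pring) \<in> Sym n" "mset A \<in> index_set n" using 1(2) Cons by (auto simp: index_set_def intro!: Sym_alphabet_gen)
    moreover have "(amono M :: 'k pring) \<in> Sym n" if "M \<in> set (merges x A)" for M
      by (rule 1(1)) (use that 1(2) Cons merges_index_set[of x A n M] in \<open>auto dest: length_merges\<close>)
    ultimately show ?thesis using 1(1)[of A] Cons
      unfolding amono_def by (auto intro!: Sym_diff Sym_mult Sym_sum_list simp: amono_def)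
  qed
qed

text \<open>
  The span is closed under multiplication by a power sum of one alphabet, by the recursion
  for \<open>aug_mono\<close>; hence it contains every polynomial.
\<close>

lemma Sym_span_amono:
  assumes "f \<in> Sym n"
  shows "(f :: 'k::field pring) \<in> pr.span (amono ` {L. mset L \<in> index_set n})"
proof -
  let ?S = "pr.span (amono ` {L. mset L \<in> index_set n}) :: 'k pring set"
  have x: "alphabet_gen x * g \<in> ?S" if x: "fst x < n" "snd x > 0" and "g \<in> ?S" for x g
    using that(3)
  proof (induct rule: pr.span_induct_alt)
    case base then show ?case by (simp add: pr.span_zero)
  next
    case (step c g h)
    then obtain L where L: "g = amono L" "mset L \<in> index_set n" by auto
    then have xL: "mset (x # L) \<in> index_set n" using x by (auto simp: index_set_def)
    have sl: "(\<Sum>M\<leftarrow>xs. amono M) \<in> ?S" if "\<And>M. M \<in> set xs \<Longrightarrow> mset M \<in> index_set n" for xs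
      using that by (induct xs) (simp_all add: pr.span_add pr.span_base pr.span_zero)
    have "alphabet_gen x * amono L \<in> ?S"
      unfolding alphabet_gen_amono using xL merges_index_set[OF xL] by (intro pr.span_add sl pr.span_base) auto
    then have "cst c * (alphabet_gen x * amono L) + alphabet_gen x * h \<in> ?S" using step by (intro pr.span_add pr.span_scale)
    then show ?case unfolding L(1) by (simp add: algebra_simps)
  qed
  have g: "gen x * g \<in> ?S" if "fst x < n" "snd x > 0" "g \<in> ?S" for x g
  proof -
    have "gen x * g = (\<Sum>i\<le>fst x. alphabet_gen (i, snd x) * g)"
      using gen_sum_alphabet_gen[of "fst x" "snd x", where ?'a = 'k] by (simp add: sum_distrib_right)
    also have "\<dots> \<in> ?S" using that by (intro pr.span_sum x) auto
    finally show ?thesis .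
  qed
  have p: "(\<Prod>v\<in>#C. gen v) \<in> ?S" if "C \<in> index_set n" for C
    using that
  proof (induct C)
    case empty
    have "amono [] \<in> ?S" by (intro pr.span_base) (auto simp: index_set_def)
    then show ?case by (simp add: amono_def)
  next
    case (add v C)
    then have "C \<in> index_set n" "fst v < n" "snd v > 0" by (auto simp: index_set_def)
    then show ?case using add g by simp
  qed
  have "f = (\<Sum>C\<in>Poly_Mapping.keys f. cst (Poly_Mapping.lookup f C) * (\<Prod>v\<in>#C. gen v))"
    unfolding prod_gen cst_def mult_single
    by (rule poly_mapping_eqI) (simp add: lookup_sum lookup_single when_def in_keys_iff)
  also have "\<dots> \<in> ?S"
    by (intro pr.span_sum pr.span_scale p) (use assms in \<open>auto simp: Sym_def\<close>)
  finally show ?thesis .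
qed

lemma Sym_expand:
  fixes f :: "'k::field_char_0 pring"
  assumes "f \<in> Sym n"
  obtains S where "finite S" "S \<subseteq> index_set n" "f = (\<Sum>C\<in>S. cst (mcoord C f) * amono (some_list C))"
    "\<And>C. C \<in> index_set n \<Longrightarrow> C \<notin> S \<Longrightarrow> mcoord C f = 0"
proof -
  let ?P = "\<lambda>f S. finite S \<and> S \<subseteq> index_set n \<and> f = (\<Sum>C\<in>S. cst (mcoord C f) * amono (some_list C)) \<and> (\<forall>C\<in>index_set n - S. mcoord C f = 0)"
  have "\<exists>S. ?P f S"
    using Sym_span_amono[OF assms]
  proof (induct rule: pr.span_induct_alt)
    case base
    show ?case by (intro exI[of _ "{}"]) (simp add: mcoord_0)
  next
    case (step c x g)
    from step(1) obtain L where L: "x = amono L" "mset L \<in> index_set n" by auto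
    from step obtain S where S: "finite S" "S \<subseteq> index_set n" "g = (\<Sum>C\<in>S. cst (mcoord C g) * amono (some_list C))"
      "\<forall>C\<in>index_set n - S. mcoord C g = 0" by auto
    let ?T = "insert (mset L) S"
    have cfL: "mcoord C (cst c * x + g) = c * of_bool (mset L = C) + mcoord C g" if "C \<in> index_set n" for C
      using mcoord_amono[of C L] that L by (auto simp: mcoord_add mcoord_cst index_set_def)
    have "(\<Sum>C\<in>?T. cst (mcoord C (cst c * x + g)) * amono (some_list C)) =
      (\<Sum>C\<in>?T. (if C = mset L then cst c * x else 0) + cst (mcoord C g) * amono (some_list C))"
    proof (intro sum.cong refl)
      fix C assume "C \<in> ?T"
      then have "C \<in> index_set n" using S L by auto
      then show "cst (mcoord C (cst c * x + g)) * amono (some_list C) = (if C = mset L then cst c * x else 0) + cst (mcoord C g) * amono (some_list C)"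
        unfolding cfL[OF \<open>C \<in> index_set n\<close>]
        by (cases "C = mset L") (simp_all add: amono_some_list rhom_add[OF rhom_cst] distrib_right L(1))
    qed
    also have "\<dots> = cst c * x + (\<Sum>C\<in>?T. cst (mcoord C g) * amono (some_list C))"
      using S by (simp add: sum.distrib)
    also have "(\<Sum>C\<in>?T. cst (mcoord C g) * amono (some_list C)) = (\<Sum>C\<in>S. cst (mcoord C g) * amono (some_list C))"
      by (rule sum.mono_neutral_right) (use S L in auto)
    finally have "?P (cst c * x + g) ?T"
      using S L cfL by auto
    then show ?case by blast
  qed
  then show ?thesis using that by blast
qed

section \<open>Plethystic exponentials\<close>

text \<open>
  The coefficients in \<open>z\<close> of \<open>exp (\<Sum>_{r>0} v_r z^r / r)\<close>, computed by the recursion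
  that its logarithmic derivative gives; the map \<open>\<iota>\<close> embeds the rational scalars.
\<close>

fun exp_coeff :: "('k::field_char_0 \<Rightarrow> 'r::comm_ring_1) \<Rightarrow> (nat \<Rightarrow> 'r) \<Rightarrow> nat \<Rightarrow> 'r" where
  "exp_coeff \<iota> v 0 = 1"
| "exp_coeff \<iota> v (Suc b) = \<iota> (1 / of_nat (Suc b)) * (\<Sum>r\<le>b. v (Suc r) * exp_coeff \<iota> v (b - r))"

declare exp_coeff.simps(2) [simp del]

lemma rhom_inv_of_nat: "rhom \<iota> \<Longrightarrow> \<iota> (1 / of_nat (Suc b) :: 'k::field_char_0) * of_nat (Suc b) = 1"
  using rhom_mult[of \<iota> "1 / of_nat (Suc b)" "of_nat (Suc b)"]
  by (simp add: rhom_of_nat rhom_1 del: of_nat_Suc)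

lemma exp_coeff_rec: "rhom \<iota> \<Longrightarrow> of_nat (Suc b) * exp_coeff \<iota> v (Suc b) = (\<Sum>r\<le>b. v (Suc r) * exp_coeff \<iota> v (b - r))"
  using rhom_inv_of_nat[of \<iota> b]
  by (simp add: exp_coeff.simps(2) mult.assoc[symmetric] mult.commute[of "of_nat (Suc b)"] del: of_nat_Suc)

lemma exp_coeff_unique:
  assumes h: "rhom \<iota>" and "F 0 = 1"
    and F: "\<And>b. of_nat (Suc b) * F (Suc b) = (\<Sum>r\<le>b. v (Suc r) * F (b - r))"
  shows "F b = exp_coeff \<iota> v b"
proof (induct b rule: less_induct)
  case (less b)
  show ?case
  proof (cases b)
    case (Suc c)
    have "F (Suc c) = \<iota> (1 / of_nat (Suc c)) * (of_nat (Suc c) * F (Suc c))"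
      using rhom_inv_of_nat[OF h, of c] by (simp only: mult.assoc[symmetric] mult_1)
    also have "\<dots> = exp_coeff \<iota> v (Suc c)"
      unfolding F exp_coeff.simps(2) using less Suc by simp
    finally show ?thesis by (simp add: Suc)
  qed (simp add: assms)
qed

lemma exp_coeff_rhom:
  assumes "rhom h" shows "h (exp_coeff \<iota> v b) = exp_coeff (\<lambda>c. h (\<iota> c)) (\<lambda>r. h (v r)) b"
proof (induct b rule: less_induct)
  case (less b)
  then show ?case
    by (cases b) (simp_all add: exp_coeff.simps(2) rhom_1 rhom_mult rhom_sum assms)
qed

text \<open>
  The power series of \<open>(1 - z Y / \<tau>) / (1 - z Y)\<close>, which is the contribution of a
  letter \<open>Y\<close> to the exponential.
\<close>

definition letter_factor :: "('k::field_char_0 \<Rightarrow> 'r::comm_ring_1) \<Rightarrow> 'k \<Rightarrow> 'r \<Rightarrow> 'r fps" where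
  "letter_factor \<iota> \<tau> Y = Abs_fps (\<lambda>b. if b = 0 then 1 else \<iota> (1 - 1 / \<tau>) * Y ^ b)"

lemma letter_factor_scalar:
  "(1 - \<sigma> ^ Suc b) + (1 - \<sigma>) * (\<Sum>r<b. 1 - \<sigma> ^ Suc r) = of_nat (Suc b) * (1 - \<sigma> :: 'k::field)"
  by (induct b) (simp_all add: algebra_simps)

lemma fps_deriv_letter_factor:
  assumes h: "rhom \<iota>"
  shows "fps_deriv (letter_factor \<iota> \<tau> Y) = Abs_fps (\<lambda>r. \<iota> (1 - (1 / \<tau>) ^ Suc r) * Y ^ Suc r) * letter_factor \<iota> \<tau> Y"
proof (rule fps_ext)
  fix b
  let ?\<sigma> = "1 / \<tau>"
  let ?f = "\<lambda>r. \<iota> (1 - ?\<sigma> ^ Suc r) * Y ^ Suc r * fps_nth (letter_factor \<iota> \<tau> Y) (b - r)"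
  have "fps_nth (Abs_fps (\<lambda>r. \<iota> (1 - ?\<sigma> ^ Suc r) * Y ^ Suc r) * letter_factor \<iota> \<tau> Y) b = (\<Sum>r\<le>b. ?f r)"
    by (simp only: fps_mult_nth fps_nth_Abs_fps atLeast0AtMost)
  also have "\<dots> = ?f b + (\<Sum>r<b. ?f r)"
    by (simp only: lessThan_Suc_atMost[symmetric] sum.lessThan_Suc add.commute)
  also have "(\<Sum>r<b. ?f r) = (\<Sum>r<b. \<iota> ((1 - ?\<sigma>) * (1 - ?\<sigma> ^ Suc r)) * Y ^ Suc b)"
  proof (intro sum.cong refl)
    fix r assume "r \<in> {..<b}"
    then have "Suc r + (b - r) = Suc b" and br: "b - r \<noteq> 0" by auto
    then have "Y ^ Suc r * Y ^ (b - r) = Y ^ Suc b" by (simp only: power_add[symmetric])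
    moreover have "?f r = \<iota> (1 - ?\<sigma>) * \<iota> (1 - ?\<sigma> ^ Suc r) * (Y ^ Suc r * Y ^ (b - r))"
      using br by (simp add: letter_factor_def mult_ac del: power_Suc)
    ultimately show "?f r = \<iota> ((1 - ?\<sigma>) * (1 - ?\<sigma> ^ Suc r)) * Y ^ Suc b"
      unfolding rhom_mult[OF h] by simp
  qed
  also have "?f b + \<dots> = \<iota> ((1 - ?\<sigma> ^ Suc b) + (1 - ?\<sigma>) * (\<Sum>r<b. 1 - ?\<sigma> ^ Suc r)) * Y ^ Suc b"
    by (simp add: letter_factor_def rhom_add[OF h] rhom_sum[OF h] sum_distrib_left sum_distrib_right distrib_right del: power_Suc)
  also have "\<dots> = fps_nth (fps_deriv (letter_factor \<iota> \<tau> Y)) b"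
    unfolding letter_factor_scalar by (simp add: letter_factor_def rhom_mult[OF h] rhom_of_nat[OF h] mult.assoc del: power_Suc of_nat_Suc)
  finally show "fps_nth (fps_deriv (letter_factor \<iota> \<tau> Y)) b =
     fps_nth (Abs_fps (\<lambda>r. \<iota> (1 - ?\<sigma> ^ Suc r) * Y ^ Suc r) * letter_factor \<iota> \<tau> Y) b" ..
qed

lemma exp_coeff_deriv:
  assumes h: "rhom \<iota>"
  shows "fps_deriv (Abs_fps (exp_coeff \<iota> v)) = Abs_fps (\<lambda>r. v (Suc r)) * Abs_fps (exp_coeff \<iota> v)"
  by (rule fps_ext) (simp add: fps_mult_nth atLeast0AtMost exp_coeff_rec[OF h] del: of_nat_Suc)

text \<open>
  Both sides satisfy the same first-order linear differential equation.
\<close>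

lemma exp_coeff_letter:
  assumes h: "rhom \<iota>"
  shows "Abs_fps (exp_coeff \<iota> (\<lambda>r. v r + \<iota> (1 - (1 / \<tau>) ^ r) * Y ^ r)) = Abs_fps (exp_coeff \<iota> v) * letter_factor \<iota> \<tau> Y"
proof (rule fps_ext)
  fix b
  let ?F = "Abs_fps (exp_coeff \<iota> v) * letter_factor \<iota> \<tau> Y"
  have d: "fps_deriv ?F = Abs_fps (\<lambda>r. v (Suc r) + \<iota> (1 - (1 / \<tau>) ^ Suc r) * Y ^ Suc r) * ?F"
  proof -
    have "Abs_fps (\<lambda>r. v (Suc r) + \<iota> (1 - (1 / \<tau>) ^ Suc r) * Y ^ Suc r) =
       Abs_fps (\<lambda>r. v (Suc r)) + Abs_fps (\<lambda>r. \<iota> (1 - (1 / \<tau>) ^ Suc r) * Y ^ Suc r)"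
      by (rule fps_ext) simp
    then show ?thesis
      by (simp only: fps_deriv_mult exp_coeff_deriv[OF h] fps_deriv_letter_factor[OF h] algebra_simps)
  qed
  have "fps_nth ?F b = exp_coeff \<iota> (\<lambda>r. v r + \<iota> (1 - (1 / \<tau>) ^ r) * Y ^ r) b"
  proof (rule exp_coeff_unique[OF h])
    show "fps_nth ?F 0 = 1" by (simp add: letter_factor_def)
    fix b
    have "of_nat (Suc b) * fps_nth ?F (Suc b) = fps_nth (fps_deriv ?F) b" by (simp only: fps_deriv_nth Suc_eq_plus1)
    also have "\<dots> = (\<Sum>r\<le>b. (v (Suc r) + \<iota> (1 - (1 / \<tau>) ^ Suc r) * Y ^ Suc r) * fps_nth ?F (b - r))"
      unfolding d by (subst fps_mult_nth) (simp only: fps_nth_Abs_fps atLeast0AtMost)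
    finally show "of_nat (Suc b) * fps_nth ?F (Suc b) = (\<Sum>r\<le>b. (v (Suc r) + \<iota> (1 - (1 / \<tau>) ^ Suc r) * Y ^ Suc r) * fps_nth ?F (b - r))" .
  qed
  then show "fps_nth (Abs_fps (exp_coeff \<iota> (\<lambda>r. v r + \<iota> (1 - (1 / \<tau>) ^ r) * Y ^ r))) b = fps_nth ?F b" by simp
qed

text \<open>
  The constant term in \<open>z\<close> of \<open>A(z) g(1/z)\<close>, where \<open>A\<close> gives the coefficients of a power
  series.
\<close>

definition contract :: "(nat \<Rightarrow> 'r::comm_ring_1) \<Rightarrow> 'r poly \<Rightarrow> 'r" where
  "contract A g = (\<Sum>b\<le>degree g. A b * coeff g b)"

lemma contract_eq: "degree g \<le> N \<Longrightarrow> contract A g = (\<Sum>b\<le>N. A b * coeff g b)"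
  unfolding contract_def by (rule sum.mono_neutral_left) (auto simp: coeff_eq_0)

lemma contract_add: "contract A (f + g) = contract A f + contract A g"
  by (subst (1 2 3) contract_eq[where N = "max (degree f) (degree g)"])
     (auto simp: degree_add_le sum.distrib algebra_simps)

lemma contract_smult: "contract A (smult c g) = c * contract A g"
  by (subst (1 2) contract_eq[where N = "degree g"]) (auto simp: sum_distrib_left degree_smult_le mult_ac)

lemma contract_0 [simp]: "contract A 0 = 0"
  by (simp add: contract_def)

lemma degree_map_poly_rhom: "rhom h \<Longrightarrow> degree (map_poly h g) \<le> degree g"
  by (rule degree_le) (simp add: coeff_map_poly rhom_0 coeff_eq_0)

lemma contract_rhom: "rhom h \<Longrightarrow> h (contract A g) = contract (\<lambda>b. h (A b)) (map_poly h g)"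
  by (subst (1 2) contract_eq[where N = "degree g"])
     (simp_all add: rhom_sum rhom_mult coeff_map_poly rhom_0 degree_map_poly_rhom)

section \<open>The scalar product and vertex operators\<close>

text \<open>
  Power sum monomials are orthogonal, with a factor \<open>\<rho> v\<close> for each generator and the
  factorials of the multiplicities, so that multiplication by a generator is adjoint to a
  multiple of its partial derivative.
\<close>

definition psum_norm :: "(nat \<times> nat \<Rightarrow> 'k::field_char_0) \<Rightarrow> (nat \<times> nat) multiset \<Rightarrow> 'k" where
  "psum_norm \<rho> C = (\<Prod>v\<in>#C. \<rho> v) * of_nat (mult_fact C)"

definition pair :: "(nat \<times> nat \<Rightarrow> 'k::field_char_0) \<Rightarrow> 'k pring \<Rightarrow> 'k pring \<Rightarrow> 'k" where
  "pair \<rho> f g = (\<Sum>C\<in>Poly_Mapping.keys f. Poly_Mapping.lookup f C * Poly_Mapping.lookup g C * psum_norm \<rho> C)"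

lemma pair_eq: "finite S \<Longrightarrow> Poly_Mapping.keys f \<subseteq> S \<Longrightarrow>
    pair \<rho> f g = (\<Sum>C\<in>S. Poly_Mapping.lookup f C * Poly_Mapping.lookup g C * psum_norm \<rho> C)"
  unfolding pair_def by (rule sum.mono_neutral_left) (auto simp: in_keys_iff)

lemma pair_add_left: "pair \<rho> (f + g) h = pair \<rho> f h + pair \<rho> g h"
  using keys_add[of f g]
  by (subst (1 2 3) pair_eq[where S = "Poly_Mapping.keys f \<union> Poly_Mapping.keys g"])
     (auto simp: lookup_add sum.distrib algebra_simps)

lemma pair_add_right: "pair \<rho> f (g + h) = pair \<rho> f g + pair \<rho> f h"
  by (simp add: pair_def lookup_add sum.distrib algebra_simps)

lemma pair_commute: "pair \<rho> f g = pair \<rho> g f"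
  by (subst (1 2) pair_eq[where S = "Poly_Mapping.keys f \<union> Poly_Mapping.keys g"])
     (auto simp: mult_ac)

lemma lookup_cst_times: "Poly_Mapping.lookup (cst c * f) C = c * Poly_Mapping.lookup f C"
proof (induct f rule: pring_induct)
  case (single D d) then show ?case
    by (simp add: cst_def mult_single lookup_single when_def)
qed (simp add: lookup_add algebra_simps)

lemma pair_cst_right: "pair \<rho> f (cst c * g) = c * pair \<rho> f g"
  by (simp add: pair_def lookup_cst_times sum_distrib_left mult.assoc mult.left_commute)

lemma pair_cst_left: "pair \<rho> (cst c * f) g = c * pair \<rho> f g"
  by (simp add: pair_commute[of _ _ g] pair_cst_right)

lemma pair_0 [simp]: "pair \<rho> 0 g = 0" "pair \<rho> g 0 = 0"
  by (simp_all add: pair_def)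

lemma pair_sum_left: "pair \<rho> (sum f A) g = (\<Sum>x\<in>A. pair \<rho> (f x) g)"
  by (induct A rule: infinite_finite_induct) (simp_all add: pair_add_left)

lemma pair_single: "pair \<rho> (Poly_Mapping.single C c) (Poly_Mapping.single D d) = (if C = D then c * d * psum_norm \<rho> C else 0)"
  by (subst pair_eq[where S = "{C}"]) (auto simp: lookup_single when_def)

text \<open>
  The partial derivative with respect to the generator \<open>v\<close>.
\<close>

definition gen_deriv :: "nat \<times> nat \<Rightarrow> 'k::field_char_0 pring \<Rightarrow> 'k pring" where
  "gen_deriv v f = (\<Sum>C\<in>Poly_Mapping.keys f. Poly_Mapping.single (C - {#v#}) (of_nat (count C v) * Poly_Mapping.lookup f C))"

lemma gen_deriv_eq: "finite S \<Longrightarrow> Poly_Mapping.keys f \<subseteq> S \<Longrightarrow>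
   gen_deriv v f = (\<Sum>C\<in>S. Poly_Mapping.single (C - {#v#}) (of_nat (count C v) * Poly_Mapping.lookup f C))"
  unfolding gen_deriv_def by (rule sum.mono_neutral_left) (auto simp: in_keys_iff)

lemma gen_deriv_add: "gen_deriv v (f + g) = gen_deriv v f + gen_deriv v g"
  using keys_add[of f g]
  by (subst (1 2 3) gen_deriv_eq[where S = "Poly_Mapping.keys f \<union> Poly_Mapping.keys g"])
     (auto simp: lookup_add sum.distrib single_add algebra_simps)

lemma gen_deriv_single: "gen_deriv v (Poly_Mapping.single C c) = Poly_Mapping.single (C - {#v#}) (of_nat (count C v) * c)"
  by (subst gen_deriv_eq[where S = "{C}"]) auto

lemma gen_deriv_0: "gen_deriv v 0 = 0"
  by (simp add: gen_deriv_def)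

lemma gen_deriv_mult: "gen_deriv v (f * g) = gen_deriv v f * g + f * gen_deriv v g"
proof (induct f rule: pring_induct)
  case (single C c)
  show ?case
  proof (induct g rule: pring_induct)
    case (single D d)
    have "Poly_Mapping.single (C + D - {#v#}) (of_nat (count C v) * (c * d)) =
        Poly_Mapping.single (C - {#v#} + D) (of_nat (count C v) * (c * d))"
      by (cases "v \<in># C") (auto simp: not_in_iff)
    moreover have "Poly_Mapping.single (C + D - {#v#}) (of_nat (count D v) * (c * d)) =
        Poly_Mapping.single (C + (D - {#v#})) (of_nat (count D v) * (c * d))"
      by (cases "v \<in># D") (auto simp: not_in_iff)
    moreover have "Poly_Mapping.single (C + D - {#v#}) (of_nat (count (C + D) v) * (c * d)) =
        Poly_Mapping.single (C + D - {#v#}) (of_nat (count C v) * (c * d)) +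
        Poly_Mapping.single (C + D - {#v#}) (of_nat (count D v) * (c * d))"
      by (simp add: single_add[symmetric] distrib_right)
    ultimately show ?case
      by (simp only: mult_single gen_deriv_single mult.assoc mult.left_commute)
  qed (simp add: gen_deriv_add algebra_simps)
qed (simp add: gen_deriv_add algebra_simps)

lemma gen_deriv_sum: "gen_deriv v (sum f A) = (\<Sum>x\<in>A. gen_deriv v (f x))"
  by (induct A rule: infinite_finite_induct) (simp_all add: gen_deriv_0 gen_deriv_add)

lemma gen_deriv_cst: "gen_deriv v (cst c) = 0"
  by (simp add: cst_def gen_deriv_single)

lemma gen_deriv_gen: "gen_deriv v (gen u) = (if u = v then 1 else 0)"
  by (auto simp: gen_def gen_deriv_single simp flip: zero_multiset_def)

lemma pair_gen: "pair \<rho> (gen v * f) g = \<rho> v * pair \<rho> f (gen_deriv v g)"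
proof (induct f rule: pring_induct)
  case (single C c)
  show ?case
  proof (induct g rule: pring_induct)
    case (single D d)
    show ?case
    proof (cases "D = add_mset v C")
      case True
      then show ?thesis by (simp add: gen_def mult_single pair_single gen_deriv_single psum_norm_def mult_fact_add algebra_simps)
    next
      case False
      then have "C \<noteq> D - {#v#} \<or> count D v = 0" by (metis count_eq_zero_iff insert_DiffM)
      then show ?thesis using False by (auto simp: gen_def mult_single pair_single gen_deriv_single)
    qed
  qed (simp add: pair_add_right gen_deriv_add distrib_left)
qed (simp add: pair_add_left distrib_left)

definition augment :: "'k::field_char_0 pring \<Rightarrow> 'k" where
  "augment = gen_subst (\<lambda>c. c) (\<lambda>_. 0)"

lemma rhom_id: "rhom (\<lambda>c. c)" by (simp add: rhom_def)

lemma rhom_augment: "rhom augment"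
  unfolding augment_def by (rule rhom_gen_subst[OF rhom_id])

lemma pair_const: "pair \<rho> f (cst d) = d * augment f"
proof (induct f rule: pring_induct)
  case (single C c)
  show ?case
    by (cases C) (auto simp: cst_def pair_single augment_def gen_subst_single rhom_id psum_norm_def mult_fact_def)
qed (simp add: pair_add_left rhom_add[OF rhom_augment] distrib_left)

text \<open>
  With \<open>\<xi>\<close> the power sums of the single alphabets, these are the arguments \<open>v_r\<close> of the
  exponential in the operator \<open>k\<close>.
\<close>

definition pleth_arg :: "('k::linordered_field \<Rightarrow> 'r::comm_ring_1) \<Rightarrow> (nat \<Rightarrow> 'k) \<Rightarrow> nat \<Rightarrow> (nat \<times> nat \<Rightarrow> 'r) \<Rightarrow> nat \<Rightarrow> nat \<Rightarrow> 'r" where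
  "pleth_arg \<iota> \<tau> n \<xi> k r = (\<Sum>i<n. if k \<le> i then \<iota> (1 - (1 / \<tau> i) ^ r) * \<xi> (i, r) else 0)"

text \<open>
  The substitution that adds \<open>\<sigma> (i, r) w^r\<close> to the power sum of degree \<open>r\<close> of the
  alphabet \<open>i\<close>; the result is a polynomial in \<open>w\<close>.
\<close>

definition shift_hom :: "(nat \<times> nat \<Rightarrow> 'k) \<Rightarrow> 'k::linordered_field pring \<Rightarrow> 'k pring poly" where
  "shift_hom \<sigma> = alphabet_subst (\<lambda>c. [:cst c:]) (\<lambda>v. [:alphabet_gen v:] + monom (cst (\<sigma> v)) (snd v))"

lemma rhom_cst_poly: "rhom (\<lambda>c. [:cst c:])"
  using rhom_comp[OF rhom_const_poly rhom_cst] by simp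

lemma rhom_shift_hom: "rhom (shift_hom \<sigma>)"
  unfolding shift_hom_def by (rule rhom_alphabet_subst[OF rhom_cst_poly])

lemma shift_hom_cst: "shift_hom \<sigma> (cst c) = [:cst c:]"
  by (simp add: shift_hom_def alphabet_subst_cst[OF rhom_cst_poly])

lemma shift_hom_alphabet_gen: "shift_hom \<sigma> (alphabet_gen v) = [:alphabet_gen v:] + monom (cst (\<sigma> v)) (snd v)"
  by (simp add: shift_hom_def alphabet_subst_alphabet_gen[OF rhom_cst_poly])

lemma shift_hom_gen: "shift_hom \<sigma> (gen (i, r)) = [:gen (i, r):] + monom (cst (\<Sum>j\<le>i. \<sigma> (j, r))) r"
proof -
  have [simp]: "(\<Sum>j\<in>A. [:f j:]) = [:\<Sum>j\<in>A. f j:]" "(\<Sum>j\<in>A. monom (f j) r) = monom (\<Sum>j\<in>A. f j) r"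
    for A and f :: "nat \<Rightarrow> 'a pring"
    by (induct A rule: infinite_finite_induct) (simp_all add: add_monom)
  show ?thesis
    unfolding gen_sum_alphabet_gen by (simp add: rhom_sum[OF rhom_shift_hom] shift_hom_alphabet_gen sum.distrib rhom_sum[OF rhom_cst])
qed

text \<open>
  The constant term of the exponential times the shifted polynomial, with \<open>w = 1/z\<close>.
\<close>

definition vertex_op :: "(nat \<Rightarrow> 'k pring) \<Rightarrow> (nat \<times> nat \<Rightarrow> 'k) \<Rightarrow> 'k::linordered_field pring \<Rightarrow> 'k pring" where
  "vertex_op A \<sigma> f = contract A (shift_hom \<sigma> f)"

lemma vertex_op_add: "vertex_op A \<sigma> (f + g) = vertex_op A \<sigma> f + vertex_op A \<sigma> g"
  by (simp add: vertex_op_def rhom_add[OF rhom_shift_hom] contract_add)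

lemma vertex_op_cst: "vertex_op A \<sigma> (cst c * f) = cst c * vertex_op A \<sigma> f"
  by (simp add: vertex_op_def rhom_mult[OF rhom_shift_hom] shift_hom_cst contract_smult)

text \<open>
  If the generator \<open>v\<close> occurs in the exponent only as \<open>c p_v z^r / r\<close>, then differentiation
  multiplies the exponential by \<open>c z^r / r\<close>.
\<close>

lemma gen_deriv_exp_coeff:
  fixes V :: "nat \<Rightarrow> 'k::field_char_0 pring"
  assumes V: "\<And>r'. r' > 0 \<Longrightarrow> gen_deriv v (V r') = (if r' = r then cst c else 0)" and r: "r > 0"
  shows "gen_deriv v (exp_coeff cst V b) = (if r \<le> b then cst (c / of_nat r) * exp_coeff cst V (b - r) else 0)"
proof (induct b rule: less_induct)
  case (less b)
  show ?case
  proof (cases b)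
    case 0
    then show ?thesis using r gen_deriv_cst[of v 1] by simp
  next
    case (Suc b')
    let ?a = "exp_coeff cst V"
    have crc: "of_nat r * cst (c / of_nat r) = cst c"
      using r by (simp add: rhom_of_nat[OF rhom_cst, symmetric] rhom_mult[OF rhom_cst, symmetric])
    have 1: "(\<Sum>s\<le>b'. gen_deriv v (V (Suc s)) * ?a (b' - s)) = (if r \<le> b then cst c * ?a (b - r) else 0)"
    proof -
      have "(\<Sum>s\<le>b'. gen_deriv v (V (Suc s)) * ?a (b' - s)) = (\<Sum>s\<le>b'. if s = r - 1 then cst c * ?a (b - r) else 0)"
        using r V Suc by (intro sum.cong refl) auto
      then show ?thesis using r Suc by auto
    qed
    have 2: "(\<Sum>s\<le>b'. V (Suc s) * gen_deriv v (?a (b' - s))) =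
       (if r \<le> b then cst (c / of_nat r) * (of_nat (b - r) * ?a (b - r)) else 0)"
    proof (cases "r \<le> b'")
      case True
      have "(\<Sum>s\<le>b'. V (Suc s) * gen_deriv v (?a (b' - s))) = (\<Sum>s\<le>b' - r. V (Suc s) * (cst (c / of_nat r) * ?a (b' - r - s)))"
        by (rule sum.mono_neutral_cong_right) (use less Suc True in \<open>auto simp: diff_commute add.commute\<close>)
      also have "\<dots> = cst (c / of_nat r) * (\<Sum>s\<le>b' - r. V (Suc s) * ?a (b' - r - s))"
        by (simp add: sum_distrib_left mult.left_commute)
      also have "\<dots> = cst (c / of_nat r) * (of_nat (b - r) * ?a (b - r))"
        using exp_coeff_rec[OF rhom_cst, of "b' - r" V] True Suc by (simp add: Suc_diff_le del: of_nat_Suc)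
      finally show ?thesis using True Suc by simp
    next
      case False
      have "(\<Sum>s\<le>b'. V (Suc s) * gen_deriv v (?a (b' - s))) = (\<Sum>s\<le>b'. 0)"
        using less Suc False by (intro sum.cong refl) auto
      then show ?thesis using False Suc by auto
    qed
    have "of_nat b * gen_deriv v (?a b) = gen_deriv v (of_nat b * ?a b)"
      using gen_deriv_cst[of v "of_nat b :: 'k"] by (simp add: gen_deriv_mult rhom_of_nat[OF rhom_cst])
    also have "\<dots> = (\<Sum>s\<le>b'. gen_deriv v (V (Suc s)) * ?a (b' - s)) + (\<Sum>s\<le>b'. V (Suc s) * gen_deriv v (?a (b' - s)))"
      unfolding Suc exp_coeff_rec[OF rhom_cst] by (simp add: gen_deriv_sum gen_deriv_mult sum.distrib)
    also have "\<dots> = of_nat b * (if r \<le> b then cst (c / of_nat r) * ?a (b - r) else 0)"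
    proof (cases "r \<le> b")
      case True
      have "cst c * ?a (b - r) + cst (c / of_nat r) * (of_nat (b - r) * ?a (b - r)) =
        (of_nat r + of_nat (b - r)) * (cst (c / of_nat r) * ?a (b - r))"
        unfolding crc[symmetric] by (simp add: algebra_simps)
      also have "of_nat r + of_nat (b - r) = (of_nat b :: 'k pring)"
        using True by (simp flip: of_nat_add)
      finally show ?thesis using True unfolding 1 2 by simp
    qed (simp add: 1 2)
    finally have "cst (1 / of_nat b) * of_nat b * gen_deriv v (?a b) =
      cst (1 / of_nat b) * of_nat b * (if r \<le> b then cst (c / of_nat r) * ?a (b - r) else 0)"
      by (simp only: mult.assoc)
    moreover have "cst (1 / of_nat b) * of_nat b = (1 :: 'k pring)"
      unfolding Suc by (rule rhom_inv_of_nat[OF rhom_cst])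
    ultimately show ?thesis by simp
  qed
qed

lemma augment_exp_coeff:
  assumes "\<And>r. r > 0 \<Longrightarrow> augment (V r) = 0"
  shows "augment (exp_coeff cst V b) = (if b = 0 then 1 else 0)"
  by (cases b) (simp_all add: exp_coeff.simps(2) rhom_1[OF rhom_augment] rhom_mult[OF rhom_augment] rhom_sum[OF rhom_augment] assms)

lemma mult_coeff_shift:
  "coeff (([:a:] + monom c r) * g) b = a * coeff g b + (if r \<le> b then c * coeff g (b - r) else 0)"
  by (simp add: distrib_right coeff_monom_mult)

text \<open>
  Multiplication by the coefficient of \<open>z^b\<close> in the exponential is adjoint to \<open>\<gamma>^b\<close>
  times the coefficient of \<open>w^b\<close> of the shift. It suffices to take for \<open>g\<close> a monomial, and
  to move one generator at a time to the other side: there it acts as a derivative, which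
  either hits \<open>f\<close> or lowers the exponential by \<open>r\<close> steps, while on the right the shift of
  the generator splits into the generator itself and a multiple of \<open>w^r\<close>. The third
  hypothesis equates the second contributions.
\<close>

lemma pair_exp_coeff_shift:
  fixes V :: "nat \<Rightarrow> 'k::linordered_field pring"
  assumes pdV: "\<And>v r'. fst v < n \<Longrightarrow> snd v > 0 \<Longrightarrow> r' > 0 \<Longrightarrow> gen_deriv v (V r') = (if r' = snd v then cst (c v) else 0)"
    and augV: "\<And>r. r > 0 \<Longrightarrow> augment (V r) = 0"
    and bal: "\<And>v. fst v < n \<Longrightarrow> snd v > 0 \<Longrightarrow> c v * \<rho> v = of_nat (snd v) * \<gamma> ^ snd v * (\<Sum>j\<le>fst v. \<sigma> (j, snd v))"
    and g: "g \<in> Sym n"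
  shows "pair \<rho> (exp_coeff cst V b * f) g = \<gamma> ^ b * pair \<rho> f (coeff (shift_hom \<sigma> g) b)"
proof -
  let ?a = "exp_coeff cst V"
  have single: "pair \<rho> (?a b * f) (Poly_Mapping.single D d) = \<gamma> ^ b * pair \<rho> f (coeff (shift_hom \<sigma> (Poly_Mapping.single D d)) b)"
    if "D \<in> index_set n" for D d b f
    using that
  proof (induct D arbitrary: f b)
    case empty
    have s: "Poly_Mapping.single {#} d = cst d" by (simp add: cst_def)
    show ?case
      by (cases b) (simp_all add: s shift_hom_cst pair_const rhom_mult[OF rhom_augment] augment_exp_coeff[OF augV])
  next
    case (add v D)
    let ?g = "Poly_Mapping.single D d" and ?r = "snd v"
    let ?\<beta> = "\<Sum>j\<le>fst v. \<sigma> (j, snd v)"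
    have v: "fst v < n" "snd v > 0" and D: "D \<in> index_set n" using add(2) by (auto simp: index_set_def)
    note IH = add(1)[OF D]
    have g: "Poly_Mapping.single (add_mset v D) d = gen v * ?g"
      by (simp add: gen_def mult_single)
    have sg: "shift_hom \<sigma> (gen v * ?g) = ([:gen v:] + monom (cst ?\<beta>) ?r) * shift_hom \<sigma> ?g"
      using shift_hom_gen[of \<sigma> "fst v" "snd v"] by (simp add: rhom_mult[OF rhom_shift_hom])
    have "pair \<rho> (?a b * f) (gen v * ?g) = \<rho> v * pair \<rho> (gen_deriv v (?a b * f)) ?g"
      by (subst pair_commute) (simp add: pair_gen pair_commute[of \<rho> ?g])
    also have "\<dots> = \<rho> v * pair \<rho> (?a b * gen_deriv v f) ?g +
       (if ?r \<le> b then \<rho> v * (c v / of_nat ?r) * pair \<rho> (?a (b - ?r) * f) ?g else 0)"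
      using gen_deriv_exp_coeff[of v V ?r "c v" b, OF pdV[OF v] v(2)]
      by (simp add: gen_deriv_mult pair_add_left distrib_left pair_cst_left mult.assoc)
    also have "\<dots> = \<gamma> ^ b * (\<rho> v * pair \<rho> (gen_deriv v f) (coeff (shift_hom \<sigma> ?g) b)) +
       (if ?r \<le> b then \<rho> v * (c v / of_nat ?r) * \<gamma> ^ (b - ?r) * pair \<rho> f (coeff (shift_hom \<sigma> ?g) (b - ?r)) else 0)"
      unfolding IH by (simp add: mult.assoc mult.left_commute)
    also have "(if ?r \<le> b then \<rho> v * (c v / of_nat ?r) * \<gamma> ^ (b - ?r) * pair \<rho> f (coeff (shift_hom \<sigma> ?g) (b - ?r)) else 0) =
      (if ?r \<le> b then \<gamma> ^ b * (?\<beta> * pair \<rho> f (coeff (shift_hom \<sigma> ?g) (b - ?r))) else 0)"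
    proof (cases "?r \<le> b")
      case True
      have "\<rho> v * (c v / of_nat ?r) * \<gamma> ^ (b - ?r) = \<gamma> ^ b * ?\<beta>"
      proof -
        have "\<rho> v * (c v / of_nat ?r) = \<gamma> ^ ?r * ?\<beta>"
          using bal[OF v] v(2) by (simp add: field_simps)
        moreover have "\<gamma> ^ b = \<gamma> ^ ?r * \<gamma> ^ (b - ?r)" using True by (simp flip: power_add)
        ultimately show ?thesis by (simp add: mult_ac)
      qed
      then show ?thesis using True by (simp add: mult.assoc)
    qed simp
    also have "\<rho> v * pair \<rho> (gen_deriv v f) (coeff (shift_hom \<sigma> ?g) b) = pair \<rho> f (gen v * coeff (shift_hom \<sigma> ?g) b)"
      by (subst (2) pair_commute) (simp add: pair_gen pair_commute[of \<rho> "gen_deriv v f"])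
    finally show ?case
      unfolding g sg mult_coeff_shift
      by (simp add: pair_add_right pair_cst_right distrib_left)
  qed
  have expand: "(\<Sum>C\<in>Poly_Mapping.keys g. Poly_Mapping.single C (Poly_Mapping.lookup g C)) = g"
    by (rule poly_mapping_eqI) (simp add: lookup_sum lookup_single when_def in_keys_iff)
  have "pair \<rho> (?a b * f) (\<Sum>C\<in>S. Poly_Mapping.single C (h C)) =
      \<gamma> ^ b * pair \<rho> f (coeff (shift_hom \<sigma> (\<Sum>C\<in>S. Poly_Mapping.single C (h C))) b)"
    if "S \<subseteq> index_set n" for S h
    using that
    by (induct S rule: infinite_finite_induct)
       (simp_all add: rhom_0[OF rhom_shift_hom] rhom_add[OF rhom_shift_hom] pair_add_right single distrib_left)
  from this[of "Poly_Mapping.keys g" "Poly_Mapping.lookup g"] g show ?thesis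
    unfolding expand by (simp add: Sym_def)
qed

lemma vertex_op_self_adjoint:
  fixes V :: "nat \<Rightarrow> 'k::linordered_field pring"
  assumes "\<And>v r'. fst v < n \<Longrightarrow> snd v > 0 \<Longrightarrow> r' > 0 \<Longrightarrow> gen_deriv v (V r') = (if r' = snd v then cst (c v) else 0)"
    and "\<And>r. r > 0 \<Longrightarrow> augment (V r) = 0"
    and "\<And>v. fst v < n \<Longrightarrow> snd v > 0 \<Longrightarrow> c v * \<rho> v = of_nat (snd v) * \<gamma> ^ snd v * (\<Sum>j\<le>fst v. \<sigma> (j, snd v))"
    and f: "f \<in> Sym n" and g: "g \<in> Sym n"
  shows "pair \<rho> (vertex_op (exp_coeff cst V) \<sigma> f) g = pair \<rho> f (vertex_op (exp_coeff cst V) \<sigma> g)"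
proof -
  define N where "N = max (degree (shift_hom \<sigma> f)) (degree (shift_hom \<sigma> g))"
  have *: "pair \<rho> (vertex_op (exp_coeff cst V) \<sigma> f) g = (\<Sum>b\<le>N. \<gamma> ^ b * pair \<rho> (coeff (shift_hom \<sigma> f) b) (coeff (shift_hom \<sigma> g) b))"
    if "degree (shift_hom \<sigma> f) \<le> N" "g \<in> Sym n" for f g N
    unfolding vertex_op_def contract_eq[OF that(1)] pair_sum_left
    by (intro sum.cong refl pair_exp_coeff_shift[of n V c \<rho> \<gamma> \<sigma> g, OF assms(1-3) that(2)]) auto
  have "pair \<rho> f (vertex_op (exp_coeff cst V) \<sigma> g) = pair \<rho> (vertex_op (exp_coeff cst V) \<sigma> g) f"
    by (rule pair_commute)
  also have "\<dots> = (\<Sum>b\<le>N. \<gamma> ^ b * pair \<rho> (coeff (shift_hom \<sigma> g) b) (coeff (shift_hom \<sigma> f) b))"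
    by (rule *) (use f in \<open>auto simp: N_def\<close>)
  also have "\<dots> = (\<Sum>b\<le>N. \<gamma> ^ b * pair \<rho> (coeff (shift_hom \<sigma> f) b) (coeff (shift_hom \<sigma> g) b))"
    by (simp add: pair_commute)
  finally show ?thesis using *[of f N g] g by (simp add: N_def)
qed

section \<open>Degrees after evaluation at finitely many letters\<close>

text \<open>
  The polynomial \<open>g\<close> in \<open>w\<close> has coefficients that are polynomials in \<open>s\<close>. Write \<open>g_c(w)\<close> for
  the quotient, without the negative powers, of \<open>g(w)\<close> by \<open>w^c\<close>. Then \<open>g_c(s y) = coeff g c
  + s y g_{c+1}(s y)\<close>, so that \<open>g_{c+1}(s y)\<close> has smaller degree in \<open>s\<close> than the bound for
  the two other terms; this is why the second bound is strict.
\<close>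

lemma poly_shift_bound:
  fixes g :: "'r::comm_ring_1 poly poly"
  assumes y: "y * y' = 1"
    and g: "\<And>c e. e > d \<Longrightarrow> coeff (coeff g c) e = 0"
    and gy: "\<And>e. e > d \<Longrightarrow> coeff (poly g (monom y 1)) e = 0"
  shows "e > d \<Longrightarrow> coeff (poly (poly_shift c g) (monom y 1)) e = 0"
    and "e \<ge> d \<Longrightarrow> c > 0 \<Longrightarrow> coeff (poly (poly_shift c g) (monom y 1)) e = 0"
proof -
  have step: "poly_shift c g = pCons (coeff g c) (poly_shift (Suc c) g)" for c
    by (rule poly_eqI) (simp add: coeff_poly_shift coeff_pCons split: nat.split)
  have P: "(\<forall>e>d. coeff (poly (poly_shift c g) (monom y 1)) e = 0) \<and>
        (c > 0 \<longrightarrow> (\<forall>e\<ge>d. coeff (poly (poly_shift c g) (monom y 1)) e = 0))" for c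
  proof (induct c)
    case 0
    have "poly_shift 0 g = g" by (rule poly_eqI) (simp add: coeff_poly_shift)
    then show ?case using gy by simp
  next
    case (Suc c)
    let ?p = "poly (poly_shift (Suc c) g) (monom y 1)"
    have "coeff ?p e = 0" if "e \<ge> d" for e
    proof -
      have "poly (poly_shift c g) (monom y 1) = coeff g c + monom y 1 * ?p"
        by (subst step) simp
      then have "coeff (poly (poly_shift c g) (monom y 1)) (Suc e) = coeff (coeff g c) (Suc e) + y * coeff ?p e"
        by (simp add: coeff_monom_mult)
      then have "y * coeff ?p e = 0" using Suc g[of "Suc e" c] that by simp
      then have "y' * (y * coeff ?p e) = 0" by simp
      then show ?thesis using y by (simp add: mult.assoc[symmetric] mult.commute)
    qed
    then show ?case by auto
  qed
  show "e > d \<Longrightarrow> coeff (poly (poly_shift c g) (monom y 1)) e = 0"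
    and "e \<ge> d \<Longrightarrow> c > 0 \<Longrightarrow> coeff (poly (poly_shift c g) (monom y 1)) e = 0"
    using P[of c] by auto
qed

text \<open>
  The substitution of \<open>s z\<close> for \<open>z\<close>, where \<open>s\<close> is the variable of the coefficient
  polynomials.
\<close>

definition fscale :: "'r::comm_ring_1 fps \<Rightarrow> 'r poly fps" where
  "fscale U = Abs_fps (\<lambda>b. monom (fps_nth U b) b)"

definition fconst :: "'r::comm_ring_1 fps \<Rightarrow> 'r poly fps" where
  "fconst U = Abs_fps (\<lambda>b. [:fps_nth U b:])"

lemma fscale_1: "fscale 1 = 1" and fconst_1: "fconst 1 = 1"
  by (auto simp: fscale_def fconst_def fps_eq_iff one_pCons monom_0)

lemma fscale_mult: "fscale (U * V) = fscale U * fscale V"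
  by (rule fps_ext) (auto simp: fscale_def fps_mult_nth mult_monom monom_sum intro!: sum.cong)

lemma fconst_mult: "fconst (U * V) = fconst U * fconst V"
  by (rule fps_ext) (simp add: fconst_def fps_mult_nth rhom_sum[OF rhom_const_poly] mult.commute)

text \<open>
  A factor that does not involve \<open>s\<close> can be moved into the polynomial, where multiplication
  by \<open>z^c\<close> drops the powers of \<open>w\<close> below \<open>c\<close> and divides the others by \<open>w^c\<close>.
\<close>

lemma contract_fconst:
  "contract (fps_nth (W * fconst U)) g = contract (fps_nth W) (\<Sum>c\<le>degree g. smult [:fps_nth U c:] (poly_shift c g))"
proof -
  let ?N = "degree g"
  let ?h = "\<Sum>c\<le>?N. smult [:fps_nth U c:] (poly_shift c g)"
  have deg: "degree ?h \<le> ?N"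
    by (intro degree_sum_le) (auto intro!: order.trans[OF degree_smult_le] degree_le simp: coeff_poly_shift coeff_eq_0)
  have "contract (fps_nth W) ?h = (\<Sum>a\<le>?N. \<Sum>c\<le>?N. fps_nth W a * ([:fps_nth U c:] * coeff g (a + c)))"
    unfolding contract_eq[OF deg] by (simp add: coeff_sum coeff_poly_shift sum_distrib_left add.commute)
  also have "\<dots> = (\<Sum>(a, c)\<in>{..?N} \<times> {..?N}. fps_nth W a * ([:fps_nth U c:] * coeff g (a + c)))"
    by (simp add: sum.cartesian_product)
  also have "\<dots> = (\<Sum>(a, c)\<in>{(a, c). a + c \<le> ?N}. fps_nth W a * ([:fps_nth U c:] * coeff g (a + c)))"
  proof (rule sum.mono_neutral_right)
    show "\<forall>x\<in>{..?N} \<times> {..?N} - {(a, c). a + c \<le> ?N}.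
       (case x of (a, c) \<Rightarrow> fps_nth W a * ([:fps_nth U c:] * coeff g (a + c))) = 0"
    proof
      fix x assume x: "x \<in> {..?N} \<times> {..?N} - {(a, c). a + c \<le> ?N}"
      then have "coeff g (fst x + snd x) = 0" by (intro coeff_eq_0) auto
      then show "(case x of (a, c) \<Rightarrow> fps_nth W a * ([:fps_nth U c:] * coeff g (a + c))) = 0"
        by (simp add: case_prod_unfold)
    qed
  qed auto
  also have "\<dots> = (\<Sum>b\<le>?N. \<Sum>a\<le>b. fps_nth W a * ([:fps_nth U (b - a):] * coeff g b))"
    by (subst sum.triangle_reindex_eq) (auto intro!: sum.cong)
  also have "\<dots> = contract (fps_nth (W * fconst U)) g"
    unfolding contract_def by (simp add: fps_mult_nth atLeast0AtMost fconst_def sum_distrib_right mult.assoc)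
  finally show ?thesis ..
qed

lemma smult_sum_right: "smult a (sum f S) = (\<Sum>x\<in>S. smult a (f x))"
  by (induct S rule: infinite_finite_induct) (simp_all add: smult_add_right)

text \<open>
  Contraction with a geometric series is evaluation at its ratio.
\<close>

lemma contract_fscale_geo:
  fixes c :: "'r::comm_ring_1 \<Rightarrow> 'r"
  assumes U: "\<And>b. fps_nth U b = (if b = 0 then c0 else 0) + (\<Sum>y\<in>Y. c y * y ^ b)"
  shows "contract (fps_nth (fscale U)) g = smult c0 (coeff g 0) + (\<Sum>y\<in>Y. smult (c y) (poly g (monom y 1)))"
proof -
  have "contract (fps_nth (fscale U)) g =
    (\<Sum>b\<le>degree g. (if b = 0 then smult c0 (coeff g 0) else 0) + (\<Sum>y\<in>Y. smult (c y) (monom y 1 ^ b * coeff g b)))"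
    unfolding contract_def
  proof (intro sum.cong refl)
    fix b
    have "fps_nth (fscale U) b = (if b = 0 then [:c0:] else 0) + (\<Sum>y\<in>Y. smult (c y) (monom y 1 ^ b))"
      by (auto simp: fscale_def U add_monom[symmetric] monom_sum monom_power smult_monom monom_0)
    then show "fps_nth (fscale U) b * coeff g b =
      (if b = 0 then smult c0 (coeff g 0) else 0) + (\<Sum>y\<in>Y. smult (c y) (monom y 1 ^ b * coeff g b))"
      by (simp add: distrib_right sum_distrib_right)
  qed
  also have "\<dots> = smult c0 (coeff g 0) + (\<Sum>y\<in>Y. smult (c y) (poly g (monom y 1)))"
    by (subst sum.distrib, subst sum.swap) (simp add: poly_altdef smult_sum_right mult.commute)
  finally show ?thesis .
qed

text \<open>
  The product is a rational function of \<open>z\<close> with simple poles, whose numerator and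
  denominator have the same degree.
\<close>

lemma letter_factor_product_partial_fractions:
  fixes ys :: "'k::linordered_field list"
  assumes "distinct ys" "0 \<notin> set ys"
  shows "\<exists>c0 c. \<forall>b. fps_nth (\<Prod>y\<leftarrow>ys. letter_factor (\<lambda>c. c) \<tau> y) b = (if b = 0 then c0 else 0) + (\<Sum>y\<in>set ys. c y * y ^ b)"
  using assms
proof (induct ys)
  case Nil
  show ?case by (intro exI[of _ 1]) auto
next
  case (Cons z ys)
  then obtain c0 c where U: "\<And>b. fps_nth (\<Prod>y\<leftarrow>ys. letter_factor (\<lambda>c. c) \<tau> y) b = (if b = 0 then c0 else 0) + (\<Sum>y\<in>set ys. c y * y ^ b)"
    by auto
  define geo where "geo y = Abs_fps (\<lambda>b. y ^ b)" for y :: 'k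
  define a where "a = 1 - 1 / \<tau>"
  \<comment> \<open>The product of two geometric series with different ratios \<open>z\<close> and \<open>y\<close> is a combination
    of the two.\<close>
  define u w where "u y = z / (z - y)" and "w y = y / (z - y)" for y
  have zy: "z \<noteq> y" if "y \<in> set ys" for y using that Cons(2) by auto
  have Uf: "(\<Prod>y\<leftarrow>ys. letter_factor (\<lambda>c. c) \<tau> y) = fps_const c0 + (\<Sum>y\<in>set ys. fps_const (c y) * geo y)"
    by (rule fps_ext) (simp add: U geo_def fps_sum_nth)
  have P: "letter_factor (\<lambda>c. c) \<tau> z = fps_const (1 - a) + fps_const a * geo z"
    by (rule fps_ext) (simp add: letter_factor_def geo_def a_def)
  have gg: "geo z * geo y = fps_const (u y) * geo z - fps_const (w y) * geo y" if "y \<in> set ys" for y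
  proof (rule fps_ext)
    fix b
    have "(z - y) * (\<Sum>i\<le>b. z ^ i * y ^ (b - i)) = z ^ Suc b - y ^ Suc b"
      using power_diff_sumr2[of z "Suc b" y] by (simp add: lessThan_Suc_atMost mult.commute del: power_Suc)
    then have "(\<Sum>i\<le>b. z ^ i * y ^ (b - i)) = (z ^ Suc b - y ^ Suc b) / (z - y)"
      using zy[OF that] by (simp add: field_simps)
    then show "fps_nth (geo z * geo y) b = fps_nth (fps_const (u y) * geo z - fps_const (w y) * geo y) b"
      by (subst fps_mult_nth) (simp add: geo_def atLeast0AtMost diff_divide_distrib u_def w_def)
  qed
  define c' where "c' y = (if y = z then a * (c0 + (\<Sum>y\<in>set ys. c y * (u y)))
     else (1 - a) * c y - a * c y * (w y))" for y
  have "(\<Prod>y\<leftarrow>z # ys. letter_factor (\<lambda>c. c) \<tau> y) =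
    fps_const ((1 - a) * c0) + fps_const (a * c0) * geo z + (\<Sum>y\<in>set ys. fps_const ((1 - a) * c y) * geo y)
    + (\<Sum>y\<in>set ys. fps_const (a * c y) * (geo z * geo y))"
    by (simp add: Uf P distrib_left distrib_right sum_distrib_left mult_ac flip: fps_const_mult)
       (simp add: algebra_simps sum.distrib)
  also have "(\<Sum>y\<in>set ys. fps_const (a * c y) * (geo z * geo y)) =
    (\<Sum>y\<in>set ys. fps_const (a * c y * (u y)) * geo z - fps_const (a * c y * (w y)) * geo y)"
    by (intro sum.cong refl) (simp only: gg right_diff_distrib fps_const_mult[symmetric] mult.assoc)
  finally have "fps_nth (\<Prod>y\<leftarrow>z # ys. letter_factor (\<lambda>c. c) \<tau> y) b =
     (if b = 0 then (1 - a) * c0 else 0) + (\<Sum>y\<in>set (z # ys). c' y * y ^ b)" for b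
  proof -
    assume eq: "(\<Prod>y\<leftarrow>z # ys. letter_factor (\<lambda>c. c) \<tau> y) =
      fps_const ((1 - a) * c0) + fps_const (a * c0) * geo z + (\<Sum>y\<in>set ys. fps_const ((1 - a) * c y) * geo y) +
      (\<Sum>y\<in>set ys. fps_const (a * c y * (u y)) * geo z - fps_const (a * c y * (w y)) * geo y)"
    have z: "z \<notin> set ys" using Cons(2) by simp
    have cz: "c' z = a * (c0 + (\<Sum>y\<in>set ys. c y * u y))" by (simp add: c'_def)
    have "(\<Sum>y\<in>set (z # ys). c' y * y ^ b) = c' z * z ^ b + (\<Sum>y\<in>set ys. c' y * y ^ b)"
      using z by simp
    also have "(\<Sum>y\<in>set ys. c' y * y ^ b) = (\<Sum>y\<in>set ys. ((1 - a) * c y - a * c y * (w y)) * y ^ b)"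
      using z by (intro sum.cong) (auto simp: c'_def)
    finally have rhs: "(\<Sum>y\<in>set (z # ys). c' y * y ^ b) = c' z * z ^ b +
      (\<Sum>y\<in>set ys. ((1 - a) * c y - a * c y * w y) * y ^ b)" .
    show ?thesis
      unfolding eq rhs by (simp add: geo_def fps_sum_nth cz sum.distrib sum_subtractf sum_distrib_left sum_distrib_right algebra_simps)
  qed
  then show ?case by blast
qed

lemma map_poly_shift_hom:
  assumes h: "rhom \<iota>"
  shows "map_poly (alphabet_subst \<iota> \<xi>) (shift_hom \<sigma> f) = alphabet_subst (\<lambda>c. [:\<iota> c:]) (\<lambda>v. [:\<xi> v:] + monom (\<iota> (\<sigma> v)) (snd v)) f"
proof -
  note he = rhom_alphabet_subst[OF h, of \<xi>]
  have hc: "rhom (\<lambda>c. [:\<iota> c:])" using rhom_comp[OF rhom_const_poly h] by simp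
  note hm = rhom_map_poly[OF he]
  have c: "map_poly (alphabet_subst \<iota> \<xi>) [:a:] = [:alphabet_subst \<iota> \<xi> a:]" for a
    using map_poly_pCons[of "alphabet_subst \<iota> \<xi>" a 0] rhom_0[OF he] by simp
  have "(\<lambda>f. map_poly (alphabet_subst \<iota> \<xi>) (shift_hom \<sigma> f)) f = alphabet_subst (\<lambda>c. [:\<iota> c:]) (\<lambda>v. [:\<xi> v:] + monom (\<iota> (\<sigma> v)) (snd v)) f"
    by (rule rhom_eqI)
       (simp_all add: rhom_comp[OF hm rhom_shift_hom] rhom_alphabet_subst[OF hc] shift_hom_cst shift_hom_alphabet_gen c alphabet_subst_cst[OF h] alphabet_subst_cst[OF hc]
         alphabet_subst_alphabet_gen[OF h] alphabet_subst_alphabet_gen[OF hc] rhom_add[OF hm] map_poly_monom rhom_0[OF he])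
  then show ?thesis by simp
qed

lemma alphabet_subst_vertex_op:
  assumes h: "rhom \<iota>"
  shows "alphabet_subst \<iota> \<xi> (vertex_op (exp_coeff cst (pleth_arg cst \<tau> n alphabet_gen k)) \<sigma> f) =
    contract (exp_coeff \<iota> (pleth_arg \<iota> \<tau> n \<xi> k)) (alphabet_subst (\<lambda>c. [:\<iota> c:]) (\<lambda>v. [:\<xi> v:] + monom (\<iota> (\<sigma> v)) (snd v)) f)"
proof -
  note he = rhom_alphabet_subst[OF h, of \<xi>]
  have v: "alphabet_subst \<iota> \<xi> (pleth_arg cst \<tau> n alphabet_gen k r) = pleth_arg \<iota> \<tau> n \<xi> k r" for r
    unfolding pleth_arg_def rhom_sum[OF he]
    by (intro sum.cong refl) (simp add: rhom_mult[OF he] alphabet_subst_cst[OF h] alphabet_subst_alphabet_gen[OF h] rhom_0[OF he])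
  have "alphabet_subst \<iota> \<xi> (exp_coeff cst (pleth_arg cst \<tau> n alphabet_gen k) b) = exp_coeff \<iota> (pleth_arg \<iota> \<tau> n \<xi> k) b" for b
    unfolding exp_coeff_rhom[OF he] alphabet_subst_cst[OF h] v ..
  then show ?thesis
    unfolding vertex_op_def contract_rhom[OF he] map_poly_shift_hom[OF h] by simp
qed

definition letters_psum :: "(nat \<times> 'r) list \<Rightarrow> nat \<times> nat \<Rightarrow> 'r::comm_ring_1" where
  "letters_psum zs v = (\<Sum>(i, Y)\<leftarrow>zs. letter i Y v)"

lemma letters_psum_Nil [simp]: "letters_psum [] v = 0"
  and letters_psum_Cons: "letters_psum ((i, Y) # zs) v = letters_psum zs v + letter i Y v"
  and letters_psum_append: "letters_psum (zs @ zs') v = letters_psum zs v + letters_psum zs' v"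
  by (simp_all add: letters_psum_def add.commute)

lemma letters_psum_eq: "letters_psum zs (l, r) = (\<Sum>Y\<leftarrow>map snd (filter (\<lambda>z. fst z = l) zs). Y ^ r)"
  by (induct zs) (auto simp: letters_psum_def letter_def)

lemma exp_coeff_zero: "exp_coeff \<iota> (\<lambda>r. 0) b = (if b = 0 then 1 else 0)"
  by (cases b) (simp_all add: exp_coeff.simps(2))

lemma pleth_arg_letter:
  assumes h: "rhom \<iota>" and i: "i < n"
  shows "pleth_arg \<iota> \<tau> n (\<lambda>v. \<xi> v + letter i Y v) k r =
    pleth_arg \<iota> \<tau> n \<xi> k r + (if k \<le> i then \<iota> (1 - (1 / \<tau> i) ^ r) * Y ^ r else 0)"
proof -
  have "pleth_arg \<iota> \<tau> n (\<lambda>v. \<xi> v + letter i Y v) k r =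
    (\<Sum>j<n. (if k \<le> j then \<iota> (1 - (1 / \<tau> j) ^ r) * \<xi> (j, r) else 0) +
       (if j = i then if k \<le> i then \<iota> (1 - (1 / \<tau> i) ^ r) * Y ^ r else 0 else 0))"
    unfolding pleth_arg_def by (intro sum.cong refl) (auto simp: letter_def distrib_left)
  then show ?thesis using i by (simp add: sum.distrib pleth_arg_def)
qed

lemma exp_coeff_letters_psum:
  assumes h: "rhom \<iota>" and "\<And>z. z \<in> set zs \<Longrightarrow> fst z < n"
  shows "Abs_fps (exp_coeff \<iota> (pleth_arg \<iota> \<tau> n (letters_psum zs) k)) = (\<Prod>z\<leftarrow>zs. if k \<le> fst z then letter_factor \<iota> (\<tau> (fst z)) (snd z) else 1)"
  using assms(2)
proof (induct zs)
  case Nil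
  have "pleth_arg \<iota> \<tau> n (letters_psum []) k = (\<lambda>r. 0)"
    by (rule ext) (simp add: pleth_arg_def cong: if_cong)
  moreover have "Abs_fps (exp_coeff \<iota> (\<lambda>r. 0)) = 1" by (rule fps_ext) (simp add: exp_coeff_zero)
  ultimately show ?case by (simp only: list.map prod_list.Nil)
next
  case (Cons z zs)
  obtain i Y where z: "z = (i, Y)" by force
  have i: "i < n" using Cons(2)[of z] z by simp
  have "letters_psum (z # zs) = (\<lambda>v. letters_psum zs v + letter i Y v)" by (auto simp: z letters_psum_Cons)
  then have v: "pleth_arg \<iota> \<tau> n (letters_psum (z # zs)) k = (\<lambda>r. pleth_arg \<iota> \<tau> n (letters_psum zs) k r + (if k \<le> i then \<iota> (1 - (1 / \<tau> i) ^ r) * Y ^ r else 0))"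
    using pleth_arg_letter[OF h i, of \<tau> "letters_psum zs" Y k] by auto
  show ?case
  proof (cases "k \<le> i")
    case True
    then have "Abs_fps (exp_coeff \<iota> (pleth_arg \<iota> \<tau> n (letters_psum (z # zs)) k)) =
      Abs_fps (exp_coeff \<iota> (pleth_arg \<iota> \<tau> n (letters_psum zs) k)) * letter_factor \<iota> (\<tau> i) Y"
      unfolding v using exp_coeff_letter[OF h, of "pleth_arg \<iota> \<tau> n (letters_psum zs) k" "\<tau> i" Y] by simp
    then show ?thesis using Cons True by (simp add: z mult.commute)
  next
    case False
    then have "exp_coeff \<iota> (pleth_arg \<iota> \<tau> n (letters_psum (z # zs)) k) = exp_coeff \<iota> (pleth_arg \<iota> \<tau> n (letters_psum zs) k)"
      unfolding v by simp
    then show ?thesis using Cons False by (simp add: z)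
  qed
qed

lemma filtration_degree: "filtration (\<lambda>d. {p :: 'r::comm_ring_1 poly. degree p \<le> d})"
  unfolding filtration_def
  by (auto intro: degree_add_le order.trans[OF degree_mult_le])

lemma coeff_coeff_mult:
  "coeff (coeff (f * g) c) e = (\<Sum>c'\<le>c. \<Sum>e'\<le>e. coeff (coeff f c') e' * coeff (coeff g (c - c')) (e - e'))"
  by (simp add: coeff_mult coeff_sum)

lemma filtration_weight:
  "filtration (\<lambda>d. {g :: 'r::comm_ring_1 poly poly. \<forall>c e. e + w * c > d \<longrightarrow> coeff (coeff g c) e = 0})"
  unfolding filtration_def
proof (intro conjI allI ballI impI)
  fix d d' and f g :: "'r poly poly"
  assume f: "f \<in> {g. \<forall>c e. e + w * c > d \<longrightarrow> coeff (coeff g c) e = 0}"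
    and g: "g \<in> {g. \<forall>c e. e + w * c > d' \<longrightarrow> coeff (coeff g c) e = 0}"
  have "coeff (coeff (f * g) c) e = 0" if "e + w * c > d + d'" for c e
    unfolding coeff_coeff_mult
  proof (intro sum.neutral ballI)
    fix c' e' assume "c' \<in> {..c}" "e' \<in> {..e}"
    then have "w * c = w * c' + w * (c - c')" "e = e' + (e - e')" by (auto simp flip: distrib_left)
    then have "e' + w * c' > d \<or> (e - e') + w * (c - c') > d'" using that by linarith
    then show "coeff (coeff f c') e' * coeff (coeff g (c - c')) (e - e') = 0"
      using f g by auto
  qed
  then show "f * g \<in> {g. \<forall>c e. e + w * c > d + d' \<longrightarrow> coeff (coeff g c) e = 0}" by blast
qed (auto simp: one_pCons coeff_pCons split: nat.splits)

lemma poly_aug_mono: "poly (aug_mono \<xi> L) x = aug_mono (\<lambda>v. poly (\<xi> v) x) L"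
  by (rule aug_mono_rhom[OF rhom_poly])

text \<open>
  Each factor \<open>z\<close> comes with at most one factor \<open>s\<close>.
\<close>

lemma coeff_fps_prod_letter_factor_degree:
  "degree (fps_nth (\<Prod>z\<leftarrow>zs. if P z then letter_factor (\<lambda>c. [:c:]) (\<tau> (fst z)) (monom (snd z) 1) else 1) b) \<le> b"
proof (induct zs arbitrary: b)
  case Nil
  show ?case by simp
next
  case (Cons z zs)
  have 1: "degree (fps_nth (if P z then letter_factor (\<lambda>c. [:c:]) (\<tau> (fst z)) (monom (snd z) 1) else 1) b) \<le> b" for b
    by (auto simp: letter_factor_def monom_power smult_monom intro: order.trans[OF degree_monom_le])
  show ?case
    unfolding list.map prod_list.Cons fps_mult_nth
  proof (intro degree_sum_le)
    fix i assume "i \<in> {0..b}"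
    then have "i + (b - i) = b" by simp
    then show "degree (fps_nth (if P z then letter_factor (\<lambda>c. [:c:]) (\<tau> (fst z)) (monom (snd z) 1) else 1) i *
       fps_nth (\<Prod>z\<leftarrow>zs. if P z then letter_factor (\<lambda>c. [:c:]) (\<tau> (fst z)) (monom (snd z) 1) else 1) (b - i)) \<le> b"
      using order.trans[OF degree_mult_le add_mono[OF 1[of i] Cons[of "b - i"]]] by simp
  qed simp
qed

lemma fscale_letter_factor: "letter_factor (\<lambda>c. [:c:]) \<tau> (monom y 1) = fscale (letter_factor (\<lambda>c. c) \<tau> y)"
  by (rule fps_ext) (simp add: letter_factor_def fscale_def monom_power smult_monom monom_0 one_pCons)

lemma fconst_letter_factor: "letter_factor (\<lambda>c. [:c:]) \<tau> [:y:] = fconst (letter_factor (\<lambda>c. c) \<tau> y)"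
proof -
  have "[:y:] ^ b = [:y ^ b:]" for b by (induct b) (simp_all add: one_pCons)
  then show ?thesis by (intro fps_ext) (simp add: letter_factor_def fconst_def one_pCons)
qed

text \<open>
  The letters in \<open>F\<close> are multiplied by the variable \<open>s\<close>, those in \<open>U\<close> are not, and all those
  in \<open>F\<close> have colour at most \<open>l\<close>. By the last hypothesis, \<open>d\<close> bounds what the parts of \<open>L\<close>
  can contribute when they are placed on the letters of \<open>F\<close>; the theorem says that applying
  the operator preserves this bound.

  If \<open>l > k\<close>, then the shift does not create letters of colour \<open>l\<close>. Counting a degree in \<open>w\<close>
  like a degree in \<open>s\<close>, the bound \<open>d\<close> holds for the shifted polynomial, and a coefficient of
  the exponential has no more factors \<open>s\<close> than \<open>z\<close>.

  If \<open>l \<le> k\<close>, then only the letters of colour \<open>k\<close> contribute to the scaled part of the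
  exponential, and partial fractions turn the contraction into evaluations at \<open>w = s y\<close>, for
  the scaled letters \<open>s y\<close> of colour \<open>k\<close>. As \<open>\<sigma> (k, r) = \<kappa>^r - 1\<close>, the shift
  with \<open>w = s y\<close> replaces the letter \<open>s y\<close> by \<open>\<kappa> s y\<close>, so the number of scaled
  letters does not change and the bound still applies. The letters in \<open>U\<close> contribute a
  series in \<open>z\<close> that does not involve \<open>s\<close>, which \<open>poly_shift_bound\<close> takes into account.
\<close>

theorem vertex_op_letters_degree:
  fixes L :: "(nat \<times> nat) list" and F U :: "(nat \<times> 'k::linordered_field) list"
  assumes \<sigma>: "\<And>r. \<sigma> (k, r) = \<kappa> ^ r - 1" "\<And>i r. i > k \<Longrightarrow> \<sigma> (i, r) = 0"
    and k: "k < n"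
    and F: "\<And>z. z \<in> set F \<Longrightarrow> fst z \<le> l \<and> fst z < n" "distinct (map snd F)" "0 \<notin> snd ` set F"
    and U: "\<And>z. z \<in> set U \<Longrightarrow> fst z < n"
    and d: "\<And>J. mset J \<subseteq># mset L \<Longrightarrow> \<forall>v\<in>set J. fst v \<le> l \<Longrightarrow>
       length (filter (\<lambda>v. fst v = l) J) \<le> length (filter (\<lambda>z. fst z = l) F) \<Longrightarrow> sum_list (map snd J) \<le> d"
  shows "degree (alphabet_subst (\<lambda>c. [:c:]) (\<lambda>v. letters_psum (map (map_prod id (\<lambda>y. monom y 1)) F) v + letters_psum (map (map_prod id (\<lambda>y. [:y:])) U) v)
     (vertex_op (exp_coeff cst (pleth_arg cst \<tau> n alphabet_gen k)) \<sigma> (amono L))) \<le> d"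
proof -
  let ?F = "map (map_prod id (\<lambda>y. monom y 1)) F" and ?U = "map (map_prod id (\<lambda>y. [:y:])) U"
  let ?c = "\<lambda>c::'k. [:c:]"
  define Ys where "Ys = map (\<lambda>z. monom (snd z) 1) (filter (\<lambda>z. fst z = l) F)"
  have lenYs: "length Ys = length (filter (\<lambda>z. fst z = l) F)" by (simp add: Ys_def)
  have Fl: "letters_psum ?F (l, r) = (\<Sum>Y\<leftarrow>Ys. Y ^ r)" for r
    unfolding letters_psum_eq Ys_def by (simp add: filter_map o_def)
  have Fgt: "letters_psum ?F (i, r) = 0" if "i > l" for i r
  proof -
    have "filter (\<lambda>z. fst z = i) ?F = []" using that by (auto simp: filter_empty_conv dest!: F(1))
    then show ?thesis by (simp add: letters_psum_eq)
  qed
  have Fdeg: "degree (letters_psum ?F (i, r)) \<le> r" for i r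
  proof -
    have "letters_psum ?F (i, r) \<in> {p. degree p \<le> r}"
      unfolding letters_psum_eq
      by (rule filtration_sum_list[OF filtration_degree])
         (auto intro!: order.trans[OF degree_power_le] simp: degree_monom_eq degree_monom_le intro: order.trans[OF mult_right_mono[OF degree_monom_le]])
    then show ?thesis by simp
  qed
  have pc: "degree ([:y:] ^ r) = 0" for y :: 'k and r
    using degree_power_le[of "[:y:]" r] by simp
  have Udeg: "degree (letters_psum ?U v) \<le> 0" for v
  proof -
    have "letters_psum ?U (fst v, snd v) \<in> {p. degree p \<le> 0}"
      unfolding letters_psum_eq
      by (rule filtration_sum_list[OF filtration_degree]) (auto simp: pc)
    then show ?thesis by simp
  qed
  define \<xi> where "\<xi> = (\<lambda>v. letters_psum ?F v + letters_psum ?U v)"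
  define g where "g = aug_mono (\<lambda>v. [:\<xi> v:] + monom [:\<sigma> v:] (snd v)) L"
  define \<alpha> where "\<alpha> = exp_coeff ?c (pleth_arg ?c \<tau> n \<xi> k)"
  have hc: "rhom (\<lambda>c. [:?c c:])" using rhom_comp[OF rhom_const_poly rhom_const_poly] by simp
  have eq: "alphabet_subst ?c \<xi> (vertex_op (exp_coeff cst (pleth_arg cst \<tau> n alphabet_gen k)) \<sigma> (amono L)) = contract \<alpha> g"
    unfolding alphabet_subst_vertex_op[OF rhom_const_poly] alphabet_subst_amono[OF hc] g_def \<alpha>_def ..
  have \<xi>_app: "\<xi> = letters_psum (?F @ ?U)" by (auto simp: \<xi>_def letters_psum_append)
  have \<alpha>: "Abs_fps \<alpha> =
      (\<Prod>z\<leftarrow>F. if k \<le> fst z then letter_factor ?c (\<tau> (fst z)) (monom (snd z) 1) else 1) *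
      (\<Prod>z\<leftarrow>U. if k \<le> fst z then letter_factor ?c (\<tau> (fst z)) [:snd z:] else 1)"
    unfolding \<alpha>_def \<xi>_app
    by (subst exp_coeff_letters_psum[OF rhom_const_poly]) (use F(1) U in \<open>auto simp: o_def cong: if_cong\<close>)
  \<comment> \<open>The part of the exponential that comes from the letters that are not scaled.\<close>
  define \<omega> where "\<omega> = (\<Prod>z\<leftarrow>U. if k \<le> fst z then letter_factor (\<lambda>c. c) (\<tau> (fst z)) (snd z) else 1)"
  have \<omega>: "(\<Prod>z\<leftarrow>U. if k \<le> fst z then letter_factor ?c (\<tau> (fst z)) [:snd z:] else 1) = fconst \<omega>"
    unfolding \<omega>_def by (induct U) (auto simp: fconst_1 fconst_mult fconst_letter_factor)
  \<comment> \<open>The coefficients of \<sigma> have degree zero in s. The weight w of the other variable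
    is one in the first case below and zero in the second.\<close>
  have W0: "monom [:a:] r \<in> {g. \<forall>c e. e + 0 * c > 0 \<longrightarrow> coeff (coeff g c) e = 0}" for a :: 'k and r
    by (auto simp: coeff_monom coeff_pCons split: nat.splits)
  have W1: "monom [:a:] r \<in> {g. \<forall>c e. e + 1 * c > r \<longrightarrow> coeff (coeff g c) e = 0}" for a :: 'k and r
    by (auto simp: coeff_monom coeff_pCons split: nat.splits)
  have Wc: "degree p \<le> r \<Longrightarrow> [:p:] \<in> {g. \<forall>c e. e + w * c > r \<longrightarrow> coeff (coeff g c) e = 0}" for p :: "'k poly" and r w
    by (auto simp: coeff_pCons coeff_eq_0 split: nat.splits)
  have cs: "[:\<Sum>Y\<leftarrow>Ys. Y ^ r:] = (\<Sum>y\<leftarrow>map (\<lambda>Y. [:Y:]) Ys. y ^ r)" for r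
    by (simp add: rhom_sum_list[OF rhom_const_poly] rhom_power[OF rhom_const_poly] o_def)
  have Y1: "degree Y \<le> 1" if "Y \<in> set Ys" for Y
    using that by (auto simp: Ys_def intro: order.trans[OF degree_monom_le])
  show ?thesis
  proof (cases "l > k")
    case True
    have "aug_mono (\<lambda>v. ([:letters_psum ?F v:] + monom [:\<sigma> v:] (snd v)) + [:letters_psum ?U v:]) L \<in> {g. \<forall>c e. e + 1 * c > d \<longrightarrow> coeff (coeff g c) e = 0}"
    proof (rule aug_mono_bound[where l = l and ys = "map (\<lambda>Y. [:Y:]) Ys", OF filtration_weight])
      fix i r
      have "[:letters_psum ?F (i, r):] \<in> {g. \<forall>c e. e + 1 * c > r \<longrightarrow> coeff (coeff g c) e = 0}"
        by (rule Wc[OF Fdeg])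
      then show "[:letters_psum ?F (i, r):] + monom [:\<sigma> (i, r):] (snd (i, r)) \<in> {g. \<forall>c e. e + 1 * c > r \<longrightarrow> coeff (coeff g c) e = 0}"
        using W1[of "\<sigma> (i, r)" r] by (simp only: mem_Collect_eq snd_conv coeff_add) simp
    next
      fix r show "[:letters_psum ?F (l, r):] + monom [:\<sigma> (l, r):] (snd (l, r)) = (\<Sum>y\<leftarrow>map (\<lambda>Y. [:Y:]) Ys. y ^ r)"
        using \<sigma>(2)[OF True] by (simp only: Fl cs) simp
    next
      fix y assume "y \<in> set (map (\<lambda>Y. [:Y:]) Ys)"
      then show "y \<in> {g. \<forall>c e. e + 1 * c > 1 \<longrightarrow> coeff (coeff g c) e = 0}"
        using Wc[OF Y1, of _ 1] by auto
    next
      fix i r assume "i > l"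
      then show "[:letters_psum ?F (i, r):] + monom [:\<sigma> (i, r):] (snd (i, r)) = 0"
        using \<sigma>(2) True Fgt[of i r] by simp
    next
      fix v show "[:letters_psum ?U v:] \<in> {g. \<forall>c e. e + 1 * c > 0 \<longrightarrow> coeff (coeff g c) e = 0}"
        by (rule Wc[OF Udeg])
    qed (use d lenYs in auto)
    also have "(\<lambda>v. ([:letters_psum ?F v:] + monom [:\<sigma> v:] (snd v)) + [:letters_psum ?U v:]) = (\<lambda>v. [:\<xi> v:] + monom [:\<sigma> v:] (snd v))"
      by (auto simp: \<xi>_def)
    finally have g: "coeff (coeff g c) e = 0" if "e + c > d" for c e
      using that by (simp add: g_def)
    have "degree (\<alpha> b * coeff g b) \<le> d" for b
    proof (cases "b \<le> d")
      case True
      have "\<alpha> b = fps_nth ((\<Prod>z\<leftarrow>F. if k \<le> fst z then letter_factor ?c (\<tau> (fst z)) (monom (snd z) 1) else 1) * fconst \<omega>) b"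
        using arg_cong[OF \<alpha>, of "\<lambda>f. fps_nth f b"] by (simp add: \<omega>)
      also have "degree \<dots> \<le> b"
        unfolding fps_mult_nth
      proof (intro degree_sum_le)
        fix i assume i: "i \<in> {0..b}"
        have "degree (fps_nth (\<Prod>z\<leftarrow>F. if k \<le> fst z then letter_factor ?c (\<tau> (fst z)) (monom (snd z) 1) else 1) i) + 0 \<le> i + (b - i)"
          by (intro add_mono coeff_fps_prod_letter_factor_degree) simp
        moreover have "degree (fps_nth (fconst \<omega>) (b - i)) = 0" by (simp add: fconst_def)
        ultimately show "degree (fps_nth (\<Prod>z\<leftarrow>F. if k \<le> fst z then letter_factor ?c (\<tau> (fst z)) (monom (snd z) 1) else 1) i * fps_nth (fconst \<omega>) (b - i)) \<le> b"
          using i by (intro order.trans[OF degree_mult_le]) simp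
      qed simp
      finally have "degree (\<alpha> b) \<le> b" .
      moreover have "degree (coeff g b) \<le> d - b"
        by (rule degree_le) (use g True in auto)
      ultimately have "degree (\<alpha> b) + degree (coeff g b) \<le> d" using True by linarith
      then show ?thesis using degree_mult_le order.trans by blast
    next
      case False
      then have "coeff g b = 0" using g by (intro poly_eqI) simp
      then show ?thesis by simp
    qed
    then have "degree (contract \<alpha> g) \<le> d"
      unfolding contract_def by (intro degree_sum_le) auto
    then show ?thesis using eq by (simp add: \<xi>_def)
  next
    case False
    then have lk: "l \<le> k" by simp
    define ys where "ys = map snd (filter (\<lambda>z. fst z = k) F)"
    have ys: "distinct ys" "0 \<notin> set ys" using F(2,3) by (auto simp: ys_def distinct_map_filter)
    have "(\<Prod>z\<leftarrow>G. if k \<le> fst z then letter_factor ?c (\<tau> (fst z)) (monom (snd z) 1) else 1) =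
       fscale (\<Prod>y\<leftarrow>map snd (filter (\<lambda>z. fst z = k) G). letter_factor (\<lambda>c. c) (\<tau> k) y)" if "\<And>z. z \<in> set G \<Longrightarrow> fst z \<le> k" for G
      using that by (induct G) (auto simp: fscale_1 fscale_mult fscale_letter_factor[unfolded One_nat_def] dest: order.antisym)
    moreover have "fst z \<le> k" if "z \<in> set F" for z using F(1)[OF that] lk by simp
    ultimately have "(\<Prod>z\<leftarrow>F. if k \<le> fst z then letter_factor ?c (\<tau> (fst z)) (monom (snd z) 1) else 1) =
       fscale (\<Prod>y\<leftarrow>ys. letter_factor (\<lambda>c. c) (\<tau> k) y)" unfolding ys_def by blast
    moreover have "fps_nth (Abs_fps \<alpha>) = \<alpha>" by (rule ext) simp
    ultimately have A: "\<alpha> = fps_nth (fscale (\<Prod>y\<leftarrow>ys. letter_factor (\<lambda>c. c) (\<tau> k) y) * fconst \<omega>)"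
      using arg_cong[OF \<alpha>, of fps_nth] unfolding \<omega> by (simp only:)
    obtain c0 c where pf: "\<And>b. fps_nth (\<Prod>y\<leftarrow>ys. letter_factor (\<lambda>c. c) (\<tau> k) y) b = (if b = 0 then c0 else 0) + (\<Sum>y\<in>set ys. c y * y ^ b)"
      using letter_factor_product_partial_fractions[OF ys] by blast
    define g' where "g' = (\<Sum>c\<le>degree g. smult [:fps_nth \<omega> c:] (poly_shift c g))"
    have cg: "contract \<alpha> g = smult c0 (coeff g' 0) + (\<Sum>y\<in>set ys. smult (c y) (poly g' (monom y 1)))"
      unfolding A contract_fconst g'_def[symmetric] by (rule contract_fscale_geo[OF pf])
    have "aug_mono (\<lambda>v. [:letters_psum ?F v:] + ([:letters_psum ?U v:] + monom [:\<sigma> v:] (snd v))) L \<in> {g. \<forall>c e. e + 0 * c > d \<longrightarrow> coeff (coeff g c) e = 0}"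
    proof (rule aug_mono_bound[where l = l and ys = "map (\<lambda>Y. [:Y:]) Ys", OF filtration_weight])
      fix i r
      show "[:letters_psum ?F (i, r):] \<in> {g. \<forall>c e. e + 0 * c > r \<longrightarrow> coeff (coeff g c) e = 0}"
        by (rule Wc[OF Fdeg])
    next
      fix r show "[:letters_psum ?F (l, r):] = (\<Sum>y\<leftarrow>map (\<lambda>Y. [:Y:]) Ys. y ^ r)"
        by (simp only: Fl cs)
    next
      fix y assume "y \<in> set (map (\<lambda>Y. [:Y:]) Ys)"
      then show "y \<in> {g. \<forall>c e. e + 0 * c > 1 \<longrightarrow> coeff (coeff g c) e = 0}"
        using Wc[OF Y1, of _ 0] by auto
    next
      fix i r assume "i > l"
      then show "[:letters_psum ?F (i, r):] = 0" using Fgt[of i r] by simp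
    next
      fix v
      have "[:letters_psum ?U v:] \<in> {g. \<forall>c e. e + 0 * c > 0 \<longrightarrow> coeff (coeff g c) e = 0}"
        by (rule Wc[OF Udeg])
      then show "[:letters_psum ?U v:] + monom [:\<sigma> v:] (snd v) \<in> {g. \<forall>c e. e + 0 * c > 0 \<longrightarrow> coeff (coeff g c) e = 0}"
        using W0[of "\<sigma> v" "snd v"] by (simp only: mem_Collect_eq coeff_add) simp
    qed (use d lenYs in auto)
    also have "(\<lambda>v. [:letters_psum ?F v:] + ([:letters_psum ?U v:] + monom [:\<sigma> v:] (snd v))) = (\<lambda>v. [:\<xi> v:] + monom [:\<sigma> v:] (snd v))"
      by (auto simp: \<xi>_def)
    finally have g0: "coeff (coeff g c) e = 0" if "e > d" for c e
      using that by (simp add: g_def)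
    have gy: "degree (poly g (monom y 1)) \<le> d" if y: "y \<in> set ys" for y
    proof -
      let ?x = "monom y 1 :: 'k poly"
      have l: "l = k" using y F(1) lk by (auto simp: ys_def dest: order.antisym)
      have xY: "?x \<in> set Ys" using y l by (auto simp: ys_def Ys_def)
      \<comment> \<open>The shift replaces the letter s y by its multiple with \<kappa>, and keeps all
        others.\<close>
      define Zs where "Zs = smult \<kappa> ?x # remove1 ?x Ys"
      have lenZ: "length Zs = length Ys" using xY by (simp add: Zs_def length_remove1) (metis Suc_pred length_pos_if_in_set)
      have powx: "smult \<kappa> p ^ r = smult (\<kappa> ^ r) (p ^ r)" for p :: "'k poly" and r
        by (simp add: smult_power)
      have sumZ: "(\<Sum>z\<leftarrow>Zs. z ^ r) = (\<Sum>Y\<leftarrow>Ys. Y ^ r) + [:\<sigma> (k, r):] * ?x ^ r" for r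
      proof -
        have "(\<Sum>Y\<leftarrow>Ys. Y ^ r) = ?x ^ r + (\<Sum>z\<leftarrow>remove1 ?x Ys. z ^ r)"
          using xY by (rule sum_list_map_remove1)
        then show ?thesis by (simp add: Zs_def powx \<sigma>(1)) (simp add: algebra_simps smult_diff_left)
      qed
      have "poly g ?x = aug_mono (\<lambda>v. (letters_psum ?F v + (if fst v \<le> k then [:\<sigma> v:] * ?x ^ snd v else 0)) + letters_psum ?U v) L"
        unfolding g_def poly_aug_mono
        by (rule aug_mono_cong) (auto simp: \<xi>_def poly_monom \<sigma>(2) not_le)
      also have "\<dots> \<in> {p. degree p \<le> d}"
      proof (rule aug_mono_bound[where l = l and ys = Zs, OF filtration_degree])
        fix i r
        have "degree ([:\<sigma> (i, r):] * ?x ^ r) \<le> r"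
          by (auto simp: monom_power intro: order.trans[OF degree_smult_le] order.trans[OF degree_monom_le])
        then show "letters_psum ?F (i, r) + (if fst (i, r) \<le> k then [:\<sigma> (i, r):] * ?x ^ snd (i, r) else 0) \<in> {p. degree p \<le> r}"
          using Fdeg[of i r] by (auto intro!: degree_add_le)
      next
        fix r show "letters_psum ?F (l, r) + (if fst (l, r) \<le> k then [:\<sigma> (l, r):] * ?x ^ snd (l, r) else 0) = (\<Sum>z\<leftarrow>Zs. z ^ r)"
          using sumZ[of r] Fl[of r] l by simp
      next
        fix z assume "z \<in> set Zs"
        then have "z = smult \<kappa> ?x \<or> z \<in> set Ys" using set_remove1_subset by (fastforce simp: Zs_def)
        then show "z \<in> {p. degree p \<le> 1}" using Y1
          by (auto intro: order.trans[OF degree_smult_le] order.trans[OF degree_monom_le])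
      next
        fix i r assume "i > l"
        then show "letters_psum ?F (i, r) + (if fst (i, r) \<le> k then [:\<sigma> (i, r):] * ?x ^ snd (i, r) else 0) = 0"
          using l Fgt[of i r] by simp
      qed (use d lenYs lenZ Udeg in auto)
      finally show ?thesis by simp
    qed
    have sh: "coeff (poly (poly_shift c g) (monom y 1)) e = 0" if "e > d" "y \<in> set ys" for c y e
    proof -
      have "y * inverse y = 1" using ys that by (intro right_inverse) auto
      then show ?thesis
        by (rule poly_shift_bound(1)[where d = d]) (use g0 that order.strict_trans1[OF gy] in \<open>auto intro!: coeff_eq_0\<close>)
    qed
    have "coeff (contract \<alpha> g) e = 0" if "e > d" for e
      unfolding cg g'_def using that
      by (simp add: coeff_sum poly_sum coeff_poly_shift g0 sh[unfolded One_nat_def])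
    then have "degree (contract \<alpha> g) \<le> d" by (intro degree_le) auto
    then show ?thesis using eq by (simp add: \<xi>_def)
  qed
qed

section \<open>Extracting coordinates letter by letter\<close>

text \<open>
  The variable of the resulting polynomial is the letter that is added to the alphabet \<open>i\<close>.
\<close>

definition adjoin_letter :: "nat \<Rightarrow> 'k::field_char_0 pring \<Rightarrow> 'k pring poly" where
  "adjoin_letter i = alphabet_subst (\<lambda>c. [:cst c:]) (\<lambda>v. [:alphabet_gen v:] + letter i (monom 1 1) v)"

definition letter_coeff :: "nat \<Rightarrow> nat \<Rightarrow> 'k::field_char_0 pring \<Rightarrow> 'k pring" where
  "letter_coeff i a h = coeff (adjoin_letter i h) a"

lemma rhom_adjoin_letter: "rhom (adjoin_letter i)"
  unfolding adjoin_letter_def by (rule rhom_alphabet_subst[OF rhom_cst_poly])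

lemma adjoin_letter_cst: "adjoin_letter i (cst c) = [:cst c:]"
  by (simp add: adjoin_letter_def alphabet_subst_cst[OF rhom_cst_poly])

lemma letter_coeff_add: "letter_coeff i a (f + g) = letter_coeff i a f + letter_coeff i a g"
  by (simp add: letter_coeff_def rhom_add[OF rhom_adjoin_letter])

lemma letter_coeff_cst: "letter_coeff i a (cst c * f) = cst c * letter_coeff i a f"
  by (simp add: letter_coeff_def rhom_mult[OF rhom_adjoin_letter] adjoin_letter_cst)

lemma aug_mono_const: "aug_mono (\<lambda>v. [:\<xi> v:]) L = [:aug_mono \<xi> L:]"
  using aug_mono_rhom[OF rhom_const_poly, of \<xi> L] by simp

lemma letter_rhom: "rhom h \<Longrightarrow> h (letter i Y v) = letter i (h Y) v"
  by (auto simp: letter_def rhom_0 rhom_power split: prod.splits)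

text \<open>
  The coefficient of the power \<open>a\<close> of a new letter of colour \<open>i\<close> comes from the parts \<open>(i,
  a)\<close>, of which it removes one.
\<close>

lemma letter_coeff_amono:
  assumes a: "a > 0"
  shows "letter_coeff i a (amono L :: 'k::field_char_0 pring) = (\<Sum>(y, M)\<leftarrow>removals L. if y = (i, a) then amono M else 0)"
proof -
  have "adjoin_letter i (amono L :: 'k pring) = [:amono L:] + (\<Sum>(y, M)\<leftarrow>removals L. if fst y = i then monom 1 1 ^ snd y * [:amono M:] else 0)"
    unfolding adjoin_letter_def alphabet_subst_amono[OF rhom_cst_poly] aug_mono_add_letter aug_mono_const amono_def[symmetric] ..
  moreover have "coeff (sum_list xs) a = (\<Sum>x\<leftarrow>xs. coeff x a)" for xs :: "'k pring poly list"
    by (induct xs) auto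
  moreover have "coeff (if fst y = i then monom 1 1 ^ snd y * [:m:] else 0) a = (if y = (i, a) then m else 0)"
    for y and m :: "'k pring"
    by (auto simp: monom_power coeff_monom_mult coeff_pCons prod_eq_iff split: nat.split)
  ultimately show ?thesis
    using a by (simp only: letter_coeff_def) (auto simp: case_prod_unfold o_def coeff_pCons split: nat.split)
qed

lemma alphabet_subst_letter:
  assumes h: "rhom \<iota>" and N: "degree (adjoin_letter i f) \<le> N"
  shows "alphabet_subst \<iota> (\<lambda>v. \<xi> v + letter i Y v) f = (\<Sum>a\<le>N. alphabet_subst \<iota> \<xi> (letter_coeff i a f) * Y ^ a)"
proof -
  note he = rhom_alphabet_subst[OF h, of \<xi>]
  note hm = rhom_map_poly[OF he]
  have c: "map_poly (alphabet_subst \<iota> \<xi>) [:a:] = [:alphabet_subst \<iota> \<xi> a:]" for a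
    using map_poly_pCons[of "alphabet_subst \<iota> \<xi>" a 0] rhom_0[OF he] by simp
  have m: "map_poly (alphabet_subst \<iota> \<xi>) (monom 1 1) = monom 1 1"
    using map_poly_monom[of "alphabet_subst \<iota> \<xi>" 1 1] rhom_0[OF he] rhom_1[OF he] by simp
  have "(\<lambda>f. poly (map_poly (alphabet_subst \<iota> \<xi>) (adjoin_letter i f)) Y) f = alphabet_subst \<iota> (\<lambda>v. \<xi> v + letter i Y v) f"
  proof (rule rhom_eqI)
    show "rhom (\<lambda>f. poly (map_poly (alphabet_subst \<iota> \<xi>) (adjoin_letter i f)) Y)"
      by (rule rhom_comp[OF rhom_poly rhom_comp[OF hm rhom_adjoin_letter]])
    show "rhom (alphabet_subst \<iota> (\<lambda>v. \<xi> v + letter i Y v))" by (rule rhom_alphabet_subst[OF h])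
    show "poly (map_poly (alphabet_subst \<iota> \<xi>) (adjoin_letter i (cst d))) Y = alphabet_subst \<iota> (\<lambda>v. \<xi> v + letter i Y v) (cst d)" for d
      by (simp add: adjoin_letter_cst c alphabet_subst_cst[OF h])
    show "poly (map_poly (alphabet_subst \<iota> \<xi>) (adjoin_letter i (alphabet_gen v))) Y = alphabet_subst \<iota> (\<lambda>v. \<xi> v + letter i Y v) (alphabet_gen v)" for v
      using letter_rhom[OF hm, where i = i and Y = "monom 1 1" and v = v]
        letter_rhom[OF rhom_poly[of Y], where i = i and Y = "monom 1 1" and v = v]
      by (simp add: adjoin_letter_def alphabet_subst_alphabet_gen[OF rhom_cst_poly] alphabet_subst_alphabet_gen[OF h] rhom_add[OF hm] c m[unfolded One_nat_def] poly_monom)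
  qed
  then have "alphabet_subst \<iota> (\<lambda>v. \<xi> v + letter i Y v) f = poly (map_poly (alphabet_subst \<iota> \<xi>) (adjoin_letter i f)) Y" by simp
  also have "\<dots> = (\<Sum>a\<le>degree (map_poly (alphabet_subst \<iota> \<xi>) (adjoin_letter i f)). alphabet_subst \<iota> \<xi> (letter_coeff i a f) * Y ^ a)"
    by (simp add: poly_altdef coeff_map_poly rhom_0[OF he] letter_coeff_def)
  also have "\<dots> = (\<Sum>a\<le>N. alphabet_subst \<iota> \<xi> (letter_coeff i a f) * Y ^ a)"
  proof (rule sum.mono_neutral_left)
    show "{..degree (map_poly (alphabet_subst \<iota> \<xi>) (adjoin_letter i f))} \<subseteq> {..N}"
      using degree_map_poly_rhom[OF he, of "adjoin_letter i f"] N by auto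
    show "\<forall>a\<in>{..N} - {..degree (map_poly (alphabet_subst \<iota> \<xi>) (adjoin_letter i f))}. alphabet_subst \<iota> \<xi> (letter_coeff i a f) * Y ^ a = 0"
      using coeff_eq_0[of "map_poly (alphabet_subst \<iota> \<xi>) (adjoin_letter i f)"] by (auto simp: coeff_map_poly rhom_0[OF he] letter_coeff_def)
  qed simp
  finally show ?thesis .
qed

lemma Sym_linear_eqI:
  fixes F G :: "'k::field_char_0 pring \<Rightarrow> 'b::ab_group_add"
  assumes "f \<in> Sym n"
    and "\<And>f g. F (f + g) = F f + F g" "\<And>f g. G (f + g) = G f + G g"
    and "\<And>c f. F f = G f \<Longrightarrow> F (cst c * f) = G (cst c * f)"
    and "\<And>L. mset L \<in> index_set n \<Longrightarrow> F (amono L) = G (amono L)"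
  shows "F f = G f"
  using Sym_span_amono[OF assms(1)]
proof (induct rule: pr.span_induct_alt)
  case base
  have "F 0 = 0" "G 0 = 0" using assms(2)[of 0 0] assms(3)[of 0 0] by auto
  then show ?case by simp
qed (use assms in auto)

lemma map_fst_removals: "map fst (removals L) = L"
  by (induct L) (auto simp: o_def case_prod_unfold)

lemma sum_list_removals_count:
  "(\<Sum>(y, M)\<leftarrow>removals L. if y = x then c else 0) = of_nat (count (mset L) x) * (c :: 'r::comm_ring_1)"
proof -
  have "(\<Sum>(y, M)\<leftarrow>removals L. if y = x then c else 0) = (\<Sum>y\<leftarrow>map fst (removals L). if y = x then c else 0)"
    by (simp add: o_def case_prod_unfold)
  also have "\<dots> = of_nat (count (mset L) x) * c"
    unfolding map_fst_removals by (induct L) (auto simp: algebra_simps)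
  finally show ?thesis .
qed

lemma mcoord_letter_coeff_amono:
  assumes "i < n" "a > 0" "C \<in> index_set n" "mset L \<in> index_set n"
  shows "mcoord C (letter_coeff i a (amono L)) = (of_nat (count C (i, a)) + 1) * mcoord (add_mset (i, a) C) (amono L :: 'k::field_char_0 pring)"
proof -
  have "mcoord C (letter_coeff i a (amono L)) = (\<Sum>(y, M)\<leftarrow>removals L. mcoord C (if y = (i, a) then amono M else 0))"
    by (simp add: letter_coeff_amono assms mcoord_sum_list o_def case_prod_unfold)
  also have "\<dots> = (\<Sum>(y, M)\<leftarrow>removals L. if y = (i, a) then of_bool (mset L = add_mset (i, a) C) else 0)"
  proof (intro arg_cong[of _ _ sum_list] map_cong refl, clarify)
    fix c b M assume "((c, b), M) \<in> set (removals L)"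
    then have L: "mset L = add_mset (c, b) (mset M)" by (rule removals_mset)
    have M: "snd v > 0" if "v \<in> set M" for v using that assms(4) unfolding L index_set_def by auto
    have "mcoord C (amono M) = of_bool (mset M = C)"
      by (rule mcoord_amono) (use assms(3) M in \<open>auto simp: index_set_def\<close>)
    then show "mcoord C (if (c, b) = (i, a) then amono M else 0) = (if (c, b) = (i, a) then of_bool (mset L = add_mset (i, a) C) else 0)"
      using L by (auto simp: mcoord_0)
  qed
  also have "\<dots> = of_nat (count (mset L) (i, a)) * of_bool (mset L = add_mset (i, a) C)"
    by (rule sum_list_removals_count)
  also have "\<dots> = (of_nat (count C (i, a)) + 1) * of_bool (mset L = add_mset (i, a) C)"
    by (cases "mset L = add_mset (i, a) C") simp_all
  also have "of_bool (mset L = add_mset (i, a) C) = mcoord (add_mset (i, a) C) (amono L :: 'k pring)"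
  proof (rule mcoord_amono[symmetric])
    show "snd v > 0" if "v \<in># add_mset (i, a) C" for v using that assms by (auto simp: index_set_def)
    show "snd v > 0" if "v \<in> set L" for v using that assms(4) by (auto simp: index_set_def)
  qed
  finally show ?thesis .
qed

text \<open>
  Coordinates of \<open>h\<close> are found by splitting off letters successively, until only the
  constant coefficient is left.
\<close>

lemma mcoord_letter_coeff:
  assumes "i < n" "a > 0" "C \<in> index_set n" "h \<in> Sym n"
  shows "mcoord C (letter_coeff i a h) = (of_nat (count C (i, a)) + 1) * mcoord (add_mset (i, a) C) (h :: 'k::field_char_0 pring)"
  by (rule Sym_linear_eqI[OF assms(4)])
     (simp_all add: letter_coeff_add letter_coeff_cst mcoord_add mcoord_cst distrib_left mcoord_letter_coeff_amono[OF assms(1-3)])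

lemma Sym_letter_coeff:
  assumes "a > 0" "h \<in> Sym n"
  shows "letter_coeff i a (h :: 'k::field_char_0 pring) \<in> Sym n"
  using Sym_span_amono[OF assms(2)]
proof (induct rule: pr.span_induct_alt)
  case base
  show ?case by (simp add: letter_coeff_def rhom_0[OF rhom_adjoin_letter] Sym_0)
next
  case (step c x g)
  then obtain L where L: "x = amono L" "mset L \<in> index_set n" by auto
  have "letter_coeff i a (amono L :: 'k pring) \<in> Sym n"
    unfolding letter_coeff_amono[OF assms(1)]
  proof (rule Sym_sum_list, clarify)
    fix c b M assume "((c, b), M) \<in> set (removals L)"
    then have "mset L = add_mset (c, b) (mset M)" by (rule removals_mset)
    then have "mset M \<in> index_set n" using L(2) by (simp add: index_set_def)
    then show "(if (c, b) = (i, a) then amono M else 0 :: 'k pring) \<in> Sym n" by (simp add: Sym_amono Sym_0)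
  qed
  then show ?case using step L by (simp add: letter_coeff_add letter_coeff_cst Sym_add Sym_mult Sym_cst)
qed

lemma aug_mono_zero: "aug_mono (\<lambda>_. 0) L = (if L = [] then 1 else 0)"
proof (cases L)
  case (Cons x A)
  then show ?thesis using aug_mono_vanish0[of "\<lambda>_. 0" "fst x" L] by simp
qed simp

lemma alphabet_subst_zero:
  assumes "h \<in> Sym n"
  shows "alphabet_subst (\<lambda>c. [:c:]) (\<lambda>_. 0) h = [:mcoord {#} h:]"
proof -
  have m: "mcoord {#} (amono L) = (if L = [] then 1 else 0)" if "mset L \<in> index_set n" for L
    using that by (subst mcoord_amono) (auto simp: index_set_def)
  show ?thesis
  by (rule Sym_linear_eqI[OF assms])
     (simp_all add: rhom_add[OF rhom_alphabet_subst[OF rhom_const_poly]] rhom_mult[OF rhom_alphabet_subst[OF rhom_const_poly]]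
       alphabet_subst_cst[OF rhom_const_poly] alphabet_subst_amono[OF rhom_const_poly] mcoord_add mcoord_cst aug_mono_zero m one_pCons)
qed

text \<open>
  In a triple of colour, flag and part, the flag says whether the letter that carries the
  part is scaled by the variable \<open>s\<close>.
\<close>

definition flag_letter :: "nat \<times> bool \<times> nat \<Rightarrow> 'k \<Rightarrow> nat \<times> 'k::linordered_field poly" where
  "flag_letter z y = (fst z, if fst (snd z) then monom y 1 else [:y:])"

text \<open>
  If evaluating \<open>h\<close> at letters of the prescribed colours always gives degree at most \<open>d\<close>,
  then the coordinate of \<open>h\<close> at the list \<open>fl\<close> vanishes when its flagged parts have a sum
  greater than \<open>d\<close>. The letters are split off one by one: the coefficients with respect to
  the letter \<open>y\<close> are those of a polynomial in \<open>y\<close> with infinitely many zeros. The number \<open>u\<close>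
  is the sum of the flagged parts that have been split off already.
\<close>

lemma letters_vanish:
  fixes h :: "'k::linordered_field pring"
  assumes "h \<in> Sym n" and "\<And>z. z \<in> set fl \<Longrightarrow> fst z < n \<and> snd (snd z) > 0"
    and "\<And>ys e. length ys = length fl \<Longrightarrow> distinct ys \<Longrightarrow> 0 \<notin> set ys \<Longrightarrow> e + u > d \<Longrightarrow>
       coeff (alphabet_subst (\<lambda>c. [:c:]) (letters_psum (map2 flag_letter fl ys)) h) e = 0"
    and "(\<Sum>z\<leftarrow>fl. if fst (snd z) then snd (snd z) else 0) + u > d"
  shows "mcoord (mset (map (\<lambda>z. (fst z, snd (snd z))) fl)) h = 0"
  using assms
proof (induct fl arbitrary: h u)
  case Nil
  have "letters_psum [] = (\<lambda>_. 0 :: 'k poly)" by auto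
  then show ?case using Nil(3)[of "[]" 0] Nil(4) alphabet_subst_zero[OF Nil(1)] by simp
next
  case (Cons z fl)
  obtain i b a where z: "z = (i, b, a)" by (cases z) auto
  have i: "i < n" and a: "a > 0" using Cons(3)[of z] z by auto
  let ?C = "mset (map (\<lambda>z. (fst z, snd (snd z))) fl)"
  let ?ba = "if b then a else 0"
  have C: "?C \<in> index_set n" using Cons(3) by (auto simp: index_set_def)
  have "mcoord ?C (letter_coeff i a h) = 0"
  proof (rule Cons(1))
    show "letter_coeff i a h \<in> Sym n" by (rule Sym_letter_coeff[OF a Cons(2)])
    show "fst z < n \<and> snd (snd z) > 0" if "z \<in> set fl" for z using Cons(3) that by simp
    show "(\<Sum>z\<leftarrow>fl. if fst (snd z) then snd (snd z) else 0) + (u + ?ba) > d"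
      using Cons(5) by (cases b) (simp_all add: z add_ac)
    fix ys :: "'k list" and e
    assume ys: "length ys = length fl" "distinct ys" "0 \<notin> set ys" and e: "e + (u + ?ba) > d"
    define \<xi> where "\<xi> = letters_psum (map2 flag_letter fl ys)"
    define G where "G a = alphabet_subst (\<lambda>c. [:c:]) \<xi> (letter_coeff i a h)" for a
    define N where "N = max a (degree (adjoin_letter i h))"
    define E where "E = e + ?ba"
    \<comment> \<open>These numbers are the coefficients, with respect to y, of the coefficient of s^E; a
      scaled letter to the power a' contributes a' to the degree in s.\<close>
    define \<kappa> where "\<kappa> a' = (if b then if a' \<le> E then coeff (G a') (E - a') else 0 else coeff (G a') E)" for a'
    define p where "p = (\<Sum>a'\<le>N. monom (\<kappa> a') a')"
    have "poly p y = 0" if y: "y \<notin> insert 0 (set ys)" for y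
    proof -
      have "(\<lambda>v. \<xi> v + letter i (snd (flag_letter z y)) v) = letters_psum (map2 flag_letter (z # fl) (y # ys))"
        by (auto simp: \<xi>_def z flag_letter_def letters_psum_Cons)
      then have "coeff (alphabet_subst (\<lambda>c. [:c:]) (\<lambda>v. \<xi> v + letter i (snd (flag_letter z y)) v) h) E = 0"
        using Cons(4)[of "y # ys" E] y ys e by (simp add: E_def add_ac)
      moreover have "alphabet_subst (\<lambda>c. [:c:]) (\<lambda>v. \<xi> v + letter i (snd (flag_letter z y)) v) h = (\<Sum>a'\<le>N. G a' * snd (flag_letter z y) ^ a')"
        unfolding G_def by (rule alphabet_subst_letter[OF rhom_const_poly]) (simp add: N_def)
      moreover have "coeff (G a' * snd (flag_letter z y) ^ a') E = \<kappa> a' * y ^ a'" for a'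
      proof (cases b)
        case True
        then show ?thesis by (simp add: z flag_letter_def \<kappa>_def monom_power mult.commute[of "G a'"] coeff_monom_mult not_le)
      next
        case False
        have "[:y:] ^ a' = [:y ^ a':]" by (induct a') (simp_all add: one_pCons)
        then show ?thesis using False by (simp add: z flag_letter_def \<kappa>_def)
      qed
      ultimately show ?thesis by (simp add: p_def poly_sum poly_monom coeff_sum)
    qed
    then have "- insert 0 (set ys) \<subseteq> {y. poly p y = 0}" by auto
    moreover have "infinite (- insert 0 (set ys))"
      using infinite_UNIV_char_0[where 'a = 'k] finite_compl[of "insert 0 (set ys)"] by auto
    ultimately have "p = 0" using poly_roots_finite[of p] finite_subset by blast
    then have "coeff p a = 0" by simp
    moreover have "coeff p a = \<kappa> a" by (simp add: p_def coeff_sum N_def)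
    moreover have "\<kappa> a = coeff (G a) e" by (simp add: \<kappa>_def E_def)
    ultimately show "coeff (alphabet_subst (\<lambda>c. [:c:]) (letters_psum (map2 flag_letter fl ys)) (letter_coeff i a h)) e = 0"
      by (simp add: G_def \<xi>_def)
  qed
  then have "(of_nat (count ?C (i, a)) + 1) * mcoord (add_mset (i, a) ?C) h = 0"
    using mcoord_letter_coeff[OF i a C Cons(2)] by simp
  moreover have "of_nat (count ?C (i, a)) + 1 \<noteq> (0::'k)"
    using of_nat_0_le_iff[of "count ?C (i, a)", where 'a = 'k] by linarith
  ultimately show ?case by (simp add: z)
qed

section \<open>Diagonal coefficients of vertex operators\<close>

lemma sum_list_monom: "(\<Sum>x\<leftarrow>xs. monom (f x) m) = monom (\<Sum>x\<leftarrow>xs. f x) m"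
  by (induct xs) (auto simp: add_monom[symmetric])

lemma aug_mono_monom: "aug_mono (\<lambda>v. monom (\<xi> v) (snd v)) L = monom (aug_mono \<xi> L) (sum_list (map snd L))"
proof (induct L rule: length_induct')
  case (1 L)
  show ?case
  proof (cases L)
    case Nil then show ?thesis by (simp add: monom_0 one_pCons)
  next
    case (Cons x A)
    have "(\<Sum>M\<leftarrow>merges x A. aug_mono (\<lambda>v. monom (\<xi> v) (snd v)) M) = (\<Sum>M\<leftarrow>merges x A. monom (aug_mono \<xi> M) (sum_list (map snd L)))"
    proof (intro arg_cong[of _ _ sum_list] map_cong refl)
      fix M assume M: "M \<in> set (merges x A)"
      have "aug_mono (\<lambda>v. monom (\<xi> v) (snd v)) M = monom (aug_mono \<xi> M) (sum_list (map snd M))"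
        by (rule 1) (use M Cons in \<open>auto dest: length_merges\<close>)
      then show "aug_mono (\<lambda>v. monom (\<xi> v) (snd v)) M = monom (aug_mono \<xi> M) (sum_list (map snd L))"
        using size_merges[OF M] Cons by simp
    qed
    also have "\<dots> = monom (\<Sum>M\<leftarrow>merges x A. aug_mono \<xi> M) (sum_list (map snd L))"
      by (rule sum_list_monom)
    finally have "(\<Sum>M\<leftarrow>merges x A. aug_mono (\<lambda>v. monom (\<xi> v) (snd v)) M) = monom (\<Sum>M\<leftarrow>merges x A. aug_mono \<xi> M) (sum_list (map snd L))" .
    moreover have "aug_mono (\<lambda>v. monom (\<xi> v) (snd v)) A = monom (aug_mono \<xi> A) (sum_list (map snd A))"
      by (rule 1) (simp add: Cons)
    ultimately show ?thesis using Cons by (simp add: mult_monom diff_monom)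
  qed
qed

lemma contract_monom: "contract A ([:a:] * monom c m) = c * (A m * a)"
proof -
  have "[:a:] * monom c m = monom (a * c) m" by (simp add: smult_monom)
  then have "contract A ([:a:] * monom c m) = (\<Sum>b\<le>m. A b * coeff (monom (a * c) m) b)"
    by (simp add: contract_eq[where N = m] degree_monom_le)
  also have "\<dots> = (\<Sum>b\<le>m. if b = m then A m * (a * c) else 0)"
    by (intro sum.cong) auto
  finally show ?thesis by (simp add: mult_ac)
qed

lemma contract_sum_list: "contract A (\<Sum>x\<leftarrow>xs. f x) = (\<Sum>x\<leftarrow>xs. contract A (f x))"
  by (induct xs) (simp_all add: contract_add)

lemma shift_hom_amono: "shift_hom \<sigma> (amono L) = aug_mono (\<lambda>v. [:alphabet_gen v:] + monom (cst (\<sigma> v)) (snd v)) L"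
  unfolding shift_hom_def by (rule alphabet_subst_amono[OF rhom_cst_poly])

text \<open>
  The shift distributes the parts over the given alphabets and the additional letters that
  are described by \<open>\<sigma>\<close>.
\<close>

lemma vertex_op_amono:
  "vertex_op A \<sigma> (amono L) = (\<Sum>(J, K)\<leftarrow>list_splits L. cst (aug_mono \<sigma> K) * (A (sum_list (map snd K)) * amono J))"
proof -
  have "shift_hom \<sigma> (amono L) = (\<Sum>(J, K)\<leftarrow>list_splits L. [:amono J:] * monom (cst (aug_mono \<sigma> K)) (sum_list (map snd K)))"
    unfolding shift_hom_amono aug_mono_add aug_mono_const aug_mono_monom amono_def[symmetric] aug_mono_rhom[OF rhom_cst, symmetric] ..
  then show ?thesis
    unfolding vertex_op_def by (simp only: contract_sum_list case_prod_unfold contract_monom)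
qed

text \<open>
  Combinations of monomial symmetric functions whose parts of colour below \<open>k\<close> are exactly
  those in \<open>C0\<close>. Power sums of the alphabets from \<open>k\<close> on do not change these parts.
\<close>

definition low_fixed :: "nat \<Rightarrow> nat \<Rightarrow> (nat \<times> nat) multiset \<Rightarrow> 'k::linordered_field pring set" where
  "low_fixed n k C0 = pr.span (amono ` {M. mset M \<in> index_set n \<and> filter_mset (\<lambda>v. fst v < k) (mset M) = C0})"

lemma low_fixed_alphabet_gen:
  assumes i: "k \<le> fst x" "fst x < n" "snd x > 0" and "h \<in> low_fixed n k C0"
  shows "alphabet_gen x * h \<in> low_fixed n k C0"
  using assms(4) unfolding low_fixed_def
proof (induct rule: pr.span_induct_alt)
  case base then show ?case by (simp add: pr.span_zero)
next
  let ?S = "amono ` {M. mset M \<in> index_set n \<and> filter_mset (\<lambda>v. fst v < k) (mset M) = C0} :: 'a pring set"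
  case (step c g h)
  then obtain L where L: "g = amono L" "mset L \<in> index_set n" "filter_mset (\<lambda>v. fst v < k) (mset L) = C0" by auto
  have xL: "mset (x # L) \<in> index_set n" using L i by (auto simp: index_set_def)
  have M: "(amono M :: 'a pring) \<in> ?S" if "M \<in> set (merges x L)" for M
  proof -
    have "mset M \<in># mset (map mset (merges x L))" using that by simp
    then obtain y where y: "y \<in># mset L" "fst x = fst y" "mset M = add_mset (fst x, snd x + snd y) (mset L - {#y#})"
      unfolding merges_mset by auto
    from y(1) obtain E where "mset L = add_mset y E" by (rule mset_add)
    then have "filter_mset (\<lambda>v. fst v < k) (mset M) = C0" using y i L by auto
    then show ?thesis using merges_index_set[OF xL that] by blast
  qed
  have sl: "(\<Sum>M\<leftarrow>xs. amono M) \<in> pr.span ?S" if "\<And>M. M \<in> set xs \<Longrightarrow> (amono M :: 'a pring) \<in> ?S" for xs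
    using that by (induct xs) (simp_all add: pr.span_add pr.span_base pr.span_zero)
  have "(amono (x # L) :: 'a pring) \<in> ?S" using xL L i by auto
  then have "alphabet_gen x * amono L \<in> pr.span ?S"
    unfolding alphabet_gen_amono using M by (intro pr.span_add sl pr.span_base)
  then have "cst c * (alphabet_gen x * amono L) + alphabet_gen x * h \<in> pr.span ?S" using step by (intro pr.span_add pr.span_scale)
  then show ?case unfolding L(1) by (simp add: algebra_simps)
qed

lemma low_fixed_pleth_arg:
  assumes "r > 0" "h \<in> low_fixed n k C0"
  shows "pleth_arg cst \<tau> n alphabet_gen k r * h \<in> low_fixed n k C0"
proof -
  have "pleth_arg cst \<tau> n alphabet_gen k r * h = (\<Sum>i<n. if k \<le> i then cst (1 - (1 / \<tau> i) ^ r) * (alphabet_gen (i, r) * h) else 0)"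
    unfolding pleth_arg_def sum_distrib_right by (intro sum.cong) (auto simp: mult.assoc)
  also have "\<dots> \<in> low_fixed n k C0"
    unfolding low_fixed_def using low_fixed_alphabet_gen[of k "(_, r)" n h C0] assms
    by (intro pr.span_sum) (auto simp: pr.span_zero low_fixed_def intro: pr.span_scale)
  finally show ?thesis .
qed

lemma low_fixed_exp_coeff:
  assumes "h \<in> low_fixed n k C0"
  shows "exp_coeff cst (pleth_arg cst \<tau> n alphabet_gen k) b * h \<in> low_fixed n k C0"
proof (induct b rule: less_induct)
  case (less b)
  show ?case
  proof (cases b)
    case (Suc c)
    let ?V = "pleth_arg cst \<tau> n alphabet_gen k"
    have "exp_coeff cst ?V b * h = cst (1 / of_nat (Suc c)) * (\<Sum>r\<le>c. ?V (Suc r) * (exp_coeff cst ?V (c - r) * h))"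
      unfolding Suc exp_coeff.simps(2) by (simp only: sum_distrib_right mult.assoc)
    also have "\<dots> \<in> low_fixed n k C0"
      unfolding low_fixed_def
      by (intro pr.span_scale pr.span_sum, fold low_fixed_def, intro low_fixed_pleth_arg less) (simp_all add: Suc)
    finally show ?thesis .
  qed (simp add: assms)
qed

lemma mcoord_low_fixed:
  assumes "h \<in> low_fixed n k C0" "C \<in> index_set n" "filter_mset (\<lambda>v. fst v < k) C \<noteq> C0"
  shows "mcoord C h = 0"
  using assms(1) unfolding low_fixed_def
proof (induct rule: pr.span_induct_alt)
  case (step c x g)
  then obtain M where M: "x = amono M" "mset M \<in> index_set n" "filter_mset (\<lambda>v. fst v < k) (mset M) = C0" by auto
  have "mcoord C (amono M :: 'a pring) = of_bool (mset M = C)"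
    by (rule mcoord_amono) (use M(2) assms(2) in \<open>auto simp: index_set_def\<close>)
  then show ?case using M step assms by (auto simp: mcoord_add mcoord_cst)
qed (simp add: mcoord_0)

lemma low_fixed_subset_Sym: "low_fixed n k C0 \<subseteq> Sym n"
proof
  fix h :: "'a pring" assume "h \<in> low_fixed n k C0"
  then show "h \<in> Sym n" unfolding low_fixed_def
    by (induct rule: pr.span_induct_alt) (auto intro: Sym_0 Sym_add Sym_mult Sym_cst Sym_amono)
qed

lemma Sym_vertex_op_amono:
  assumes "mset L \<in> index_set n"
  shows "vertex_op (exp_coeff cst (pleth_arg cst \<tau> n alphabet_gen k)) \<sigma> (amono L) \<in> Sym n"
  unfolding vertex_op_amono
proof (rule Sym_sum_list, clarify, rule Sym_mult[OF Sym_cst])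
  fix J K assume "(J, K) \<in> set (list_splits L)"
  then have "mset J \<in> index_set n" using assms list_splits_mset[of J K L] by (auto simp: index_set_def)
  then have "amono J \<in> low_fixed n k (filter_mset (\<lambda>v. fst v < k) (mset J))"
    unfolding low_fixed_def by (intro pr.span_base) auto
  then show "exp_coeff cst (pleth_arg cst \<tau> n alphabet_gen k) (sum_list (map snd K)) * amono J \<in> Sym n"
    using low_fixed_exp_coeff low_fixed_subset_Sym by blast
qed

text \<open>
  When the shift acts on an alphabet before \<open>k\<close>, it removes parts of that colour, which
  multiplication by the exponential cannot restore. So the shift of the alphabet \<open>k\<close> alone
  determines the diagonal coefficient.
\<close>

lemma mcoord_vertex_op_restrict:
  fixes \<tau> :: "nat \<Rightarrow> 'k::linordered_field"
  assumes L: "mset L \<in> index_set n" and \<sigma>: "\<And>i r. i > k \<Longrightarrow> \<sigma> (i, r) = 0"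
    and \<sigma>': "\<And>r. \<sigma>' (k, r) = \<sigma> (k, r)" "\<And>i r. i \<noteq> k \<Longrightarrow> \<sigma>' (i, r) = 0"
  shows "mcoord (mset L) (vertex_op (exp_coeff cst (pleth_arg cst \<tau> n alphabet_gen k)) \<sigma> (amono L)) =
    mcoord (mset L) (vertex_op (exp_coeff cst (pleth_arg cst \<tau> n alphabet_gen k)) \<sigma>' (amono L))"
  unfolding vertex_op_amono mcoord_sum_list
proof (intro arg_cong[of _ _ sum_list] map_cong refl)
  fix JK assume JK: "JK \<in> set (list_splits L)"
  obtain J K where [simp]: "JK = (J, K)" by force
  have ms: "mset L = mset J + mset K" using JK by (simp add: list_splits_mset)
  let ?A = "exp_coeff cst (pleth_arg cst \<tau> n alphabet_gen k)"
  let ?h = "?A (sum_list (map snd K)) * amono J"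
  have "aug_mono \<sigma> K * mcoord (mset L) ?h = aug_mono \<sigma>' K * mcoord (mset L) ?h"
  proof (cases "\<forall>v\<in>set K. fst v = k")
    case True
    have "aug_mono \<sigma> K = aug_mono \<sigma>' K" by (rule aug_mono_cong) (use True \<sigma>'(1) in force)
    then show ?thesis by simp
  next
    case False
    then obtain v where v: "v \<in> set K" "fst v \<noteq> k" by auto
    have 0: "aug_mono \<sigma>' K = 0" using v \<sigma>'(2) by (intro aug_mono_vanish0[of _ "fst v"]) auto
    show ?thesis
    proof (cases "fst v < k")
      case True
      have "(amono J :: 'k pring) \<in> low_fixed n k (filter_mset (\<lambda>v. fst v < k) (mset J))"
        unfolding low_fixed_def by (intro pr.span_base) (use L ms in \<open>auto simp: index_set_def\<close>)
      from low_fixed_exp_coeff[OF this] have h: "?h \<in> low_fixed n k (filter_mset (\<lambda>v. fst v < k) (mset J))" .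
      have "v \<in># filter_mset (\<lambda>v. fst v < k) (mset K)" using v True by simp
      then have "filter_mset (\<lambda>v. fst v < k) (mset K) \<noteq> {#}" by (metis empty_not_add_mset mset_add)
      then have "mcoord (mset L) ?h = 0" by (intro mcoord_low_fixed[OF h L]) (simp add: ms)
      then show ?thesis by simp
    next
      case False
      then have "fst v > k" using v by simp
      then have "aug_mono \<sigma> K = 0" using v \<sigma> by (intro aug_mono_vanish0[of _ "fst v"]) auto
      then show ?thesis using 0 by simp
    qed
  qed
  then show "mcoord (mset L) (case JK of (J, K) \<Rightarrow> cst (aug_mono \<sigma> K) * (?A (sum_list (map snd K)) * amono J)) =
    mcoord (mset L) (case JK of (J, K) \<Rightarrow> cst (aug_mono \<sigma>' K) * (?A (sum_list (map snd K)) * amono J))"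
    by (simp add: mcoord_cst)
qed

lemma sum_list_removals_amono:
  fixes F :: "'k::field_char_0 pring \<Rightarrow> 'r::comm_ring_1"
  shows "(\<Sum>(y, M)\<leftarrow>removals (x # L). if y = x then F (amono M) else 0) = of_nat (count (mset (x # L)) x) * F (amono L)"
proof -
  have "(\<Sum>(y, M)\<leftarrow>removals (x # L). if y = x then F (amono M) else 0) = (\<Sum>(y, M)\<leftarrow>removals (x # L). if y = x then F (amono L) else 0)"
  proof (intro arg_cong[of _ _ sum_list] map_cong refl)
    fix p assume p: "p \<in> set (removals (x # L))"
    obtain y M where yM: "p = (y, M)" by (rule prod.exhaust)
    have "mset (x # L) = add_mset y (mset M)" using p yM by (intro removals_mset) simp
    then have "y = x \<Longrightarrow> amono M = (amono L :: 'k pring)"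
      unfolding amono_def by (intro aug_mono_perm) simp
    then show "(case p of (y, M) \<Rightarrow> if y = x then F (amono M) else 0) = (case p of (y, M) \<Rightarrow> if y = x then F (amono L) else 0)"
      by (simp add: yM)
  qed
  then show ?thesis by (simp only: sum_list_removals_count)
qed

lemma coeff_sum_list: "coeff (\<Sum>x\<leftarrow>xs. f x) a = (\<Sum>x\<leftarrow>xs. coeff (f x) a)"
  by (induct xs) auto

text \<open>
  The largest part \<open>a\<close> of colour \<open>k\<close> is split off. If \<open>s\<close> is the new letter, the exponential
  gains the factor \<open>(1 - z s / \<tau>) / (1 - z s) = 1 / \<tau> + (1 - 1 / \<tau>) / (1 - z
  s)\<close>. The constant \<open>1 / \<tau>\<close> leaves the operator as it was, applied to the remaining
  parts. The geometric series evaluates the shift at \<open>w = s\<close>, which replaces the letter \<open>s\<close>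
  by \<open>\<kappa> s\<close> and yields \<open>\<kappa>^a\<close>; the other coefficients of the exponential do not
  contribute to the power \<open>s^a\<close>, since by the maximality of \<open>a\<close> no higher power occurs and
  the bound in \<open>poly_shift_bound\<close> is strict.
\<close>

lemma letter_coeff_vertex_op:
  fixes \<sigma> :: "nat \<times> nat \<Rightarrow> 'k::linordered_field" and \<tau> :: "nat \<Rightarrow> 'k"
  assumes a: "a > 0" and L: "\<And>v. v \<in> set L \<Longrightarrow> fst v = k \<Longrightarrow> snd v \<le> a" and k: "k < n"
    and \<sigma>: "\<And>r. \<sigma> (k, r) = \<kappa> ^ r - 1" "\<And>i r. i \<noteq> k \<Longrightarrow> \<sigma> (i, r) = 0"
  shows "letter_coeff k a (vertex_op (exp_coeff cst (pleth_arg cst \<tau> n alphabet_gen k)) \<sigma> (amono ((k, a) # L))) = of_nat (count (mset ((k, a) # L)) (k, a)) *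
    (cst (1 / \<tau> k) * vertex_op (exp_coeff cst (pleth_arg cst \<tau> n alphabet_gen k)) \<sigma> (amono L) + cst ((1 - 1 / \<tau> k) * \<kappa> ^ a) * amono L)"
proof -
  define A where "A = exp_coeff cst (pleth_arg cst \<tau> n alphabet_gen k)"
  let ?L = "(k, a) # L"
  define cnt where "cnt = (of_nat (count (mset ?L) (k, a)) :: 'k pring)"
  let ?\<iota> = "\<lambda>c::'k. [:cst c:]"
  let ?s = "monom 1 1 :: 'k pring poly"
  define \<xi> where "\<xi> = (\<lambda>v. [:alphabet_gen v:] + letter k ?s v)"
  define \<alpha> where "\<alpha> = exp_coeff ?\<iota> (pleth_arg ?\<iota> \<tau> n \<xi> k)"
  define g where "g = aug_mono (\<lambda>v. [:\<xi> v:] + monom (?\<iota> (\<sigma> v)) (snd v)) ?L"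
  have h2: "rhom (\<lambda>c. [:?\<iota> c:])" using rhom_comp[OF rhom_const_poly rhom_cst_poly] by simp
  have eq: "letter_coeff k a (vertex_op A \<sigma> (amono ?L)) = coeff (contract \<alpha> g) a"
    unfolding letter_coeff_def adjoin_letter_def \<xi>_def[symmetric] A_def alphabet_subst_vertex_op[OF rhom_cst_poly] alphabet_subst_amono[OF h2] g_def \<alpha>_def ..
  define U where "U = letter_factor cst (\<tau> k) (1 :: 'k pring)"
  have \<alpha>: "\<alpha> = fps_nth (fscale U * fconst (Abs_fps A))"
  proof -
    have v: "pleth_arg ?\<iota> \<tau> n (\<lambda>v. [:alphabet_gen v:]) k r = [:pleth_arg cst \<tau> n alphabet_gen k r:]" for r
      unfolding pleth_arg_def by (subst rhom_sum[OF rhom_const_poly]) (intro sum.cong, auto)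
    have A: "exp_coeff ?\<iota> (pleth_arg ?\<iota> \<tau> n (\<lambda>v. [:alphabet_gen v:]) k) b = [:A b:]" for b
      unfolding v A_def by (rule exp_coeff_rhom[OF rhom_const_poly, symmetric])
    have "pleth_arg ?\<iota> \<tau> n \<xi> k = (\<lambda>r. pleth_arg ?\<iota> \<tau> n (\<lambda>v. [:alphabet_gen v:]) k r + ?\<iota> (1 - (1 / \<tau> k) ^ r) * ?s ^ r)"
      unfolding \<xi>_def by (rule ext) (simp add: pleth_arg_letter[OF rhom_cst_poly k] del: One_nat_def)
    then have "Abs_fps \<alpha> = Abs_fps (exp_coeff ?\<iota> (pleth_arg ?\<iota> \<tau> n (\<lambda>v. [:alphabet_gen v:]) k)) * letter_factor ?\<iota> (\<tau> k) ?s"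
      unfolding \<alpha>_def by (simp only: exp_coeff_letter[OF rhom_cst_poly])
    also have "Abs_fps (exp_coeff ?\<iota> (pleth_arg ?\<iota> \<tau> n (\<lambda>v. [:alphabet_gen v:]) k)) = fconst (Abs_fps A)"
      by (rule fps_ext) (simp add: A fconst_def)
    also have "letter_factor ?\<iota> (\<tau> k) ?s = fscale U"
      by (rule fps_ext) (simp add: letter_factor_def U_def fscale_def monom_power smult_monom monom_0 one_pCons)
    finally have "Abs_fps \<alpha> = fscale U * fconst (Abs_fps A)" by (simp add: mult.commute)
    moreover have "fps_nth (Abs_fps \<alpha>) = \<alpha>" by (rule ext) simp
    ultimately show ?thesis by simp
  qed
  have U: "fps_nth U b = (if b = 0 then cst (1 / \<tau> k) else 0) + (\<Sum>y\<in>{1}. cst (1 - 1 / \<tau> k) * y ^ b)" for b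
    using rhom_add[OF rhom_cst, of "1 / \<tau> k" "1 - 1 / \<tau> k"] by (simp add: U_def letter_factor_def)
  define g' where "g' = (\<Sum>c\<le>degree g. smult [:A c:] (poly_shift c g))"
  have cg: "coeff (contract \<alpha> g) a = cst (1 / \<tau> k) * coeff (coeff g' 0) a + cst (1 - 1 / \<tau> k) * coeff (poly g' ?s) a"
    unfolding \<alpha> contract_fconst by (subst contract_fscale_geo[OF U]) (simp add: g'_def del: One_nat_def)
  \<comment> \<open>The shifted polynomial before the new letter is added, with coefficients that are
    constant in s.\<close>
  define H where "H M = aug_mono (\<lambda>v. [:[:alphabet_gen v:]:] + monom (?\<iota> (\<sigma> v)) (snd v)) M" for M
  have H: "coeff (H M) c = [:coeff (shift_hom \<sigma> (amono M)) c:]" for M c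
  proof -
    have c0: "(\<lambda>p. [:p:]) 0 = (0 :: 'k pring poly)" by simp
    have "H M = map_poly (\<lambda>p. [:p:]) (shift_hom \<sigma> (amono M))"
      unfolding shift_hom_amono H_def aug_mono_rhom[OF rhom_map_poly[OF rhom_const_poly]]
        rhom_add[OF rhom_map_poly[OF rhom_const_poly]]
      by (simp add: map_poly_pCons map_poly_monom)
    then show ?thesis by (simp add: coeff_map_poly)
  qed
  have "g = H ?L + (\<Sum>(y, M)\<leftarrow>removals ?L. if fst y = k then [:?s:] ^ snd y * H M else 0)"
  proof -
    have "g = aug_mono (\<lambda>v. ([:[:alphabet_gen v:]:] + monom (?\<iota> (\<sigma> v)) (snd v)) + letter k [:?s:] v) ?L"
      unfolding g_def
    proof (rule aug_mono_cong)
      fix v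
      have "[:letter k ?s v:] = letter k [:?s:] v" by (rule letter_rhom[OF rhom_const_poly])
      moreover have "[:\<xi> v:] = [:[:alphabet_gen v:]:] + [:letter k ?s v:]" by (simp add: \<xi>_def)
      ultimately show "[:\<xi> v:] + monom (?\<iota> (\<sigma> v)) (snd v) = [:[:alphabet_gen v:]:] + monom (?\<iota> (\<sigma> v)) (snd v) + letter k [:?s:] v"
        by (simp only: add_ac)
    qed
    then show ?thesis unfolding aug_mono_add_letter H_def[symmetric] by simp
  qed
  then have coeff_g: "coeff (coeff g c) e = (\<Sum>(y, M)\<leftarrow>removals ?L. if y = (k, e) then coeff (shift_hom \<sigma> (amono M)) c else 0)"
    if "e > 0" for c e
  proof -
    assume g: "g = H ?L + (\<Sum>(y, M)\<leftarrow>removals ?L. if fst y = k then [:?s:] ^ snd y * H M else 0)"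
    have "coeff (coeff (if fst y = k then [:?s:] ^ snd y * H M else 0) c) e = (if y = (k, e) then coeff (shift_hom \<sigma> (amono M)) c else 0)" for y M
    proof -
      have "[:?s:] ^ b = [:monom 1 b:]" for b
        by (simp add: rhom_power[OF rhom_const_poly, symmetric] monom_power)
      then have "coeff (coeff ([:?s:] ^ snd y * H M) c) e = coeff (monom 1 (snd y) * [:coeff (shift_hom \<sigma> (amono M)) c:]) e"
        by (simp add: H)
      then show ?thesis by (auto simp: coeff_monom_mult coeff_pCons prod_eq_iff split: nat.split)
    qed
    moreover have "coeff (coeff (H ?L) c) e = 0" using that by (simp add: H coeff_pCons split: nat.split)
    ultimately show ?thesis unfolding g by (simp add: coeff_sum_list case_prod_unfold del: removals.simps)
  qed
  have poly_g: "coeff (poly g ?s) e = (\<Sum>(y, M)\<leftarrow>removals ?L. if y = (k, e) then cst (\<kappa> ^ e) * amono M else 0)" if "e > 0" for e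
  proof -
    have "poly g ?s = aug_mono (\<lambda>v. [:alphabet_gen v:] + letter k (smult (cst \<kappa>) ?s) v) ?L"
      unfolding g_def poly_aug_mono
    proof (rule aug_mono_cong)
      fix v
      have "letter k ?s v + ?\<iota> (\<sigma> v) * ?s ^ snd v = letter k (smult (cst \<kappa>) ?s) v"
        by (cases v) (auto simp: letter_def \<sigma> rhom_diff[OF rhom_cst] rhom_power[OF rhom_cst] smult_power[symmetric] smult_diff_left
            simp del: One_nat_def)
      then show "poly ([:\<xi> v:] + monom (?\<iota> (\<sigma> v)) (snd v)) ?s = [:alphabet_gen v:] + letter k (smult (cst \<kappa>) ?s) v"
        by (simp add: \<xi>_def poly_monom add.assoc del: One_nat_def)
    qed
    also have "\<dots> = [:amono ?L:] + (\<Sum>(y, M)\<leftarrow>removals ?L. if fst y = k then smult (cst \<kappa>) ?s ^ snd y * [:amono M:] else 0)"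
      unfolding aug_mono_add_letter aug_mono_const amono_def[symmetric] ..
    finally have p: "poly g ?s = \<dots>" .
    have "coeff (if fst y = k then smult (cst \<kappa>) ?s ^ snd y * [:amono M:] else 0) e = (if y = (k, e) then cst (\<kappa> ^ e) * amono M else 0)" for y M
      by (auto simp: smult_power[symmetric] monom_power smult_monom coeff_monom_mult coeff_pCons prod_eq_iff rhom_power[OF rhom_cst] split: nat.split)
    moreover have "coeff [:amono ?L:] e = 0" using that by (simp add: coeff_pCons split: nat.split)
    ultimately show ?thesis unfolding p by (simp add: coeff_sum_list case_prod_unfold del: One_nat_def removals.simps)
  qed
  \<comment> \<open>No power of s beyond a occurs, since a is the largest part of colour k.\<close>
  have van: "(\<Sum>(y, M)\<leftarrow>removals ?L. if y = (k, e) then F M else 0) = 0" if "e > a" for e and F :: "(nat \<times> nat) list \<Rightarrow> 'k pring"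
  proof -
    have "(\<Sum>(y, M)\<leftarrow>removals ?L. if y = (k, e) then F M else 0) = (\<Sum>p\<leftarrow>removals ?L. 0)"
    proof (intro arg_cong[of _ _ sum_list] map_cong refl)
      fix p assume p: "p \<in> set (removals ?L)"
      obtain y M where yM: "p = (y, M)" by (rule prod.exhaust)
      have "mset ?L = add_mset y (mset M)" using p yM by (intro removals_mset) simp
      then have "y \<in># mset ?L" by simp
      then have "y \<noteq> (k, e)" using L[of y] that by auto
      then show "(case p of (y, M) \<Rightarrow> if y = (k, e) then F M else 0) = 0" by (simp add: yM)
    qed
    then show ?thesis by (simp only: sum_list_0)
  qed
  have g0: "coeff (coeff g c) e = 0" if "e > a" for c e
    using coeff_g[of e c] van[OF that] a that by simp
  have g1: "coeff (poly g ?s) e = 0" if "e > a" for e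
    using poly_g[of e] van[OF that] a that by simp
  have sh: "coeff (poly (poly_shift c g) ?s) a = 0" if "c > 0" for c
    by (rule poly_shift_bound(2)[of 1 1 a]) (use g0 g1 that in auto)
  have "coeff (poly g' ?s) a = (\<Sum>c\<le>degree g. A c * coeff (poly (poly_shift c g) ?s) a)"
    by (simp add: g'_def poly_sum coeff_sum del: One_nat_def)
  also have "\<dots> = (\<Sum>c\<le>degree g. if c = 0 then coeff (poly g ?s) a else 0)"
  proof (intro sum.cong refl)
    fix c
    have "poly_shift 0 g = g" by (rule poly_eqI) (simp add: coeff_poly_shift)
    then show "A c * coeff (poly (poly_shift c g) ?s) a = (if c = 0 then coeff (poly g ?s) a else 0)"
      using sh[of c] by (auto simp: A_def)
  qed
  also have "\<dots> = cnt * (cst (\<kappa> ^ a) * amono L)"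
    unfolding cnt_def using poly_g[OF a] sum_list_removals_amono[where x = "(k, a)" and L = L and F = "\<lambda>h. cst (\<kappa> ^ a) * h"] by simp
  finally have p': "coeff (poly g' ?s) a = cnt * (cst (\<kappa> ^ a) * amono L)" .
  define N where "N = max (degree g) (degree (shift_hom \<sigma> (amono L)))"
  have "coeff (coeff g' 0) a = (\<Sum>c\<le>degree g. A c * coeff (coeff g c) a)"
    by (simp add: g'_def coeff_sum coeff_poly_shift)
  also have "\<dots> = (\<Sum>c\<le>N. A c * coeff (coeff g c) a)"
    by (rule sum.mono_neutral_left) (auto simp: N_def coeff_eq_0)
  also have "\<dots> = (\<Sum>c\<le>N. A c * (cnt * coeff (shift_hom \<sigma> (amono L)) c))"
    unfolding cnt_def using coeff_g[OF a] sum_list_removals_amono[where x = "(k, a)" and L = L and F = "\<lambda>h. coeff (shift_hom \<sigma> h) c" for c] by simp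
  also have "\<dots> = cnt * vertex_op A \<sigma> (amono L)"
    unfolding vertex_op_def by (subst contract_eq[where N = N]) (auto simp: N_def sum_distrib_left mult_ac)
  finally show ?thesis
    unfolding A_def[symmetric] eq cg p' cnt_def[symmetric] rhom_mult[OF rhom_cst] by (simp add: algebra_simps)
qed

text \<open>
  For \<open>\<nu>\<close> of length \<open>l\<close> this is \<open>\<tau>^{-l} + (1 - 1/\<tau>) \<Sum>_i
  \<kappa>^{\<nu>_i} \<tau>^{-i}\<close>, with \<open>i\<close> from \<open>0\<close> to \<open>l - 1\<close>.
\<close>

fun eigenval :: "'k::linordered_field \<Rightarrow> 'k \<Rightarrow> nat list \<Rightarrow> 'k" where
  "eigenval \<kappa> \<tau> [] = 1"
| "eigenval \<kappa> \<tau> (a # \<nu>) = eigenval \<kappa> \<tau> \<nu> / \<tau> + (1 - 1 / \<tau>) * \<kappa> ^ a"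

lemma mcoord_vertex_op_diag:
  fixes \<sigma> :: "nat \<times> nat \<Rightarrow> 'k::linordered_field"
  assumes k: "k < n" and \<sigma>: "\<And>r. \<sigma> (k, r) = \<kappa> ^ r - 1" "\<And>i r. i \<noteq> k \<Longrightarrow> \<sigma> (i, r) = 0"
    and "mset L \<in> index_set n" and "filter_mset (\<lambda>v. fst v = k) (mset L) = image_mset (Pair k) (mset \<nu>)"
    and "sorted_wrt (\<ge>) \<nu>"
  shows "mcoord (mset L) (vertex_op (exp_coeff cst (pleth_arg cst \<tau> n alphabet_gen k)) \<sigma> (amono L)) = eigenval \<kappa> (\<tau> k) \<nu>"
  using assms(4-6)
proof (induct \<nu> arbitrary: L)
  case Nil
  have nk: "fst v \<noteq> k" if "v \<in> set L" for v
  proof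
    assume "fst v = k"
    then have "v \<in># filter_mset (\<lambda>v. fst v = k) (mset L)" using that by simp
    then show False unfolding Nil(2) by simp
  qed
  have "shift_hom \<sigma> (amono L) = aug_mono (\<lambda>v. [:alphabet_gen v:]) L"
    unfolding shift_hom_amono
  proof (rule aug_mono_cong)
    fix v :: "nat \<times> nat" assume "fst v \<in> fst ` set L"
    then obtain u where "u \<in> set L" "fst v = fst u" by (rule imageE)
    then have "fst v \<noteq> k" using nk[of u] by simp
    then show "[:alphabet_gen v:] + monom (cst (\<sigma> v)) (snd v) = [:alphabet_gen v:]" using \<sigma>(2)[of "fst v" "snd v"] by simp
  qed
  then have "vertex_op (exp_coeff cst (pleth_arg cst \<tau> n alphabet_gen k)) \<sigma> (amono L) = amono L"
    unfolding vertex_op_def by (simp add: aug_mono_const contract_def amono_def)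
  moreover have "mcoord (mset L) (amono L :: 'k pring) = 1"
    using Nil(1) by (subst mcoord_amono) (auto simp: index_set_def)
  ultimately show ?case by simp
next
  case (Cons a \<nu>)
  let ?A = "exp_coeff cst (pleth_arg cst \<tau> n alphabet_gen k)"
  have "(k, a) \<in># filter_mset (\<lambda>v. fst v = k) (mset L)" unfolding Cons(3) by simp
  then obtain L' where L': "mset L = mset ((k, a) # L')" by (metis ex_mset filter_mset_eq_conv insert_DiffM mset.simps(2) mset_subset_eqD multiset_filter_subset)
  have LI: "mset L' \<in> index_set n" and a: "a > 0" using Cons(2) unfolding L' by (auto simp: index_set_def)
  have f: "filter_mset (\<lambda>v. fst v = k) (mset L') = image_mset (Pair k) (mset \<nu>)"
    using Cons(3) unfolding L' by simp
  have IH: "mcoord (mset L') (vertex_op ?A \<sigma> (amono L')) = eigenval \<kappa> (\<tau> k) \<nu>"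
    by (rule Cons(1)[OF LI f]) (use Cons(4) in simp)
  have le: "snd v \<le> a" if "v \<in> set L'" "fst v = k" for v
  proof -
    have "v \<in># filter_mset (\<lambda>v. fst v = k) (mset L')" using that by simp
    then show ?thesis using Cons(4) unfolding f by auto
  qed
  have mL: "amono L = (amono ((k, a) # L') :: 'k pring)" unfolding amono_def by (rule aug_mono_perm[OF L'])
  define h where "h = vertex_op ?A \<sigma> (amono ((k, a) # L'))"
  define c where "c = (of_nat (count (mset ((k, a) # L')) (k, a)) :: 'k)"
  have "c = of_nat (Suc (count (mset L') (k, a)))" by (simp add: c_def)
  then have c0: "c \<noteq> 0" by (simp del: of_nat_Suc)
  have cc: "of_nat (count (mset ((k, a) # L')) (k, a)) = cst c"
    unfolding c_def by (rule rhom_of_nat[OF rhom_cst, symmetric])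
  have hW: "h \<in> Sym n" unfolding h_def by (rule Sym_vertex_op_amono) (use Cons(2) L' in simp)
  have "c * mcoord (mset L) h = mcoord (mset L') (letter_coeff k a h)"
    using mcoord_letter_coeff[OF k a LI hW] by (simp add: c_def L' add.commute)
  also have "\<dots> = c * (eigenval \<kappa> (\<tau> k) \<nu> / \<tau> k + (1 - 1 / \<tau> k) * \<kappa> ^ a)"
  proof -
    have "mcoord (mset L') (amono L' :: 'k pring) = 1"
      using LI by (subst mcoord_amono) (auto simp: index_set_def)
    moreover have "letter_coeff k a h = cst c * (cst (1 / \<tau> k) * vertex_op ?A \<sigma> (amono L') + cst ((1 - 1 / \<tau> k) * \<kappa> ^ a) * amono L')"
      unfolding h_def cc[symmetric] by (rule letter_coeff_vertex_op[OF a _ k]) (use le \<sigma> in auto)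
    ultimately show ?thesis by (simp add: mcoord_cst mcoord_add IH)
  qed
  finally show ?case using c0 unfolding mL h_def by simp
qed

section \<open>Orthogonal vectors along a partial order\<close>

text \<open>
  Over an ordered field a positive form has no isotropic vectors, so that orthogonal
  projection onto a space with a finite spanning set works as over the real numbers.
\<close>

locale positive_form = vector_space scale
  for scale :: "'k::linordered_field \<Rightarrow> 'v::ab_group_add \<Rightarrow> 'v" +
  fixes B :: "'v \<Rightarrow> 'v \<Rightarrow> 'k" and V :: "'v set"
  assumes subspace_V: "subspace V"
    and B_add: "B (x + y) z = B x z + B y z"
    and B_scale: "B (scale c x) z = c * B x z"
    and B_commute: "B x y = B y x"
    and B_pos: "x \<in> V \<Longrightarrow> x \<noteq> 0 \<Longrightarrow> B x x > 0"
begin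

lemma B_add_right: "B z (x + y) = B z x + B z y"
  by (simp add: B_commute[of z] B_add)

lemma B_scale_right: "B z (scale c x) = c * B z x"
  by (simp add: B_commute[of z] B_scale)

lemma B_zero: "B 0 z = 0"
  using B_scale[of 0 0 z] by simp

lemma B_diff: "B (x - y) z = B x z - B y z"
  using B_add[of "x - y" y z] by (simp add: algebra_simps)

lemma B_diff_right: "B z (x - y) = B z x - B z y"
  by (simp add: B_commute[of z] B_diff)

lemma B_span_zero:
  assumes "\<And>x. x \<in> S \<Longrightarrow> B v x = 0" "y \<in> span S"
  shows "B v y = 0"
  using assms(2)
  by (induct rule: span_induct_alt) (use assms(1) in \<open>auto simp: B_add_right B_scale_right B_commute[of v 0] B_zero\<close>)

lemma orthogonal_projection:
  assumes "finite S" "S \<subseteq> V" "v \<in> V"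
  shows "\<exists>u\<in>span S. \<forall>x\<in>span S. B (v - u) x = 0"
  using assms
proof (induct S arbitrary: v rule: finite_induct)
  case empty
  have "B (v - 0) x = 0" if "x \<in> span {}" for x using that by (simp add: B_commute[of v 0] B_zero)
  then show ?case by (intro bexI[of _ 0]) (auto simp: span_zero)
next
  case (insert a S)
  then have a: "a \<in> V" and S: "S \<subseteq> V" by auto
  have sub: "span S \<subseteq> V" using S subspace_V by (rule span_minimal)
  obtain b where b: "b \<in> span S" "\<And>x. x \<in> span S \<Longrightarrow> B (a - b) x = 0" using insert(3)[OF S a] by auto
  obtain u where u: "u \<in> span S" "\<And>x. x \<in> span S \<Longrightarrow> B (v - u) x = 0" using insert(3)[OF S insert(5)] by auto
  have mono: "x \<in> span S \<Longrightarrow> x \<in> span (insert a S)" for x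
    using span_mono[of S "insert a S"] by auto
  \<comment> \<open>The part of the new vector that is orthogonal to the previous ones; projection onto it
    corrects the previous projection. If it is zero, the division by zero gives the
    correction zero.\<close>
  define d where "d = a - b"
  have dV: "d \<in> V" unfolding d_def using a b sub subspace_V by (auto intro: subspace_diff)
  have dsp: "d \<in> span (insert a S)" unfolding d_def using b mono by (auto intro: span_diff span_base)
  define w where "w = u + scale (B v d / B d d) d"
  have 1: "B (v - w) x = 0" if "x \<in> span S" for x
    using u(2)[OF that] b(2)[OF that] by (simp add: w_def d_def diff_diff_eq[symmetric] B_diff B_scale)
  have 2: "B (v - w) d = 0"
  proof -
    have "B u d = 0" using b(2)[OF u(1)] by (simp add: d_def B_commute)
    moreover have "B d d = 0 \<Longrightarrow> d = 0" using B_pos[OF dV] by auto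
    then have "B v d / B d d * B d d = B v d"
      by (cases "B d d = 0") (auto simp: B_commute[of v 0] B_zero)
    ultimately show ?thesis by (simp add: w_def B_diff B_add B_scale)
  qed
  have 3: "B (v - w) a = 0"
    using 2 1[OF b(1)] by (simp add: d_def B_diff_right)
  have "B (v - w) x = 0" if "x \<in> span (insert a S)" for x
    by (rule B_span_zero[OF _ that]) (use 1 3 in \<open>auto intro: span_base\<close>)
  moreover have "w \<in> span (insert a S)"
    unfolding w_def using u mono dsp by (intro span_add span_scale) auto
  ultimately show ?case by blast
qed

lemma zero_if_orthogonal: "x \<in> V \<Longrightarrow> B x x = 0 \<Longrightarrow> x = 0"
  using B_pos[of x] by auto

end

locale triangular_form = positive_form scale B V
  for scale :: "'k::linordered_field \<Rightarrow> 'v::ab_group_add \<Rightarrow> 'v" and B V +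
  fixes m :: "'i \<Rightarrow> 'v" and I :: "'i set" and less :: "'i \<Rightarrow> 'i \<Rightarrow> bool"
  assumes span_m: "span (m ` I) = V"
    and m_notin: "\<Lambda> \<in> I \<Longrightarrow> m \<Lambda> \<notin> span (m ` {M\<in>I. less M \<Lambda>})"
    and finite_lower: "\<Lambda> \<in> I \<Longrightarrow> finite {M\<in>I. less M \<Lambda>}"
    and less_trans: "L \<in> I \<Longrightarrow> M \<in> I \<Longrightarrow> N \<in> I \<Longrightarrow> less L M \<Longrightarrow> less M N \<Longrightarrow> less L N"
    and less_irrefl: "\<not> less M M"
begin

definition below :: "'i \<Rightarrow> 'v set" where
  "below \<Lambda> = span (m ` {M\<in>I. less M \<Lambda>})"

lemma m_V: "\<Lambda> \<in> I \<Longrightarrow> m \<Lambda> \<in> V"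
  using span_base[of "m \<Lambda>" "m ` I"] by (auto simp: span_m)

lemma below_V: "below \<Lambda> \<subseteq> V"
  unfolding below_def span_m[symmetric] by (rule span_mono) auto

lemma below_mono:
  assumes "M \<in> I" "\<Lambda> \<in> I" "less M \<Lambda>"
  shows "below M \<subseteq> below \<Lambda>"
  unfolding below_def using assms less_trans by (intro span_mono image_mono) blast

text \<open>
  The condition that determines the basis vector at \<open>\<Lambda>\<close>. In contrast to pairwise
  orthogonality it involves no other basis vector.
\<close>

definition gram_schmidt :: "'i \<Rightarrow> 'v \<Rightarrow> bool" where
  "gram_schmidt \<Lambda> p \<longleftrightarrow> p - m \<Lambda> \<in> below \<Lambda> \<and> (\<forall>x\<in>below \<Lambda>. B p x = 0)"

lemma gram_schmidt_exists: assumes "\<Lambda> \<in> I" shows "\<exists>p. gram_schmidt \<Lambda> p"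
proof -
  let ?S = "m ` {M\<in>I. less M \<Lambda>}"
  obtain u where u: "u \<in> span ?S" "\<forall>x\<in>span ?S. B (m \<Lambda> - u) x = 0"
    using orthogonal_projection[of ?S "m \<Lambda>"] finite_lower[OF assms] m_V[OF assms] m_V by blast
  then show ?thesis
    by (intro exI[of _ "m \<Lambda> - u"]) (auto simp: gram_schmidt_def below_def span_neg)
qed

lemma gram_schmidt_unique:
  assumes "gram_schmidt \<Lambda> p" "gram_schmidt \<Lambda> p'" shows "p = p'"
proof -
  have d: "p - p' \<in> below \<Lambda>"
    using assms span_diff[of "p - m \<Lambda>" _ "p' - m \<Lambda>"] by (auto simp: gram_schmidt_def below_def)
  then have "B (p - p') (p - p') = 0" using assms by (simp add: gram_schmidt_def B_diff)
  then have "p - p' = 0" using d below_V by (intro zero_if_orthogonal) auto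
  then show ?thesis by simp
qed

lemma gram_schmidt_V: "\<Lambda> \<in> I \<Longrightarrow> gram_schmidt \<Lambda> p \<Longrightarrow> p \<in> V"
  using below_V m_V subspace_add[OF subspace_V, of "p - m \<Lambda>" "m \<Lambda>"] by (auto simp: gram_schmidt_def)

lemma gram_schmidt_nonzero: "\<Lambda> \<in> I \<Longrightarrow> gram_schmidt \<Lambda> p \<Longrightarrow> p \<noteq> 0"
  using m_notin[of \<Lambda>] span_neg[of "- m \<Lambda>"] by (auto simp: gram_schmidt_def below_def)

lemma lower_induct [consumes 1, case_names step]:
  assumes "\<Lambda> \<in> I" and step: "\<And>\<Lambda>. \<Lambda> \<in> I \<Longrightarrow> (\<And>M. M \<in> I \<Longrightarrow> less M \<Lambda> \<Longrightarrow> Q M) \<Longrightarrow> Q \<Lambda>"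
  shows "Q \<Lambda>"
  using assms(1)
proof (induct "card {M\<in>I. less M \<Lambda>}" arbitrary: \<Lambda> rule: less_induct)
  case less
  show ?case
  proof (rule step[OF less(2)])
    fix M assume M: "M \<in> I" "less M \<Lambda>"
    have "{N\<in>I. less N M} \<subset> {N\<in>I. less N \<Lambda>}"
      using M less(2) less_trans less_irrefl by blast
    then show "Q M" using M less finite_lower by (intro less(1)) (auto intro: psubset_card_mono)
  qed
qed

lemma m_in_span:
  assumes P: "\<And>\<Lambda>. \<Lambda> \<in> I \<Longrightarrow> P \<Lambda> - m \<Lambda> \<in> below \<Lambda>" and "\<Lambda> \<in> I"
  shows "m \<Lambda> \<in> span (P ` insert \<Lambda> {M\<in>I. less M \<Lambda>})"
  using assms(2)
proof (induct rule: lower_induct)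
  case (step \<Lambda>)
  let ?T = "P ` insert \<Lambda> {M\<in>I. less M \<Lambda>}"
  have "below \<Lambda> \<subseteq> span ?T"
    unfolding below_def
  proof (rule span_minimal)
    show "m ` {M\<in>I. less M \<Lambda>} \<subseteq> span ?T"
    proof clarify
      fix M assume M: "M \<in> I" "less M \<Lambda>"
      have "P ` insert M {N\<in>I. less N M} \<subseteq> ?T" using M step(1) less_trans by blast
      then show "m M \<in> span ?T" using step(2)[OF M] span_mono by blast
    qed
  qed (rule subspace_span)
  then have "P \<Lambda> - m \<Lambda> \<in> span ?T" using P[OF step(1)] by auto
  moreover have "P \<Lambda> \<in> span ?T" by (intro span_base) auto
  ultimately have "P \<Lambda> - (P \<Lambda> - m \<Lambda>) \<in> span ?T" by (rule span_diff[rotated])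
  then show ?case by simp
qed

text \<open>
  By triangularity the \<open>P M\<close> with \<open>M\<close> below \<open>\<Lambda>\<close> span the same space as the \<open>m M\<close>.
\<close>

lemma orthogonal_imp_gram_schmidt:
  assumes P: "\<And>\<Lambda>. \<Lambda> \<in> I \<Longrightarrow> P \<Lambda> - m \<Lambda> \<in> below \<Lambda>"
    and orth: "\<And>\<Lambda> M. \<Lambda> \<in> I \<Longrightarrow> M \<in> I \<Longrightarrow> \<Lambda> \<noteq> M \<Longrightarrow> B (P \<Lambda>) (P M) = 0"
    and \<Lambda>: "\<Lambda> \<in> I"
  shows "gram_schmidt \<Lambda> (P \<Lambda>)"
proof -
  have *: "B (P \<Lambda>) (m M) = 0" if M: "M \<in> I" "less M \<Lambda>" for M
  proof (rule B_span_zero[OF _ m_in_span[of P, OF P M(1)]])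
    fix x assume "x \<in> P ` insert M {N\<in>I. less N M}"
    then obtain N where N: "x = P N" "N \<in> I" "less N \<Lambda>" using M \<Lambda> less_trans by blast
    then have "N \<noteq> \<Lambda>" using less_irrefl by auto
    then show "B (P \<Lambda>) x = 0" using orth[of \<Lambda> N] N \<Lambda> by auto
  qed
  have "B (P \<Lambda>) x = 0" if "x \<in> below \<Lambda>" for x
    using that unfolding below_def by (rule B_span_zero[rotated]) (use * in auto)
  then show ?thesis using P[OF \<Lambda>] by (simp add: gram_schmidt_def)
qed

lemma gram_schmidt_basis:
  assumes P: "\<And>\<Lambda>. \<Lambda> \<in> I \<Longrightarrow> gram_schmidt \<Lambda> (P \<Lambda>)"
    and orth: "\<And>\<Lambda> M. \<Lambda> \<in> I \<Longrightarrow> M \<in> I \<Longrightarrow> \<Lambda> \<noteq> M \<Longrightarrow> B (P \<Lambda>) (P M) = 0"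
  shows "inj_on P I" "independent (P ` I)" "span (P ` I) = V"
proof -
  have pos: "B (P \<Lambda>) (P \<Lambda>) \<noteq> 0" if "\<Lambda> \<in> I" for \<Lambda>
    using B_pos[OF gram_schmidt_V[OF that P[OF that]] gram_schmidt_nonzero[OF that P[OF that]]] by simp
  show inj: "inj_on P I"
    using orth pos by (auto simp: inj_on_def) metis
  show "independent (P ` I)"
    unfolding dependent_def
  proof clarify
    fix \<Lambda> assume \<Lambda>: "\<Lambda> \<in> I" "P \<Lambda> \<in> span (P ` I - {P \<Lambda>})"
    have "B (P \<Lambda>) (P \<Lambda>) = 0"
    proof (rule B_span_zero[OF _ \<Lambda>(2)])
      fix x assume "x \<in> P ` I - {P \<Lambda>}"
      then show "B (P \<Lambda>) x = 0" using orth \<Lambda>(1) by auto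
    qed
    then show False using pos \<Lambda>(1) by simp
  qed
  show "span (P ` I) = V"
  proof
    show "span (P ` I) \<subseteq> V"
      by (rule span_minimal[OF _ subspace_V]) (use gram_schmidt_V P in auto)
    have "m M \<in> span (P ` I)" if "M \<in> I" for M
    proof -
      have "P ` insert M {N\<in>I. less N M} \<subseteq> P ` I" using that by auto
      moreover have "m M \<in> span (P ` insert M {N\<in>I. less N M})"
        by (rule m_in_span[OF _ that]) (use P in \<open>auto simp: gram_schmidt_def\<close>)
      ultimately show ?thesis using span_mono by blast
    qed
    then have "m ` I \<subseteq> span (P ` I)" by auto
    from span_minimal[OF this subspace_span] show "V \<subseteq> span (P ` I)" by (simp add: span_m)
  qed
qed

text \<open>
  The difference between \<open>E k (P \<Lambda>)\<close> and \<open>e k \<Lambda>\<close> times \<open>P \<Lambda>\<close> lies in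
  the span below \<open>\<Lambda>\<close>, by triangularity. It is also orthogonal to this span, because
  the self-adjoint \<open>E k\<close> maps the span to itself. Hence it vanishes.
\<close>

lemma orthogonal_if_eigen:
  assumes E_add: "\<And>k x y. E k (x + y) = E k x + E k y"
    and E_scale: "\<And>k c x. E k (scale c x) = scale c (E k x)"
    and self: "\<And>k x y. k \<in> K \<Longrightarrow> x \<in> V \<Longrightarrow> y \<in> V \<Longrightarrow> B (E k x) y = B x (E k y)"
    and tri: "\<And>k \<Lambda>. k \<in> K \<Longrightarrow> \<Lambda> \<in> I \<Longrightarrow> E k (m \<Lambda>) - scale (e k \<Lambda>) (m \<Lambda>) \<in> below \<Lambda>"
    and sep: "\<And>\<Lambda> M. \<Lambda> \<in> I \<Longrightarrow> M \<in> I \<Longrightarrow> \<Lambda> \<noteq> M \<Longrightarrow> \<exists>k\<in>K. e k \<Lambda> \<noteq> e k M"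
    and P: "\<And>\<Lambda>. \<Lambda> \<in> I \<Longrightarrow> gram_schmidt \<Lambda> (P \<Lambda>)"
    and \<Lambda>: "\<Lambda> \<in> I" and M: "M \<in> I" and ne: "\<Lambda> \<noteq> M"
  shows "B (P \<Lambda>) (P M) = 0"
proof -
  have sp: "subspace (below \<Lambda>)" for \<Lambda> unfolding below_def by (rule subspace_span)
  have Em: "E k (m N) \<in> below \<Lambda>" if k: "k \<in> K" and N: "N \<in> I" "\<Lambda> \<in> I" "less N \<Lambda>" for k N \<Lambda>
  proof -
    have "m N \<in> below \<Lambda>" unfolding below_def using N by (intro span_base) auto
    then have "(E k (m N) - scale (e k N) (m N)) + scale (e k N) (m N) \<in> below \<Lambda>"
      using tri[OF k N(1)] below_mono[OF N] sp by (intro subspace_add[OF sp] subspace_scale[OF sp]) auto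
    then show ?thesis by simp
  qed
  have inv: "E k x \<in> below \<Lambda>" if k: "k \<in> K" and \<Lambda>: "\<Lambda> \<in> I" and x: "x \<in> below \<Lambda>" for k x \<Lambda>
    using x unfolding below_def
  proof (induct rule: span_induct_alt)
    case base
    have "E k 0 = 0" using E_scale[of k 0 0] by simp
    then show ?case by (simp add: span_zero)
  next
    case (step c x y)
    then have "E k x \<in> below \<Lambda>" using Em k \<Lambda> by auto
    then show ?case using step by (simp add: E_add E_scale below_def span_add span_scale)
  qed
  have eigen: "E k (P \<Lambda>) = scale (e k \<Lambda>) (P \<Lambda>)" if k: "k \<in> K" and \<Lambda>: "\<Lambda> \<in> I" for k \<Lambda>
  proof -
    let ?d = "E k (P \<Lambda>) - scale (e k \<Lambda>) (P \<Lambda>)" and ?r = "P \<Lambda> - m \<Lambda>"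
    have r: "?r \<in> below \<Lambda>" using P[OF \<Lambda>] by (simp add: gram_schmidt_def)
    have "?d = (E k ?r + (E k (m \<Lambda>) - scale (e k \<Lambda>) (m \<Lambda>))) - scale (e k \<Lambda>) ?r"
    proof -
      have "E k (P \<Lambda>) = E k ?r + E k (m \<Lambda>)" unfolding E_add[symmetric] by simp
      then show ?thesis by (simp add: scale_right_diff_distrib)
    qed
    also have "\<dots> \<in> below \<Lambda>"
      by (intro subspace_diff[OF sp] subspace_add[OF sp] subspace_scale[OF sp] inv tri k \<Lambda> r)
    finally have d: "?d \<in> below \<Lambda>" .
    have "B ?d ?d = B (P \<Lambda>) (E k ?d) - e k \<Lambda> * B (P \<Lambda>) ?d"
      using self[OF k gram_schmidt_V[OF \<Lambda> P[OF \<Lambda>]], of ?d] d below_V[of \<Lambda>] by (simp add: B_diff B_scale subset_iff)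
    also have "\<dots> = 0" using P[OF \<Lambda>] d inv[OF k \<Lambda> d] by (simp add: gram_schmidt_def)
    finally have "?d = 0" using d below_V by (intro zero_if_orthogonal) auto
    then show ?thesis by simp
  qed
  obtain k where k: "k \<in> K" "e k \<Lambda> \<noteq> e k M" using sep[OF \<Lambda> M ne] by auto
  have "e k \<Lambda> * B (P \<Lambda>) (P M) = B (E k (P \<Lambda>)) (P M)" by (simp add: eigen[OF k(1) \<Lambda>] B_scale)
  also have "\<dots> = B (P \<Lambda>) (E k (P M))" by (rule self[OF k(1)]) (use gram_schmidt_V P \<Lambda> M in auto)
  also have "\<dots> = e k M * B (P \<Lambda>) (P M)" by (simp add: eigen[OF k(1) M] B_scale_right)
  finally show ?thesis using k(2) by simp
qed

end

section \<open>The dominance order on multipartitions\<close>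

definition lex_partial_sum :: "nat list list \<Rightarrow> nat \<Rightarrow> nat \<Rightarrow> nat" where
  "lex_partial_sum \<Lambda> k j = (\<Sum>i<k. sum_list (\<Lambda> ! i)) + sum_list (take j (\<Lambda> ! k))"

lemma dominance_le_lex_partial_sum: "dominance_le n M \<Lambda> \<longleftrightarrow> (\<forall>k<n. \<forall>j. lex_partial_sum M k j \<le> lex_partial_sum \<Lambda> k j)"
  by (simp add: dominance_le_def lex_partial_sum_def)

text \<open>
  Partial sums determine a list with positive entries, even its length; without the
  positivity, zeros at the end could not be seen.
\<close>

lemma take_sums_determine:
  assumes "0 \<notin> set xs" "0 \<notin> set ys" "\<And>j. sum_list (take j xs) = sum_list (take j (ys :: nat list))"
  shows "xs = ys"
  using assms
proof (induct xs arbitrary: ys)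
  case Nil
  then show ?case using Nil(3)[of 1] by (cases ys) auto
next
  case (Cons x xs)
  then obtain y ys' where ys: "ys = y # ys'" using Cons(4)[of 1] by (cases ys) auto
  have xy: "x = y" using Cons(4)[of 1] ys by simp
  have "xs = ys'"
  proof (rule Cons(1))
    show "sum_list (take j xs) = sum_list (take j ys')" for j
      using Cons(4)[of "Suc j"] ys xy by simp
  qed (use Cons ys in auto)
  then show ?case using ys xy by simp
qed

lemma dominance_antisym:
  assumes "M \<in> multipartitions n" "\<Lambda> \<in> multipartitions n" "dominance_le n M \<Lambda>" "dominance_le n \<Lambda> M"
  shows "M = \<Lambda>"
proof -
  have eq: "lex_partial_sum M k j = lex_partial_sum \<Lambda> k j" if "k < n" for k j
    using assms(3,4) that by (auto simp: dominance_le_lex_partial_sum intro: order.antisym)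
  have len: "length M = n" "length \<Lambda> = n" using assms by (auto simp: multipartitions_def)
  have "M ! k = \<Lambda> ! k" if "k < n" for k
  proof (rule take_sums_determine)
    have "lex_partial_sum M k 0 = lex_partial_sum \<Lambda> k 0" by (rule eq[OF that])
    then show "sum_list (take j (M ! k)) = sum_list (take j (\<Lambda> ! k))" for j
      using eq[OF that, of j] by (simp add: lex_partial_sum_def)
  qed (use assms(1,2) that len in \<open>auto simp: multipartitions_def is_partition_def\<close>)
  then show ?thesis using len by (intro nth_equalityI) auto
qed

lemma dominance_le_trans: "dominance_le n L M \<Longrightarrow> dominance_le n M N \<Longrightarrow> dominance_le n L N"
  unfolding dominance_le_lex_partial_sum by (meson order.trans)

lemma length_le_sum_list: "0 \<notin> set xs \<Longrightarrow> length xs \<le> sum_list (xs :: nat list)"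
  by (induct xs) auto

lemma lex_partial_sum_total: "length M = Suc k \<Longrightarrow> lex_partial_sum M k (length (M ! k)) = sum_list (map sum_list M)"
  by (simp add: lex_partial_sum_def sum_list_sum_nth atLeast0LessThan)

text \<open>
  The partial sums for the last component bound the total size, hence the lengths and the
  parts.
\<close>

lemma finite_dominance_lower:
  assumes "n \<ge> 1" shows "finite {M \<in> multipartitions n. dominance_le n M \<Lambda>}"
proof -
  define D where "D = sum_list (map sum_list (take n \<Lambda>)) + lex_partial_sum \<Lambda> (n - 1) 0 + (\<Sum>i<n. sum_list (\<Lambda> ! i))"
  let ?X = "{xs. set xs \<subseteq> {..D} \<and> length xs \<le> D}"
  have "finite ?X" by (rule finite_lists_length_le) simp
  then have "finite {Ms. set Ms \<subseteq> ?X \<and> length Ms = n}" by (rule finite_lists_length_eq)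
  moreover have "M \<in> {Ms. set Ms \<subseteq> ?X \<and> length Ms = n}" if M: "M \<in> multipartitions n" "dominance_le n M \<Lambda>" for M
  proof -
    have len: "length M = n" using M by (simp add: multipartitions_def)
    have "sum_list (map sum_list M) = lex_partial_sum M (n - 1) (length (M ! (n - 1)))"
      using len assms by (intro lex_partial_sum_total[symmetric]) simp
    also have "\<dots> \<le> lex_partial_sum \<Lambda> (n - 1) (length (M ! (n - 1)))"
      using M(2) assms by (auto simp: dominance_le_lex_partial_sum)
    also have "\<dots> \<le> D"
    proof -
      have "sum_list (take j xs) \<le> sum_list xs" for j and xs :: "nat list"
        by (metis append_take_drop_id le_add1 sum_list_append)
      moreover have "sum_list (\<Lambda> ! (n - 1)) \<le> (\<Sum>i<n. sum_list (\<Lambda> ! i))"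
        using assms by (intro member_le_sum) auto
      ultimately have "sum_list (take (length (M ! (n - 1))) (\<Lambda> ! (n - 1))) \<le> (\<Sum>i<n. sum_list (\<Lambda> ! i))"
        using order.trans by blast
      then show ?thesis by (simp add: D_def lex_partial_sum_def)
    qed
    finally have tot: "sum_list (map sum_list M) \<le> D" .
    have "xs \<in> ?X" if xs: "xs \<in> set M" for xs
    proof -
      have s: "sum_list xs \<le> D" using member_le_sum_list[of "sum_list xs" "map sum_list M"] xs tot by auto
      have "0 \<notin> set xs" using M xs by (auto simp: multipartitions_def is_partition_def)
      then have "length xs \<le> D" using length_le_sum_list s order.trans by blast
      moreover have "x \<le> D" if "x \<in> set xs" for x using member_le_sum_list[OF that] s by simp
      ultimately show ?thesis by auto
    qed
    then show ?thesis using len by auto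
  qed
  ultimately show ?thesis by (elim finite_subset[rotated]) auto
qed

section \<open>Multipartitions as multisets of coloured parts\<close>

lemma set_some_list [simp]: "set (some_list C) = set_mset C"
  using set_mset_mset[of "some_list C"] by simp

lemma parts_mset_Suc: "parts_mset (Suc n) \<Lambda> = parts_mset n \<Lambda> + image_mset (Pair n) (mset (\<Lambda> ! n))"
  by (simp add: parts_mset_def)

lemma filter_parts_mset: "filter_mset (\<lambda>v. fst v = k) (parts_mset n \<Lambda>) = (if k < n then image_mset (Pair k) (mset (\<Lambda> ! k)) else {#})"
proof (induct n)
  case 0 then show ?case by (simp add: parts_mset_def)
next
  case (Suc n)
  have "filter_mset (\<lambda>v. fst v = k) (image_mset (Pair n) N) = (if n = k then image_mset (Pair n) N else {#})" for N :: "nat multiset"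
    by (induct N) auto
  then show ?case using Suc by (auto simp: parts_mset_Suc)
qed

lemma parts_mset_index_set: "\<Lambda> \<in> multipartitions n \<Longrightarrow> parts_mset n \<Lambda> \<in> index_set n"
  by (force simp: parts_mset_def index_set_def set_mset_sum multipartitions_def is_partition_def intro!: Nat.gr0I)

lemma sorted_desc_unique:
  assumes "sorted_wrt (\<ge>) xs" "sorted_wrt (\<ge>) ys" "mset xs = mset (ys :: nat list)"
  shows "xs = ys"
proof -
  have "sorted (rev xs)" "sorted (rev ys)" using assms(1,2) by (simp_all add: sorted_wrt_rev)
  moreover have "mset (rev xs) = mset (rev ys)" using assms(3) by simp
  ultimately have "rev xs = rev ys" by (metis properties_for_sort)
  then show ?thesis by simp
qed

lemma parts_mset_inj:
  assumes "\<Lambda> \<in> multipartitions n" "M \<in> multipartitions n" "parts_mset n \<Lambda> = parts_mset n M"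
  shows "\<Lambda> = M"
proof -
  have len: "length \<Lambda> = n" "length M = n" using assms by (auto simp: multipartitions_def)
  have "\<Lambda> ! k = M ! k" if k: "k < n" for k
  proof (rule sorted_desc_unique)
    have "image_mset snd (image_mset (Pair k) (mset (\<Lambda> ! k))) = image_mset snd (image_mset (Pair k) (mset (M ! k)))"
      using filter_parts_mset[of k n \<Lambda>] filter_parts_mset[of k n M] assms(3) k by simp
    then show "mset (\<Lambda> ! k) = mset (M ! k)" by (simp add: image_mset.compositionality o_def)
  qed (use assms(1,2) k len in \<open>auto simp: multipartitions_def is_partition_def\<close>)
  then show ?thesis using len by (intro nth_equalityI) auto
qed

lemma parts_mset_surj:
  assumes "C \<in> index_set n"
  shows "\<exists>\<Lambda>\<in>multipartitions n. parts_mset n \<Lambda> = C"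
proof -
  define p where "p i = rev (sorted_list_of_multiset (image_mset snd (filter_mset (\<lambda>v. fst v = i) C)))" for i
  define \<Lambda> where "\<Lambda> = map p [0..<n]"
  have mp: "mset (p i) = image_mset snd (filter_mset (\<lambda>v. fst v = i) C)" for i by (simp add: p_def)
  have "is_partition (p i)" for i
  proof -
    have "sorted_wrt (\<ge>) (p i)" by (simp add: p_def sorted_wrt_rev)
    moreover have "0 \<notin># mset (p i)" unfolding mp using assms by (auto simp: index_set_def)
    ultimately show ?thesis by (simp add: is_partition_def)
  qed
  then have "\<Lambda> \<in> multipartitions n" by (auto simp: multipartitions_def \<Lambda>_def)
  moreover have "parts_mset k \<Lambda> = filter_mset (\<lambda>v. fst v < k) C" if "k \<le> n" for k
    using that
  proof (induct k)
    case 0 then show ?case by (simp add: parts_mset_def)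
  next
    case (Suc k)
    have "image_mset (Pair k) (mset (\<Lambda> ! k)) = image_mset (Pair k \<circ> snd) (filter_mset (\<lambda>v. fst v = k) C)"
      using Suc(2) by (simp add: \<Lambda>_def mp image_mset.compositionality)
    also have "\<dots> = image_mset (\<lambda>v. v) (filter_mset (\<lambda>v. fst v = k) C)"
      by (rule image_mset_cong) auto
    finally have "parts_mset (Suc k) \<Lambda> = filter_mset (\<lambda>v. fst v < k) C + filter_mset (\<lambda>v. fst v = k) C"
      using Suc by (simp add: parts_mset_Suc)
    also have "\<dots> = filter_mset (\<lambda>v. fst v < Suc k) C"
      by (induct C) auto
    finally show ?case .
  qed
  then have "parts_mset n \<Lambda> = filter_mset (\<lambda>v. fst v < n) C" by simp
  moreover have "filter_mset (\<lambda>v. fst v < n) C = C"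
    using filter_mset_left[of C "\<lambda>v. fst v < n" "{#}"] assms by (auto simp: index_set_def)
  ultimately show ?thesis by auto
qed

lemma sum_mset_submset_take:
  assumes "sorted_wrt (\<ge>) \<nu>" "N \<subseteq># mset \<nu>" "size N \<le> j"
  shows "sum_mset N \<le> sum_list (take j (\<nu> :: nat list))"
  using assms
proof (induct \<nu> arbitrary: N j)
  case (Cons x \<nu>)
  show ?case
  proof (cases "N = {#}")
    case False
    then obtain i where j: "j = Suc i" using Cons(4) by (cases j) auto
    obtain y N' where N: "N = add_mset y N'" and y: "y \<le> x" and N': "N' \<subseteq># mset \<nu>"
    proof (cases "x \<in># N")
      case True
      then obtain N' where "N = add_mset x N'" by (rule mset_add)
      then show ?thesis using that[of x N'] Cons(3) by simp
    next
      case False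
      then have sub: "N \<subseteq># mset \<nu>"
        using Cons(3) subset_eq_diff_conv[of N "{#x#}" "mset \<nu>"] by (simp add: diff_single_trivial)
      obtain y N' where N: "N = add_mset y N'" using \<open>N \<noteq> {#}\<close> by (metis multiset_cases)
      have "y \<in># mset \<nu>" using sub N by (metis insert_subset_eq_iff)
      then have "y \<le> x" using Cons(2) by simp
      moreover have "N' \<subseteq># mset \<nu>" using sub N subset_mset.order_trans[of N' N] by simp
      ultimately show ?thesis using that N by blast
    qed
    have "sum_mset N' \<le> sum_list (take i \<nu>)"
      by (rule Cons(1)) (use Cons N N' j in auto)
    then show ?thesis using N y j by simp
  qed simp
qed simp

lemma sum_mset_mono_subset: "N \<subseteq># M \<Longrightarrow> sum_mset N \<le> sum_mset (M :: nat multiset)"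
  by (metis le_add1 subset_mset.add_diff_inverse sum_mset.union)

text \<open>
  This is how the partial sums of the dominance order arise: they are the largest sums of
  parts of colour at most \<open>l\<close> with at most \<open>j\<close> of colour \<open>l\<close>.
\<close>

lemma submultiset_bound:
  assumes \<Lambda>: "\<Lambda> \<in> multipartitions n" and l: "l < n" and J: "mset J \<subseteq># parts_mset n \<Lambda>"
    and "\<forall>v\<in>set J. fst v \<le> l" and j: "length (filter (\<lambda>v. fst v = l) J) \<le> j"
  shows "sum_list (map snd J) \<le> lex_partial_sum \<Lambda> l j"
proof -
  define N where "N i = image_mset snd (filter_mset (\<lambda>v. fst v = i) (mset J))" for i
  have sub: "N i \<subseteq># mset (\<Lambda> ! i)" if "i < n" for i
  proof -
    have "filter_mset (\<lambda>v. fst v = i) (mset J) \<subseteq># image_mset (Pair i) (mset (\<Lambda> ! i))"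
      using multiset_filter_mono[OF J, of "\<lambda>v. fst v = i"] that by (simp add: filter_parts_mset)
    from image_mset_subseteq_mono[OF this, of snd] show ?thesis
      by (simp add: N_def image_mset.compositionality o_def)
  qed
  have "sum_list (map snd J) = (\<Sum>i\<le>l. sum_mset (N i))"
    using assms(4) unfolding N_def
  proof (induct J)
    case (Cons v J)
    have "(\<Sum>i\<le>l. sum_mset (image_mset snd (filter_mset (\<lambda>v. fst v = i) (mset (v # J))))) =
      (\<Sum>i\<le>l. sum_mset (image_mset snd (filter_mset (\<lambda>v. fst v = i) (mset J))) + (if i = fst v then snd v else 0))"
      by (intro sum.cong) auto
    then show ?case using Cons by (simp add: sum.distrib)
  qed simp
  also have "\<dots> = (\<Sum>i<l. sum_mset (N i)) + sum_mset (N l)"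
    by (simp add: lessThan_Suc_atMost[symmetric])
  also have "\<dots> \<le> lex_partial_sum \<Lambda> l j"
    unfolding lex_partial_sum_def
  proof (intro add_mono sum_mono)
    fix i assume "i \<in> {..<l}"
    then show "sum_mset (N i) \<le> sum_list (\<Lambda> ! i)"
      using sum_mset_mono_subset[OF sub[of i]] l by (simp add: sum_mset_sum_list)
  next
    have "size (N l) \<le> j" using j by (simp add: N_def) (metis mset_filter size_mset)
    moreover have "sorted_wrt (\<ge>) (\<Lambda> ! l)" using \<Lambda> l by (auto simp: multipartitions_def is_partition_def)
    ultimately show "sum_mset (N l) \<le> sum_list (take j (\<Lambda> ! l))"
      using sub[OF l] by (intro sum_mset_submset_take) auto
  qed
  finally show ?thesis .
qed

section \<open>Triangularity of the vertex operators\<close>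

text \<open>
  One letter for each part of \<open>M\<close>. The flagged ones belong to the alphabets before \<open>l\<close> or
  carry one of the first \<open>j\<close> parts of component \<open>l\<close>, so that the flagged parts add up to the
  partial sum of \<open>M\<close>.
\<close>

definition flagged_block :: "nat list list \<Rightarrow> nat \<Rightarrow> nat \<Rightarrow> nat \<Rightarrow> (nat \<times> bool \<times> nat) list" where
  "flagged_block M l j i = (let c = (if i = l then j else length (M ! i)) in
     map (\<lambda>a. (i, i \<le> l, a)) (take c (M ! i)) @ map (\<lambda>a. (i, False, a)) (drop c (M ! i)))"

definition flagged_parts :: "nat \<Rightarrow> nat list list \<Rightarrow> nat \<Rightarrow> nat \<Rightarrow> (nat \<times> bool \<times> nat) list" where
  "flagged_parts n M l j = concat (map (flagged_block M l j) [0..<n])"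

lemma flagged_parts_Suc: "flagged_parts (Suc n) M l j = flagged_parts n M l j @ flagged_block M l j n"
  by (simp add: flagged_parts_def)

lemma mset_flagged_parts: "mset (map (\<lambda>z. (fst z, snd (snd z))) (flagged_parts n M l j)) = parts_mset n M"
proof (induct n)
  case 0 show ?case by (simp add: flagged_parts_def parts_mset_def)
next
  case (Suc n)
  have "mset (map (\<lambda>z. (fst z, snd (snd z))) (flagged_block M l j n)) = image_mset (Pair n) (mset (take c (M ! n)) + mset (drop c (M ! n)))"
    if "c = (if n = l then j else length (M ! n))" for c
    using that by (simp add: flagged_block_def Let_def o_def)
  moreover have "mset (take c xs) + mset (drop c xs) = mset xs" for c and xs :: "nat list"
    by (metis append_take_drop_id mset_append)
  ultimately show ?case using Suc by (simp add: flagged_parts_Suc parts_mset_Suc)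
qed

lemma sum_flagged_parts:
  "(\<Sum>z\<leftarrow>flagged_parts n M l j. if fst (snd z) then snd (snd z) else 0) = (if l < n then lex_partial_sum M l j else (\<Sum>i<n. sum_list (M ! i)))"
proof (induct n)
  case 0 show ?case by (simp add: flagged_parts_def)
next
  case (Suc n)
  have z: "(\<Sum>z\<leftarrow>map (\<lambda>a. (n, b, a)) xs. if fst (snd z) then snd (snd z) else 0) = (if b then sum_list xs else 0)" for b and xs :: "nat list"
    by (induct xs) auto
  have "(\<Sum>z\<leftarrow>flagged_block M l j n. if fst (snd z) then snd (snd z) else 0) =
     (if n < l then sum_list (M ! n) else if n = l then sum_list (take j (M ! n)) else 0)"
    unfolding flagged_block_def Let_def map_append sum_list_append z by auto
  then show ?case using Suc by (auto simp: flagged_parts_Suc lex_partial_sum_def)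
qed

lemma flagged_parts_bounds:
  assumes "z \<in> set (flagged_parts n M l j)"
  shows "fst z < n" "fst (snd z) \<Longrightarrow> fst z \<le> l" "(fst z, snd (snd z)) \<in># parts_mset n M"
proof -
  have "(fst z, snd (snd z)) \<in># mset (map (\<lambda>z. (fst z, snd (snd z))) (flagged_parts n M l j))"
    using assms by auto
  then show "(fst z, snd (snd z)) \<in># parts_mset n M" unfolding mset_flagged_parts .
  from assms obtain i where "i < n" "z \<in> set (flagged_block M l j i)" by (auto simp: flagged_parts_def)
  then show "fst z < n" "fst (snd z) \<Longrightarrow> fst z \<le> l" by (auto simp: flagged_block_def Let_def)
qed

lemma number_flagged_parts: "length (filter (\<lambda>z. fst (snd z) \<and> fst z = l) (flagged_parts n M l j)) \<le> (if l < n then j else 0)"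
proof (induct n)
  case 0 show ?case by (simp add: flagged_parts_def)
next
  case (Suc n)
  have "filter (\<lambda>z. fst (snd z) \<and> fst z = l) (flagged_block M l j n) = (if n = l then map (\<lambda>a. (l, True, a)) (take j (M ! n)) else [])"
    by (auto simp: flagged_block_def Let_def filter_map o_def filter_empty_conv filter_id_conv)
  then show ?case using Suc by (auto simp: flagged_parts_Suc split: if_splits)
qed

definition select_flagged :: "bool \<Rightarrow> (nat \<times> bool \<times> nat) list \<Rightarrow> 'k list \<Rightarrow> (nat \<times> 'k) list" where
  "select_flagged b fl ys = map (\<lambda>p. (fst (fst p), snd p)) (filter (\<lambda>p. fst (snd (fst p)) = b) (zip fl ys))"

lemma letters_psum_select_flagged:
  "letters_psum (map2 flag_letter fl ys) v =
    letters_psum (map (map_prod id (\<lambda>y. monom y 1)) (select_flagged True fl ys)) v + letters_psum (map (map_prod id (\<lambda>y. [:y:])) (select_flagged False fl ys)) v"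
proof -
  have "letters_psum (map (\<lambda>(z, y). flag_letter z y) ps) v =
    letters_psum (map (map_prod id (\<lambda>y. monom y 1)) (map (\<lambda>p. (fst (fst p), snd p)) (filter (\<lambda>p. fst (snd (fst p)) = True) ps))) v +
    letters_psum (map (map_prod id (\<lambda>y. [:y:])) (map (\<lambda>p. (fst (fst p), snd p)) (filter (\<lambda>p. fst (snd (fst p)) = False) ps))) v" for ps :: "((nat \<times> bool \<times> nat) \<times> 'a) list"
    by (induct ps) (auto simp: flag_letter_def letters_psum_Cons add_ac)
  then show ?thesis unfolding select_flagged_def .
qed

lemma length_filter_select_flagged:
  assumes "length ys = length fl"
  shows "length (filter (\<lambda>z. fst z = l) (select_flagged True fl ys)) = length (filter (\<lambda>z. fst (snd z) \<and> fst z = l) fl)"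
  using assms[symmetric] unfolding select_flagged_def by (induct fl ys rule: list_induct2) auto

lemma set_select_flagged: "w \<in> set (select_flagged b fl ys) \<Longrightarrow> \<exists>z\<in>set fl. fst z = fst w \<and> fst (snd z) = b"
  unfolding select_flagged_def by (force dest: set_zip_leftD)

lemma snd_select_flagged:
  assumes "length ys = length fl" "distinct ys"
  shows "distinct (map snd (select_flagged b fl ys))" "snd ` set (select_flagged b fl ys) \<subseteq> set ys"
proof -
  have s: "map snd (select_flagged b fl ys) = map snd (filter (\<lambda>p. fst (snd (fst p)) = b) (zip fl ys))"
    by (simp add: select_flagged_def o_def)
  have "distinct (map snd (zip fl ys))" using assms by simp
  then show "distinct (map snd (select_flagged b fl ys))" unfolding s by (rule distinct_map_filter)
  show "snd ` set (select_flagged b fl ys) \<subseteq> set ys" by (auto simp: select_flagged_def dest: set_zip_rightD)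
qed

text \<open>
  If a partial sum of \<open>M\<close> exceeds that of \<open>\<Lambda>\<close>, then scaling the corresponding
  letters shows that the coordinate at \<open>M\<close> vanishes: the degree bound for the operator is
  the partial sum of \<open>\<Lambda>\<close>.
\<close>

theorem vertex_op_triangular:
  fixes \<sigma> :: "nat \<times> nat \<Rightarrow> 'k::linordered_field"
  assumes \<sigma>: "\<And>r. \<sigma> (k, r) = \<kappa> ^ r - 1" "\<And>i r. i > k \<Longrightarrow> \<sigma> (i, r) = 0"
    and k: "k < n" and \<Lambda>: "\<Lambda> \<in> multipartitions n" and M: "M \<in> multipartitions n" and L: "mset L = parts_mset n \<Lambda>"
    and nz: "mcoord (parts_mset n M) (vertex_op (exp_coeff cst (pleth_arg cst \<tau> n alphabet_gen k)) \<sigma> (amono L)) \<noteq> 0"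
  shows "dominance_le n M \<Lambda>"
  unfolding dominance_le_lex_partial_sum
proof (intro allI impI)
  fix l j assume l: "l < n"
  let ?h = "vertex_op (exp_coeff cst (pleth_arg cst \<tau> n alphabet_gen k)) \<sigma> (amono L)" and ?fl = "flagged_parts n M l j"
  show "lex_partial_sum M l j \<le> lex_partial_sum \<Lambda> l j"
  proof (rule ccontr)
    assume "\<not> lex_partial_sum M l j \<le> lex_partial_sum \<Lambda> l j"
    then have gt: "(\<Sum>z\<leftarrow>?fl. if fst (snd z) then snd (snd z) else 0) + 0 > lex_partial_sum \<Lambda> l j"
      using l by (simp add: sum_flagged_parts)
    have LI: "mset L \<in> index_set n" unfolding L by (rule parts_mset_index_set[OF \<Lambda>])
    have "mcoord (mset (map (\<lambda>z. (fst z, snd (snd z))) ?fl)) ?h = 0"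
    proof (rule letters_vanish[where u = 0 and d = "lex_partial_sum \<Lambda> l j", OF Sym_vertex_op_amono[OF LI] _ _ gt])
      fix z assume z: "z \<in> set ?fl"
      show "fst z < n \<and> snd (snd z) > 0"
        using flagged_parts_bounds[OF z] parts_mset_index_set[OF M] by (auto simp: index_set_def)
    next
      fix ys :: "'k list" and e
      assume ys: "length ys = length ?fl" "distinct ys" "0 \<notin> set ys" and e: "e + 0 > lex_partial_sum \<Lambda> l j"
      have "degree (alphabet_subst (\<lambda>c. [:c:]) (\<lambda>v. letters_psum (map (map_prod id (\<lambda>y. monom y 1)) (select_flagged True ?fl ys)) v +
          letters_psum (map (map_prod id (\<lambda>y. [:y:])) (select_flagged False ?fl ys)) v) ?h) \<le> lex_partial_sum \<Lambda> l j"
      proof (rule vertex_op_letters_degree[of \<sigma> k \<kappa> n _ l, OF \<sigma> k])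
        fix z assume "z \<in> set (select_flagged True ?fl ys)"
        then show "fst z \<le> l \<and> fst z < n" using set_select_flagged flagged_parts_bounds by metis
      next
        fix z assume "z \<in> set (select_flagged False ?fl ys)"
        then show "fst z < n" using set_select_flagged flagged_parts_bounds by metis
      next
        show "distinct (map snd (select_flagged True ?fl ys))" "0 \<notin> snd ` set (select_flagged True ?fl ys)"
          using snd_select_flagged[OF ys(1,2)] ys(3) by auto
      next
        fix J assume J: "mset J \<subseteq># mset L" "\<forall>v\<in>set J. fst v \<le> l"
          "length (filter (\<lambda>v. fst v = l) J) \<le> length (filter (\<lambda>z. fst z = l) (select_flagged True ?fl ys))"
        have "length (filter (\<lambda>z. fst z = l) (select_flagged True ?fl ys)) \<le> j"
          unfolding length_filter_select_flagged[OF ys(1)] using number_flagged_parts[of l n M j] l by simp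
        then show "sum_list (map snd J) \<le> lex_partial_sum \<Lambda> l j"
          using J L by (intro submultiset_bound[OF \<Lambda> l]) auto
      qed auto
      also have "(\<lambda>v. letters_psum (map (map_prod id (\<lambda>y. monom y 1)) (select_flagged True ?fl ys)) v +
          letters_psum (map (map_prod id (\<lambda>y. [:y:])) (select_flagged False ?fl ys)) v) = letters_psum (map2 flag_letter ?fl ys)"
        by (rule ext) (rule letters_psum_select_flagged[symmetric])
      finally show "coeff (alphabet_subst (\<lambda>c. [:c:]) (letters_psum (map2 flag_letter ?fl ys)) ?h) e = 0"
        using e by (intro coeff_eq_0) simp
    qed
    then show False using nz unfolding mset_flagged_parts by simp
  qed
qed

section \<open>Eigenvalues\<close>

lemma eigenval_ge_1: "\<kappa> \<ge> 1 \<Longrightarrow> \<tau> \<ge> 1 \<Longrightarrow> eigenval \<kappa> \<tau> \<nu> \<ge> 1"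
proof (induct \<nu>)
  case (Cons a \<nu>)
  have "1 / \<tau> \<le> 1" using Cons by simp
  then have "(1 - 1 / \<tau>) * 1 \<le> (1 - 1 / \<tau>) * \<kappa> ^ a"
    using Cons by (intro mult_left_mono) auto
  moreover have "1 / \<tau> \<le> eigenval \<kappa> \<tau> \<nu> / \<tau>" using Cons by (intro divide_right_mono) auto
  ultimately have "(1 - 1 / \<tau>) * 1 + 1 / \<tau> \<le> eigenval \<kappa> \<tau> (a # \<nu>)" by simp
  then show ?case by simp
qed simp

lemma eigenval_le: "\<kappa> \<ge> 1 \<Longrightarrow> \<tau> \<ge> 1 \<Longrightarrow> \<forall>x\<in>set \<nu>. x \<le> a \<Longrightarrow> eigenval \<kappa> \<tau> \<nu> \<le> \<kappa> ^ a"
proof (induct \<nu>)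
  case (Cons b \<nu>)
  have "1 / \<tau> \<le> 1" using Cons by simp
  moreover have "\<kappa> ^ b \<le> \<kappa> ^ a" using Cons by (intro power_increasing) auto
  ultimately have "(1 - 1 / \<tau>) * \<kappa> ^ b \<le> (1 - 1 / \<tau>) * \<kappa> ^ a"
    by (intro mult_left_mono) auto
  moreover have "eigenval \<kappa> \<tau> \<nu> / \<tau> \<le> \<kappa> ^ a / \<tau>" using Cons by (intro divide_right_mono) auto
  ultimately have "eigenval \<kappa> \<tau> (b # \<nu>) \<le> \<kappa> ^ a / \<tau> + (1 - 1 / \<tau>) * \<kappa> ^ a" by simp
  also have "\<dots> = \<kappa> ^ a" by (simp add: algebra_simps)
  finally show ?case .
qed simp

text \<open>
  The first part dominates: the eigenvalue of \<open>\<mu>\<close> is at most \<open>\<kappa>^{a-1}\<close>, while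
  that of \<open>a # \<nu>\<close> exceeds \<open>(1 - 1/\<tau>) \<kappa>^a\<close>, and \<open>\<kappa>\<close> and \<open>\<tau>\<close> are
  at least \<open>2\<close>.
\<close>

lemma eigenval_greater:
  assumes "\<kappa> \<ge> 2" "\<tau> \<ge> 2" "\<forall>x\<in>set \<mu>. x < a" "a > 0"
  shows "eigenval \<kappa> \<tau> (a # \<nu>) > eigenval \<kappa> \<tau> \<mu>"
proof -
  obtain b where Suc: "a = Suc b" using assms(4) by (cases a) auto
  have "eigenval \<kappa> \<tau> \<mu> \<le> \<kappa> ^ b"
    by (rule eigenval_le) (use assms Suc in auto)
  also have "\<kappa> ^ b = (1 / 2) * (2 * \<kappa> ^ b)" by simp
  also have "\<dots> \<le> (1 / 2) * \<kappa> ^ a"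
    unfolding Suc power_Suc using assms by (intro mult_left_mono mult_right_mono) auto
  also have "\<dots> \<le> (1 - 1 / \<tau>) * \<kappa> ^ a"
    using assms by (intro mult_right_mono) (auto simp: field_simps)
  also have "\<dots> < eigenval \<kappa> \<tau> (a # \<nu>)"
    using eigenval_ge_1[of \<kappa> \<tau> \<nu>] assms by simp
  finally show ?thesis .
qed

lemma eigenval_inj:
  assumes "\<kappa> \<ge> 2" "\<tau> \<ge> 2" "is_partition \<mu>" "is_partition \<nu>" "eigenval \<kappa> \<tau> \<mu> = eigenval \<kappa> \<tau> \<nu>"
  shows "\<mu> = \<nu>"
  using assms(3-5)
proof (induct \<mu> arbitrary: \<nu>)
  case Nil
  show ?case
  proof (cases \<nu>)
    case (Cons b \<nu>')
    then have "b > 0" using Nil(2) by (auto simp: is_partition_def)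
    then have "eigenval \<kappa> \<tau> (b # \<nu>') > eigenval \<kappa> \<tau> []"
      by (intro eigenval_greater[OF assms(1,2)]) auto
    then show ?thesis using Nil(3) Cons by simp
  qed simp
next
  case (Cons a \<mu>)
  show ?case
  proof (cases \<nu>)
    case N: Nil
    have "eigenval \<kappa> \<tau> (a # \<mu>) > eigenval \<kappa> \<tau> []"
      using Cons(2) by (intro eigenval_greater[OF assms(1,2)]) (auto simp: is_partition_def)
    then show ?thesis using Cons(4) N by simp
  next
    case (Cons b \<nu>')
    have lt: "\<forall>x\<in>set (c # xs). x < d" if "is_partition (c # xs)" "c < d" for c d xs
      using that by (auto simp: is_partition_def)
    have pos: "a > 0" "b > 0" using Cons.prems(1,2) Cons by (auto simp: is_partition_def)
    have "a = b"
    proof (rule ccontr)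
      assume "a \<noteq> b"
      then consider "a < b" | "b < a" by linarith
      then show False
      proof cases
        case 1
        from eigenval_greater[OF assms(1,2) lt[OF Cons.prems(1) 1] pos(2), of \<nu>'] show False
          using Cons.prems(3) Cons by simp
      next
        case 2
        have "is_partition (b # \<nu>')" using Cons.prems(2) Cons by simp
        from eigenval_greater[OF assms(1,2) lt[OF this 2] pos(1), of \<mu>] show False
          using Cons.prems(3) Cons by simp
      qed
    qed
    moreover have "\<mu> = \<nu>'"
    proof (rule Cons.hyps)
      show "eigenval \<kappa> \<tau> \<mu> = eigenval \<kappa> \<tau> \<nu>'" using Cons.prems(3) Cons \<open>a = b\<close> assms(2) by simp
    qed (use Cons.prems Cons in \<open>auto simp: is_partition_def\<close>)
    ultimately show ?thesis using Cons by simp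
  qed
qed

section \<open>Macdonald operators in several alphabets\<close>

text \<open>
  Elements \<open>q\<close> and \<open>t\<close> that are at least \<open>2\<close> suffice for the positivity of the form and for
  the separation of the eigenvalues.
\<close>

locale multi_macdonald =
  fixes q t :: "'k::linordered_field" and n :: nat
  assumes q2: "q \<ge> 2" and t2: "t \<ge> 2" and n1: "n \<ge> 1"
begin

definition \<tau> :: "nat \<Rightarrow> 'k" where
  "\<tau> i = q ^ (n - 1 - i) * t"

definition \<kappa> :: "nat \<Rightarrow> 'k" where
  "\<kappa> k = (if k = 0 then q else q * \<tau> k)"

text \<open>
  The alphabet \<open>k\<close> is shifted by \<open>\<kappa>^r - 1\<close>, as triangularity requires. The alphabet
  before it is shifted so that the power sums in the union of the alphabets up to \<open>i\<close> are
  shifted by \<open>q^r - 1\<close> for all \<open>i \<ge> k\<close>, and are left unchanged for \<open>i + 1 < k\<close>.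
\<close>

definition \<sigma> :: "nat \<Rightarrow> nat \<times> nat \<Rightarrow> 'k" where
  "\<sigma> k v = (if fst v = k then \<kappa> k ^ snd v - 1 else if fst v + 1 = k then q ^ snd v - \<kappa> k ^ snd v else 0)"

text \<open>
  The factor that the generator \<open>v\<close> contributes to the norms. The power of \<open>q\<close> is
  distributed over the parts according to \<open>(n - 1) |\<Lambda>| - n(\<Lambda>) = \<Sum>_i (n
  - 1 - i) |\<Lambda>^{(i)}|\<close>, with components numbered from \<open>0\<close>.
\<close>

definition \<rho> :: "nat \<times> nat \<Rightarrow> 'k" where
  "\<rho> v = of_nat (snd v) * (if fst v = n - 1 then (1 - q ^ snd v) / (1 - t ^ snd v) else q ^ ((n - 1 - fst v) * snd v))"

definition mac_op :: "nat \<Rightarrow> 'k pring \<Rightarrow> 'k pring" where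
  "mac_op k = vertex_op (exp_coeff cst (pleth_arg cst \<tau> n alphabet_gen k)) (\<sigma> k)"

lemma pos: "q > 0" "t > 0" "\<tau> i > 0"
  using q2 t2 by (auto simp: \<tau>_def)

lemma \<tau>_ge_2: "\<tau> i \<ge> 2"
proof -
  have "q ^ (n - 1 - i) \<ge> 1" using q2 by (intro one_le_power) simp
  then have "1 * 2 \<le> q ^ (n - 1 - i) * t" using t2 by (intro mult_mono) auto
  then show ?thesis by (simp add: \<tau>_def)
qed

lemma \<kappa>_ge_2: "\<kappa> k \<ge> 2"
proof -
  have "1 * 2 \<le> q * \<tau> k" using q2 \<tau>_ge_2[of k] by (intro mult_mono) auto
  then show ?thesis using q2 by (simp add: \<kappa>_def)
qed

lemma \<rho>_pos: "snd v > 0 \<Longrightarrow> \<rho> v > 0"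
proof -
  assume r: "snd v > 0"
  have "q ^ snd v > 1" "t ^ snd v > 1" using q2 t2 r by (auto intro!: one_less_power)
  then have "(1 - q ^ snd v) / (1 - t ^ snd v) > 0" by (intro divide_neg_neg) auto
  then show ?thesis using r pos by (auto simp: \<rho>_def)
qed

lemma sum_\<sigma>: "(\<Sum>j\<le>l. \<sigma> k (j, r)) = (if k \<le> l then q ^ r - 1 else if l + 1 = k then q ^ r - \<kappa> k ^ r else 0)"
proof (induct l)
  case 0
  show ?case by (auto simp: \<sigma>_def \<kappa>_def)
next
  case (Suc l)
  then show ?case by (auto simp: \<sigma>_def)
qed

text \<open>
  The derivative of the argument of the exponential with respect to the generator \<open>v\<close>, which
  occurs in the power sums of two neighbouring alphabets.
\<close>

definition pleth_coeff :: "nat \<Rightarrow> nat \<times> nat \<Rightarrow> 'k" where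
  "pleth_coeff k v = (if k \<le> fst v then 1 - (1 / \<tau> (fst v)) ^ snd v else 0)
     - (if k \<le> fst v + 1 \<and> fst v + 1 < n then 1 - (1 / \<tau> (fst v + 1)) ^ snd v else 0)"

lemma gen_deriv_pleth_arg:
  assumes "fst v < n"
  shows "gen_deriv v (pleth_arg cst \<tau> n alphabet_gen k r) = (if r = snd v then cst (pleth_coeff k v) else 0)"
proof -
  obtain l s where v: "v = (l, s)" by force
  have l: "l < n" using assms v by simp
  let ?c = "\<lambda>i. if k \<le> i then 1 - (1 / \<tau> i) ^ r else 0"
  have x: "gen_deriv v (alphabet_gen (i, r) :: 'k pring) = (if r = s then (if i = l then 1 else 0) - (if i = l + 1 then 1 else 0) else 0)" for i
  proof -
    have "gen_deriv v (f - g) = gen_deriv v f - gen_deriv v g" for f g :: "'k pring"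
      using gen_deriv_add[of v "f - g" g] by (simp add: algebra_simps)
    then show ?thesis by (auto simp: alphabet_gen_def gen_deriv_gen gen_deriv_0 v)
  qed
  have "gen_deriv v (pleth_arg cst \<tau> n alphabet_gen k r) = (\<Sum>i<n. cst (?c i) * gen_deriv v (alphabet_gen (i, r)))"
    unfolding pleth_arg_def gen_deriv_sum by (intro sum.cong) (auto simp: gen_deriv_mult gen_deriv_cst gen_deriv_0)
  also have "\<dots> = (if r = s then (\<Sum>i<n. (if i = l then cst (?c l) else 0) - (if i = l + 1 then cst (?c (l + 1)) else 0)) else 0)"
    unfolding x by (auto intro!: sum.cong)
  also have "\<dots> = (if r = s then cst (?c l) - (if l + 1 < n then cst (?c (l + 1)) else 0) else 0)"
    using l by (simp add: sum_subtractf)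
  also have "\<dots> = (if r = snd v then cst (pleth_coeff k v) else 0)"
    by (auto simp: v pleth_coeff_def rhom_diff[OF rhom_cst])
  finally show ?thesis .
qed

text \<open>
  The hypothesis of self-adjointness. For colours from \<open>k\<close> on, up to the one before the
  last, it holds since neighbouring \<open>\<tau>\<close> have the ratio \<open>q\<close>; for the last colour, the
  denominator \<open>1 - t^r\<close> of \<open>\<rho>\<close> cancels; for the colour \<open>k - 1\<close>, it determines the value
  \<open>\<kappa> = q \<tau>\<close>; below, both sides vanish.
\<close>

lemma balance:
  assumes v: "fst v < n" "snd v > 0" and k: "k < n"
  shows "pleth_coeff k v * \<rho> v = of_nat (snd v) * (1 / t) ^ snd v * (\<Sum>j\<le>fst v. \<sigma> k (j, snd v))"
proof -
  obtain l r where [simp]: "v = (l, r)" by force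
  have l: "l < n" and r: "r > 0" using v by auto
  have q0: "q \<noteq> 0" and t0: "t \<noteq> 0" and \<tau>0: "\<tau> i \<noteq> 0" for i using pos(3)[of i] pos(1,2) by auto
  have t1: "1 - t ^ r \<noteq> 0"
  proof -
    have "t > 1" using t2 by simp
    then have "t ^ r > 1" using r by (intro one_less_power)
    then show ?thesis by simp
  qed
  have \<tau>r: "\<tau> l ^ r = q ^ ((n - 1 - l) * r) * t ^ r" for l
    by (simp add: \<tau>_def power_mult_distrib power_mult)
  consider "k \<le> l" "l = n - 1" | "k \<le> l" "l + 1 < n" | "l + 1 = k" | "l + 1 < k" using l by linarith
  then show ?thesis
  proof cases
    case 1
    then have "pleth_coeff k v = 1 - (1 / t) ^ r" "\<rho> v = of_nat r * ((1 - q ^ r) / (1 - t ^ r))"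
      "(\<Sum>j\<le>l. \<sigma> k (j, r)) = q ^ r - 1"
      using l by (auto simp: pleth_coeff_def \<rho>_def sum_\<sigma> \<tau>_def)
    then have "pleth_coeff k v * \<rho> v = of_nat r * ((1 - 1 / t ^ r) * ((1 - q ^ r) / (1 - t ^ r)))"
      by (simp add: power_divide)
    also have "1 - 1 / t ^ r = - (1 - t ^ r) / t ^ r" using t0 by (simp add: field_simps)
    also have "- (1 - t ^ r) / t ^ r * ((1 - q ^ r) / (1 - t ^ r)) = - (1 - q ^ r) / t ^ r * ((1 - t ^ r) / (1 - t ^ r))"
      by (simp only: times_divide_times_eq) (simp add: algebra_simps)
    also have "\<dots> = (q ^ r - 1) / t ^ r" using t1 by simp
    finally show ?thesis using \<open>(\<Sum>j\<le>l. \<sigma> k (j, r)) = q ^ r - 1\<close> by (simp add: power_divide)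
  next
    case 2
    have "n - 1 - l = Suc (n - 1 - (l + 1))" using 2 by linarith
    then have "\<tau> l = q * \<tau> (l + 1)" unfolding \<tau>_def by (simp only: power_Suc mult.assoc)
    then have "pleth_coeff k v = (q ^ r - 1) / \<tau> l ^ r"
      using 2 q0 \<tau>0[of "l + 1"] by (simp add: pleth_coeff_def divide_simps power_mult_distrib) (simp add: algebra_simps)
    moreover have "\<rho> v = of_nat r * q ^ ((n - 1 - l) * r)" "(\<Sum>j\<le>l. \<sigma> k (j, r)) = q ^ r - 1"
      using 2 by (auto simp: \<rho>_def sum_\<sigma>)
    ultimately show ?thesis using q0 t0 by (simp add: \<tau>r divide_simps)
  next
    case 3
    then have k': "n - 1 - l = Suc (n - 1 - k)" using k by linarith
    define X T where "X = q ^ ((n - 1 - k) * r)" and "T = t ^ r"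
    have X0: "X \<noteq> 0" and T0: "T \<noteq> 0" using q0 t0 by (auto simp: X_def T_def)
    have a: "pleth_coeff k (l, r) = - (1 - 1 / (X * T))"
      unfolding pleth_coeff_def fst_conv snd_conv 3 using 3 k by (simp add: power_divide \<tau>r X_def T_def)
    have b: "\<rho> (l, r) = of_nat r * (q ^ r * X)"
    proof -
      have "l \<noteq> n - 1" using 3 k by linarith
      then show ?thesis unfolding \<rho>_def fst_conv snd_conv k' by (simp add: power_add X_def)
    qed
    have c: "(\<Sum>j\<le>l. \<sigma> k (j, r)) = q ^ r - q ^ r * (X * T)"
    proof -
      have "\<kappa> k ^ r = q ^ r * (X * T)"
        using 3 by (simp add: \<kappa>_def power_mult_distrib \<tau>r X_def T_def)
      then show ?thesis unfolding sum_\<sigma> using 3 by simp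
    qed
    have d: "(1 / t) ^ r = 1 / T" by (simp add: power_divide T_def)
    have "- (1 - 1 / (X * T)) * (of_nat r * (q ^ r * X)) = of_nat r * (1 / T) * (q ^ r - q ^ r * (X * T))"
      using X0 T0 by (simp add: field_simps)
    then show ?thesis by (simp only: \<open>v = (l, r)\<close> fst_conv snd_conv a b c d)
  next
    case 4
    then show ?thesis by (auto simp: pleth_coeff_def sum_\<sigma>)
  qed
qed

lemma mac_op_self_adjoint:
  assumes k: "k < n" and f: "f \<in> Sym n" and g: "g \<in> Sym n"
  shows "pair \<rho> (mac_op k f) g = pair \<rho> f (mac_op k g)"
  unfolding mac_op_def
proof (rule vertex_op_self_adjoint[where n = n and c = "pleth_coeff k" and \<gamma> = "1 / t"])
  show "augment (pleth_arg cst \<tau> n alphabet_gen k r) = 0" for r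
    unfolding pleth_arg_def rhom_sum[OF rhom_augment]
  proof (intro sum.neutral ballI)
    fix i
    have "augment (gen v :: 'k pring) = 0" for v unfolding augment_def by (rule gen_subst_gen[OF rhom_id])
    then have "augment (alphabet_gen (i, r) :: 'k pring) = 0"
      by (simp add: alphabet_gen_def rhom_diff[OF rhom_augment] rhom_0[OF rhom_augment])
    then show "augment (if k \<le> i then cst (1 - (1 / \<tau> i) ^ r) * alphabet_gen (i, r) else 0) = 0"
      by (simp add: rhom_mult[OF rhom_augment] rhom_0[OF rhom_augment])
  qed
  show "pleth_coeff k v * \<rho> v = of_nat (snd v) * (1 / t) ^ snd v * (\<Sum>j\<le>fst v. \<sigma> k (j, snd v))"
    if "fst v < n" "snd v > 0" for v
    by (rule balance[OF that k])
qed (use f g gen_deriv_pleth_arg in auto)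

text \<open>
  The monomial symmetric function of a multipartition; the multiplicity factor in \<open>amono\<close> is
  divided out.
\<close>

definition mono_sym :: "nat list list \<Rightarrow> 'k pring" where
  "mono_sym \<Lambda> = cst (1 / of_nat (mult_fact (parts_mset n \<Lambda>))) * amono (some_list (parts_mset n \<Lambda>))"

lemma mcoord_mono_sym:
  assumes "\<Lambda> \<in> multipartitions n" "M \<in> multipartitions n"
  shows "mcoord (parts_mset n \<Lambda>) (mono_sym M) = (if M = \<Lambda> then 1 / of_nat (mult_fact (parts_mset n \<Lambda>)) else 0)"
proof -
  have "mcoord (parts_mset n \<Lambda>) (amono (some_list (parts_mset n M)) :: 'k pring) = of_bool (mset (some_list (parts_mset n M)) = parts_mset n \<Lambda>)"
    by (rule mcoord_amono) (use parts_mset_index_set[OF assms(1)] parts_mset_index_set[OF assms(2)] in \<open>auto simp: index_set_def\<close>)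
  then show ?thesis using parts_mset_inj[OF assms(2,1)] by (auto simp: mono_sym_def mcoord_cst)
qed

lemma mono_sym_Sym: "\<Lambda> \<in> multipartitions n \<Longrightarrow> mono_sym \<Lambda> \<in> Sym n"
  unfolding mono_sym_def by (intro Sym_mult Sym_cst Sym_amono) (simp add: parts_mset_index_set)

lemma amono_mono_sym: "mset L = parts_mset n \<Lambda> \<Longrightarrow> (amono L :: 'k pring) = cst (of_nat (mult_fact (parts_mset n \<Lambda>))) * mono_sym \<Lambda>"
proof -
  assume "mset L = parts_mset n \<Lambda>"
  then have "(amono L :: 'k pring) = amono (some_list (parts_mset n \<Lambda>))" using amono_some_list[of L, where ?'a = 'k] by simp
  moreover have "of_nat (mult_fact (parts_mset n \<Lambda>)) * (1 / of_nat (mult_fact (parts_mset n \<Lambda>))) = (1 :: 'k)"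
    using mult_fact_pos[of "parts_mset n \<Lambda>"] by simp
  ultimately show ?thesis
    by (simp only: mono_sym_def mult.assoc[symmetric] rhom_mult[OF rhom_cst, symmetric] cst_1 mult_1)
qed

lemma span_mono_sym:
  assumes f: "f \<in> Sym n" and S: "\<And>M. M \<in> multipartitions n \<Longrightarrow> mcoord (parts_mset n M) f \<noteq> 0 \<Longrightarrow> M \<in> S"
  shows "f \<in> pr.span (mono_sym ` S)"
proof -
  obtain T where T: "finite T" "T \<subseteq> index_set n" "f = (\<Sum>C\<in>T. cst (mcoord C f) * amono (some_list C))"
    by (rule Sym_expand[OF f])
  have "cst (mcoord C f) * amono (some_list C) \<in> pr.span (mono_sym ` S)" if C: "C \<in> T" for C
  proof (cases "mcoord C f = 0")
    case True then show ?thesis by (simp add: pr.span_zero)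
  next
    case False
    obtain M where M: "M \<in> multipartitions n" "parts_mset n M = C" using parts_mset_surj[of C n] T(2) C by blast
    then have "(amono (some_list C) :: 'k pring) = cst (of_nat (mult_fact C)) * mono_sym M" using amono_mono_sym[of "some_list C" M] by simp
    moreover have "mono_sym M \<in> pr.span (mono_sym ` S)" using S[OF M(1)] M(2) False by (intro pr.span_base) auto
    ultimately show ?thesis by (simp add: pr.span_scale)
  qed
  then have "(\<Sum>C\<in>T. cst (mcoord C f) * amono (some_list C)) \<in> pr.span (mono_sym ` S)" by (rule pr.span_sum)
  then show ?thesis by (simp only: T(3)[symmetric])
qed

lemma Sym_subspace: "pr.subspace (Sym n :: 'k pring set)"
  unfolding pr.subspace_def by (auto intro: Sym_0 Sym_add Sym_mult Sym_cst)

lemma pair_pos: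
  assumes "f \<in> Sym n" "f \<noteq> 0"
  shows "pair \<rho> f f > 0"
  unfolding pair_def
proof (rule sum_pos)
  show "Poly_Mapping.keys f \<noteq> {}" using assms(2) by simp
  fix C assume C: "C \<in> Poly_Mapping.keys f"
  then have "C \<in> index_set n" using assms(1) by (auto simp: Sym_def)
  then have "prod_mset (image_mset \<rho> C) > 0"
    by (induct C) (auto simp: index_set_def \<rho>_pos)
  then have "psum_norm \<rho> C > 0" using mult_fact_pos[of C] by (simp add: psum_norm_def)
  moreover have "Poly_Mapping.lookup f C * Poly_Mapping.lookup f C > 0"
    using C by (simp add: in_keys_iff zero_less_mult_iff linorder_neq_iff[symmetric])
  ultimately show "Poly_Mapping.lookup f C * Poly_Mapping.lookup f C * psum_norm \<rho> C > 0" by simp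
qed simp

sublocale triangular_form "\<lambda>c f. cst c * f" "pair \<rho>" "Sym n" mono_sym "multipartitions n" "dominance_less n"
proof unfold_locales
  show "pr.subspace (Sym n :: 'k pring set)" by (rule Sym_subspace)
  show "pr.span (mono_sym ` multipartitions n) = Sym n"
  proof
    show "pr.span (mono_sym ` multipartitions n) \<subseteq> Sym n"
      by (rule pr.span_minimal[OF _ Sym_subspace]) (auto intro: mono_sym_Sym)
    show "Sym n \<subseteq> pr.span (mono_sym ` multipartitions n)"
      by (rule subsetI, rule span_mono_sym)
  qed
  show "mono_sym \<Lambda> \<notin> pr.span (mono_sym ` {M \<in> multipartitions n. dominance_less n M \<Lambda>})" if \<Lambda>: "\<Lambda> \<in> multipartitions n" for \<Lambda>
  proof
    assume "mono_sym \<Lambda> \<in> pr.span (mono_sym ` {M \<in> multipartitions n. dominance_less n M \<Lambda>})"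
    then have "mcoord (parts_mset n \<Lambda>) (mono_sym \<Lambda>) = 0"
    proof (induct rule: pr.span_induct_alt)
      case (step c x y)
      then show ?case using mcoord_mono_sym[OF \<Lambda>] by (auto simp: mcoord_add mcoord_cst dominance_less_def)
    qed (simp add: mcoord_0)
    then show False using mcoord_mono_sym[OF \<Lambda> \<Lambda>] mult_fact_pos[of "parts_mset n \<Lambda>"] by simp
  qed
  show "finite {M \<in> multipartitions n. dominance_less n M \<Lambda>}" for \<Lambda>
    by (rule finite_subset[OF _ finite_dominance_lower[OF n1, of \<Lambda>]]) (auto simp: dominance_less_def)
  show "dominance_less n L N" if "L \<in> multipartitions n" "M \<in> multipartitions n" "N \<in> multipartitions n"
    "dominance_less n L M" "dominance_less n M N" for L M N
    unfolding dominance_less_def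
  proof
    show "dominance_le n L N" using that(4,5) dominance_le_trans unfolding dominance_less_def by blast
    show "L \<noteq> N"
    proof
      assume "L = N"
      then have "L = M" using that(4,5) unfolding dominance_less_def by (intro dominance_antisym[OF that(1,2)]) auto
      then show False using that(4) by (simp add: dominance_less_def)
    qed
  qed
  show "\<not> dominance_less n M M" for M by (simp add: dominance_less_def)
  show "pair \<rho> x y = pair \<rho> y x" for x y by (rule pair_commute)
  show "pair \<rho> (x + y) z = pair \<rho> x z + pair \<rho> y z" for x y z by (rule pair_add_left)
  show "pair \<rho> (cst c * x) z = c * pair \<rho> x z" for c x z by (rule pair_cst_left)
  show "pair \<rho> x x > 0" if "x \<in> Sym n" "x \<noteq> 0" for x using that by (rule pair_pos)
qed

text \<open>
  The shift of the alphabet before \<open>k\<close> is needed for self-adjointness, but it does not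
  influence the diagonal coefficient, which therefore depends on the component \<open>k\<close> only.
\<close>

lemma mac_op_triangular:
  assumes k: "k < n" and \<Lambda>: "\<Lambda> \<in> multipartitions n"
  shows "mac_op k (mono_sym \<Lambda>) - cst (eigenval (\<kappa> k) (\<tau> k) (\<Lambda> ! k)) * mono_sym \<Lambda> \<in> below \<Lambda>"
proof -
  let ?L = "some_list (parts_mset n \<Lambda>)" and ?e = "eigenval (\<kappa> k) (\<tau> k) (\<Lambda> ! k)"
  let ?w = "1 / of_nat (mult_fact (parts_mset n \<Lambda>)) :: 'k"
  have I: "mset ?L \<in> index_set n" by (simp add: parts_mset_index_set[OF \<Lambda>])
  define h where "h = mac_op k (amono ?L)"
  have Em: "mac_op k (mono_sym \<Lambda>) = cst ?w * h" by (simp add: mac_op_def mono_sym_def vertex_op_cst h_def)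
  have hW: "h \<in> Sym n" unfolding h_def mac_op_def by (rule Sym_vertex_op_amono[OF I])
  have le: "dominance_le n M \<Lambda>" if "M \<in> multipartitions n" "mcoord (parts_mset n M) h \<noteq> 0" for M
    using that(2) unfolding h_def mac_op_def
    by (rule vertex_op_triangular[rotated -1]) (use k \<Lambda> that in \<open>auto simp: \<sigma>_def\<close>)
  have diag: "mcoord (parts_mset n \<Lambda>) h = ?e"
  proof -
    let ?\<sigma>' = "\<lambda>v. if fst v = k then \<sigma> k v else 0"
    have "mcoord (mset ?L) h = mcoord (mset ?L) (vertex_op (exp_coeff cst (pleth_arg cst \<tau> n alphabet_gen k)) ?\<sigma>' (amono ?L))"
      unfolding h_def mac_op_def by (rule mcoord_vertex_op_restrict[OF I, where k = k]) (auto simp: \<sigma>_def)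
    also have "\<dots> = ?e"
      by (rule mcoord_vertex_op_diag[OF k _ _ I])
         (use \<Lambda> k in \<open>auto simp: \<sigma>_def filter_parts_mset multipartitions_def is_partition_def\<close>)
    finally show ?thesis by simp
  qed
  have "mac_op k (mono_sym \<Lambda>) - cst ?e * mono_sym \<Lambda> \<in> pr.span (mono_sym ` {M \<in> multipartitions n. dominance_less n M \<Lambda>})"
  proof (rule span_mono_sym)
    show "mac_op k (mono_sym \<Lambda>) - cst ?e * mono_sym \<Lambda> \<in> Sym n"
      unfolding Em by (intro Sym_diff Sym_mult Sym_cst hW mono_sym_Sym \<Lambda>)
  next
    fix M assume M: "M \<in> multipartitions n" and nz: "mcoord (parts_mset n M) (mac_op k (mono_sym \<Lambda>) - cst ?e * mono_sym \<Lambda>) \<noteq> 0"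
    have c: "mcoord (parts_mset n M) (mac_op k (mono_sym \<Lambda>) - cst ?e * mono_sym \<Lambda>) = ?w * mcoord (parts_mset n M) h - ?e * (if \<Lambda> = M then 1 / of_nat (mult_fact (parts_mset n M)) else 0)"
      unfolding Em mcoord_diff mcoord_cst mcoord_mono_sym[OF M \<Lambda>] ..
    have "M \<noteq> \<Lambda>" using nz unfolding c by (auto simp: diag)
    moreover have "mcoord (parts_mset n M) h \<noteq> 0" using nz \<open>M \<noteq> \<Lambda>\<close> unfolding c by auto
    ultimately show "M \<in> {M \<in> multipartitions n. dominance_less n M \<Lambda>}"
      using le[OF M] M by (simp add: dominance_less_def)
  qed
  then show ?thesis unfolding below_def .
qed

lemma gram_schmidt_orthogonal:
  assumes "\<And>\<Lambda>. \<Lambda> \<in> multipartitions n \<Longrightarrow> gram_schmidt \<Lambda> (P \<Lambda>)"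
    and \<Lambda>: "\<Lambda> \<in> multipartitions n" and M: "M \<in> multipartitions n" and "\<Lambda> \<noteq> M"
  shows "pair \<rho> (P \<Lambda>) (P M) = 0"
proof (rule orthogonal_if_eigen[where E = mac_op and K = "{..<n}" and e = "\<lambda>k \<Lambda>. eigenval (\<kappa> k) (\<tau> k) (\<Lambda> ! k)"])
  fix L N assume LN: "L \<in> multipartitions n" "N \<in> multipartitions n" "L \<noteq> N"
  then obtain k where k: "k < n" "L ! k \<noteq> N ! k"
    by (auto simp: multipartitions_def list_eq_iff_nth_eq)
  then have "eigenval (\<kappa> k) (\<tau> k) (L ! k) \<noteq> eigenval (\<kappa> k) (\<tau> k) (N ! k)"
    using eigenval_inj[OF \<kappa>_ge_2[of k] \<tau>_ge_2[of k], of "L ! k" "N ! k"] LN by (auto simp: multipartitions_def)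
  then show "\<exists>k\<in>{..<n}. eigenval (\<kappa> k) (\<tau> k) (L ! k) \<noteq> eigenval (\<kappa> k) (\<tau> k) (N ! k)" using k by auto
qed (use assms mac_op_self_adjoint mac_op_triangular in \<open>auto simp: mac_op_def vertex_op_add vertex_op_cst\<close>)

end

section \<open>Transport to multi-symmetric functions\<close>

lemma theta_amono_mono_series:
  assumes "\<Lambda> \<in> multipartitions n"
  shows "theta (cst (1 / of_nat (mult_fact (parts_mset n \<Lambda>))) * amono (some_list (parts_mset n \<Lambda>))) = (mono_series (parts_mset n \<Lambda>) :: (nat \<times> nat, 'k::field_char_0) mfps)"
proof -
  have "theta (amono (some_list (parts_mset n \<Lambda>)) :: 'k pring) = aug_mono_series (mset (some_list (parts_mset n \<Lambda>)))"
    by (rule theta_amono) (use parts_mset_index_set[OF assms] in \<open>force simp: index_set_def\<close>)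
  moreover have "(of_nat (mult_fact (parts_mset n \<Lambda>)) :: 'k) \<noteq> 0" using mult_fact_pos[of "parts_mset n \<Lambda>"] by simp
  ultimately show ?thesis
    unfolding theta_cst by (intro mfps_eqI) (simp add: aug_mono_series_altdef mcoeff_mscale)
qed

lemma theta_inj:
  assumes "f \<in> Sym n" "theta f = theta g" "g \<in> Sym n"
  shows "f = (g :: 'k::field_char_0 pring)"
proof -
  have d: "f - g \<in> Sym n" using assms by (intro Sym_diff)
  obtain S where S: "f - g = (\<Sum>C\<in>S. cst (mcoord C (f - g)) * amono (some_list C))"
    by (rule Sym_expand[OF d])
  have "theta (f - g) = 0" using assms by (simp add: rhom_diff[OF rhom_theta])
  then have "mcoord C (f - g) = 0" for C by (simp add: mcoord_def mcoeff_0)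
  then have "(\<Sum>C\<in>S. cst (mcoord C (f - g)) * amono (some_list C)) = 0" by simp
  then have "f - g = 0" by (simp only: S[symmetric])
  then show ?thesis by simp
qed

global_interpretation theta: Vector_Spaces.linear "\<lambda>(c::'k::field) (f::'k pring). cst c * f" mscale theta
  by standard (simp_all add: rhom_add[OF rhom_theta] theta_cst)

lemma theta_span: "mfps.span (theta ` S) = theta ` pr.span S"
  by (rule theta.span_image)

lemma theta_independent:
  fixes S :: "'k::field_char_0 pring set"
  assumes "pr.independent S" "S \<subseteq> Sym n"
  shows "mfps.independent (theta ` S)"
proof (rule theta.independent_inj_on_image[OF assms(1)])
  have "pr.span S \<subseteq> Sym n"
    by (rule pr.span_minimal[OF assms(2)])
       (auto simp: pr.subspace_def intro: Sym_0 Sym_add Sym_mult Sym_cst)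
  then show "inj_on theta (pr.span S)"
    by (auto intro!: inj_onI theta_inj[of _ n])
qed

lemma lookup_pr_span:
  "x \<in> pr.span (b ` T) \<Longrightarrow> (\<And>D. D \<in> T \<Longrightarrow> Poly_Mapping.lookup (b D) C = 0) \<Longrightarrow> Poly_Mapping.lookup x C = 0"
  by (induct rule: pr.span_induct_alt) (auto simp: lookup_add lookup_cst_times)

lemma single_independent: "pr.independent ((\<lambda>C. Poly_Mapping.single C (1::'k::field)) ` T)"
  unfolding pr.dependent_def
proof clarify
  fix C assume "C \<in> T" and sp: "Poly_Mapping.single C (1::'k) \<in> pr.span ((\<lambda>C. Poly_Mapping.single C 1) ` T - {Poly_Mapping.single C 1})"
  have "(\<lambda>C. Poly_Mapping.single C (1::'k)) ` T - {Poly_Mapping.single C 1} \<subseteq> (\<lambda>C. Poly_Mapping.single C 1) ` (T - {C})" by auto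
  with sp have "Poly_Mapping.single C (1::'k) \<in> pr.span ((\<lambda>C. Poly_Mapping.single C 1) ` (T - {C}))"
    using pr.span_mono by blast
  then have "Poly_Mapping.lookup (Poly_Mapping.single C (1::'k)) C = 0"
    by (rule lookup_pr_span) (auto simp: lookup_single)
  then show False by simp
qed

text \<open>
  In the ring of polynomials in the power sums, the coordinates with respect to the
  \<open>p_\<Lambda>\<close> are simply the coefficients.
\<close>

lemma p_basis_representation:
  assumes f: "f \<in> Sym n" and \<Lambda>: "\<Lambda> \<in> multipartitions n"
  shows "p_coeff n (theta f) \<Lambda> = Poly_Mapping.lookup f (parts_mset n \<Lambda>)"
proof -
  let ?b = "multi_p n ` multipartitions n"
  have mp: "multi_p n M = theta (Poly_Mapping.single (parts_mset n M) 1)" if "M \<in> multipartitions n" for M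
    by (rule multi_p_theta) (use parts_mset_index_set[OF that] in \<open>auto simp: index_set_def\<close>)
  have b: "?b = theta ` ((\<lambda>C. Poly_Mapping.single C 1) ` index_set n)"
  proof -
    have "parts_mset n ` multipartitions n = index_set n" using parts_mset_index_set parts_mset_surj by blast
    then have "theta ` ((\<lambda>C. Poly_Mapping.single C 1) ` index_set n) = (\<lambda>M. theta (Poly_Mapping.single (parts_mset n M) 1)) ` multipartitions n"
      by (simp add: image_image flip: \<open>parts_mset n ` multipartitions n = index_set n\<close>)
    note eq = this
    show ?thesis unfolding eq by (simp only: mp cong: image_cong)
  qed
  have ind: "mfps.independent ?b"
    unfolding b by (rule theta_independent[OF single_independent, of _ n]) (auto simp: Sym_def)
  have base: "mfps.representation ?b (theta (Poly_Mapping.single C 1)) = (\<lambda>v. if v = theta (Poly_Mapping.single C 1) then 1 else 0)"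
    if "C \<in> index_set n" for C
    using mfps.representation_basis[OF ind] that by (simp add: b)
  have mem: "theta (Poly_Mapping.single C 1) \<in> mfps.span ?b" if "C \<in> index_set n" for C
    unfolding b by (intro mfps.span_base imageI that)
  have f_eq: "f = (\<Sum>C\<in>Poly_Mapping.keys f. cst (Poly_Mapping.lookup f C) * Poly_Mapping.single C 1)"
    unfolding cst_def mult_single by (rule poly_mapping_eqI) (simp add: lookup_sum lookup_single when_def in_keys_iff)
  have keys: "C \<in> index_set n" if "C \<in> Poly_Mapping.keys f" for C using f that by (auto simp: Sym_def)
  have "theta f = (\<Sum>C\<in>Poly_Mapping.keys f. mscale (Poly_Mapping.lookup f C) (theta (Poly_Mapping.single C 1)))"
    by (subst f_eq) (simp add: rhom_sum[OF rhom_theta] theta_cst)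
  then have "p_coeff n (theta f) \<Lambda> =
    (\<Sum>C\<in>Poly_Mapping.keys f. Poly_Mapping.lookup f C * mfps.representation ?b (theta (Poly_Mapping.single C 1)) (multi_p n \<Lambda>))"
    unfolding p_coeff_def
    by (simp add: mfps.representation_sum[OF ind] mfps.representation_scale[OF ind] mfps.span_scale mem keys)
  also have "\<dots> = (\<Sum>C\<in>Poly_Mapping.keys f. if C = parts_mset n \<Lambda> then Poly_Mapping.lookup f (parts_mset n \<Lambda>) else 0)"
  proof (intro sum.cong refl)
    fix C assume "C \<in> Poly_Mapping.keys f"
    then have C: "C \<in> index_set n" by (rule keys)
    have "multi_p n \<Lambda> = theta (Poly_Mapping.single C 1) \<longleftrightarrow> C = parts_mset n \<Lambda>"
    proof
      assume "multi_p n \<Lambda> = theta (Poly_Mapping.single C 1)"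
      then have "Poly_Mapping.single (parts_mset n \<Lambda>) (1::qt_field) = Poly_Mapping.single C 1"
        unfolding mp[OF \<Lambda>] by (intro theta_inj[of _ n]) (use C parts_mset_index_set[OF \<Lambda>] in \<open>auto simp: Sym_def\<close>)
      then have "Poly_Mapping.keys (Poly_Mapping.single (parts_mset n \<Lambda>) (1::qt_field)) = Poly_Mapping.keys (Poly_Mapping.single C (1::qt_field))" by simp
      then show "C = parts_mset n \<Lambda>" by simp
    qed (simp add: mp[OF \<Lambda>])
    then show "Poly_Mapping.lookup f C * mfps.representation ?b (theta (Poly_Mapping.single C 1)) (multi_p n \<Lambda>) =
      (if C = parts_mset n \<Lambda> then Poly_Mapping.lookup f (parts_mset n \<Lambda>) else 0)"
      by (auto simp: base[OF C])
  qed
  also have "\<dots> = Poly_Mapping.lookup f (parts_mset n \<Lambda>)" by (auto simp: in_keys_iff)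
  finally show ?thesis .
qed

lemma mult_fact_image_Pair: "mult_fact (image_mset (Pair i) (mset (xs :: nat list))) = (\<Prod>r\<in>set xs. fact (count_list xs r))"
proof -
  have "count (image_mset (Pair i) M) (i, r) = count M r" for M :: "nat multiset" and r
    by (induct M) auto
  then have "mult_fact (image_mset (Pair i) (mset xs)) = (\<Prod>r\<in>set xs. fact (count (mset xs) r))"
    unfolding mult_fact_def by (simp add: prod.reindex inj_on_def)
  then show ?thesis by (simp add: count_mset)
qed

lemma mult_fact_union:
  assumes "set_mset A \<inter> set_mset C = {}" shows "mult_fact (A + C) = mult_fact A * mult_fact C"
proof -
  have "mult_fact (A + C) = (\<Prod>v\<in>set_mset A. fact (count (A + C) v)) * (\<Prod>v\<in>set_mset C. fact (count (A + C) v))"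
    unfolding mult_fact_def set_mset_union by (rule prod.union_disjoint) (use assms in auto)
  also have "(\<Prod>v\<in>set_mset A. fact (count (A + C) v)) = mult_fact A"
  proof -
    have "count C v = 0" if "v \<in># A" for v using that assms by (auto simp: count_eq_zero_iff)
    then show ?thesis by (simp add: mult_fact_def)
  qed
  also have "(\<Prod>v\<in>set_mset C. fact (count (A + C) v)) = mult_fact C"
  proof -
    have "count A v = 0" if "v \<in># C" for v using that assms by (auto simp: count_eq_zero_iff)
    then show ?thesis by (simp add: mult_fact_def)
  qed
  finally show ?thesis .
qed

lemma mult_fact_parts_mset: "mult_fact (parts_mset n \<Lambda>) = (\<Prod>i<n. \<Prod>r\<in>set (\<Lambda> ! i). fact (count_list (\<Lambda> ! i) r))"
proof (induct n)
  case (Suc n)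
  have "set_mset (parts_mset n \<Lambda>) \<inter> set_mset (image_mset (Pair n) (mset (\<Lambda> ! n))) = {}"
    by (auto simp: parts_mset_def set_mset_sum)
  from mult_fact_union[OF this] show ?case by (simp add: parts_mset_Suc Suc mult_fact_image_Pair)
qed (simp add: parts_mset_def mult_fact_def)

lemma prod_parts_mset: "(\<Prod>v\<in>#parts_mset n \<Lambda>. f v) = (\<Prod>i<n. \<Prod>r\<leftarrow>\<Lambda> ! i. f (i, r))"
  by (induct n) (simp_all add: parts_mset_Suc image_mset.compositionality o_def flip: prod_mset_prod_list, simp add: parts_mset_def)

lemma prod_list_count: "prod_list (xs :: nat list) = (\<Prod>r\<in>set xs. r ^ count_list xs r)"
  using prod_mset_multiplicity[of "mset xs"] by (simp add: prod_mset_prod_list count_mset)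

lemma of_nat_z_part: "of_nat (z_part \<nu>) = (\<Prod>r\<leftarrow>\<nu>. of_nat r) * (of_nat (\<Prod>r\<in>set \<nu>. fact (count_list \<nu> r)) :: 'k::comm_semiring_1)"
proof -
  have "z_part \<nu> = prod_list \<nu> * (\<Prod>r\<in>set \<nu>. fact (count_list \<nu> r))"
    by (simp add: z_part_def prod.distrib prod_list_count)
  moreover have "of_nat (prod_list \<nu>) = (\<Prod>r\<leftarrow>\<nu>. of_nat r :: 'k)" by (induct \<nu>) auto
  ultimately show ?thesis by simp
qed

lemma prod_list_mult: "(\<Prod>x\<leftarrow>xs. f x * g x) = (\<Prod>x\<leftarrow>xs. f x) * (\<Prod>x\<leftarrow>xs. (g x :: 'k::comm_monoid_mult))"
  by (induct xs) (auto simp: mult_ac)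

text \<open>
  A polynomial is positive in the order when its leading coefficient is, so \<open>q\<close> and \<open>t\<close>
  exceed all constants.
\<close>

lemma qt_ge_2: "q_var \<ge> 2" "t_var \<ge> 2"
proof -
  have two: "(2 :: qt_field) = Fract 2 1"
    using of_nat_fract[of 2, where ?'a = "rat poly poly"] by simp
  have a: "(2 :: rat poly poly) \<le> [:0, 1:]"
    unfolding less_eq_poly_def by (simp add: numeral_poly pos_poly_def)
  have b: "(2 :: rat poly) \<le> [:0, 1:]"
    unfolding less_eq_poly_def by (simp add: numeral_poly pos_poly_def)
  have pos: "(0 :: rat poly) < [:- 2, 1:]"
    unfolding less_poly_def by (simp add: pos_poly_def)
  then have c: "(2 :: rat poly poly) \<le> [:[:0, 1:]:]"
    unfolding less_eq_poly_def by (auto simp: numeral_poly pos_poly_def pos)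
  show "q_var \<ge> 2" "t_var \<ge> 2"
    using a c by (simp_all add: q_var_def t_var_def to_fract_def two)
qed

context multi_macdonald
begin

lemma psum_norm_\<rho>:
  "psum_norm \<rho> (parts_mset n \<Lambda>) = q ^ (\<Sum>i<n. (n - 1 - i) * sum_list (\<Lambda> ! i)) * of_nat (\<Prod>i<n. z_part (\<Lambda> ! i)) *
     (\<Prod>r\<leftarrow>\<Lambda> ! (n - 1). (1 - q ^ r) / (1 - t ^ r))"
proof -
  let ?f = "\<lambda>i r. if i = n - 1 then (1 - q ^ r) / (1 - t ^ r) else q ^ ((n - 1 - i) * r)"
  have row: "(\<Prod>r\<leftarrow>xs. ?f i r) = q ^ ((n - 1 - i) * sum_list xs) * (if i = n - 1 then (\<Prod>r\<leftarrow>xs. (1 - q ^ r) / (1 - t ^ r)) else 1)" for i xs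
    by (induct xs) (auto simp: power_add algebra_simps)
  have "(\<Prod>v\<in>#parts_mset n \<Lambda>. \<rho> v) = (\<Prod>i<n. (\<Prod>r\<leftarrow>\<Lambda> ! i. of_nat r) * (\<Prod>r\<leftarrow>\<Lambda> ! i. ?f i r))"
    unfolding prod_parts_mset \<rho>_def fst_conv snd_conv prod_list_mult ..
  also have "\<dots> = (\<Prod>i<n. \<Prod>r\<leftarrow>\<Lambda> ! i. of_nat r) * (q ^ (\<Sum>i<n. (n - 1 - i) * sum_list (\<Lambda> ! i)) *
      (\<Prod>r\<leftarrow>\<Lambda> ! (n - 1). (1 - q ^ r) / (1 - t ^ r)))"
    unfolding row prod.distrib using n1 by (simp add: power_sum prod.delta)
  moreover have "of_nat (\<Prod>i<n. z_part (\<Lambda> ! i)) = (\<Prod>i<n. \<Prod>r\<leftarrow>\<Lambda> ! i. of_nat r) * (of_nat (mult_fact (parts_mset n \<Lambda>)) :: 'k)"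
    unfolding of_nat_prod of_nat_z_part mult_fact_parts_mset by (simp add: prod.distrib)
  ultimately show ?thesis by (simp add: psum_norm_def mult_ac)
qed

end

locale qt_macdonald = multi_macdonald q_var t_var n for n
begin

lemma p_pairing_psum_norm:
  assumes \<Lambda>: "\<Lambda> \<in> multipartitions n"
  shows "p_pairing n \<Lambda> \<Lambda> = psum_norm \<rho> (parts_mset n \<Lambda>)"
proof -
  have len: "length \<Lambda> = n" using \<Lambda> by (simp add: multipartitions_def)
  have "int (n - 1) * int (sum_list (size_comp \<Lambda>)) - int (n_stat (size_comp \<Lambda>)) =
    (\<Sum>i<n. int (n - 1) * int (sum_list (\<Lambda> ! i)) - int (i * sum_list (\<Lambda> ! i)))"
    by (simp add: size_comp_def n_stat_def len sum_list_sum_nth atLeast0LessThan sum_subtractf sum_distrib_left)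
  also have "\<dots> = int (\<Sum>i<n. (n - 1 - i) * sum_list (\<Lambda> ! i))"
    unfolding of_nat_sum
  proof (intro sum.cong refl)
    fix i assume "i \<in> {..<n}"
    then obtain d where "n - 1 = i + d" by (metis Suc_diff_1 lessThan_iff less_Suc_eq_le le_iff_add n1 less_le_trans zero_less_one)
    then show "int (n - 1) * int (sum_list (\<Lambda> ! i)) - int (i * sum_list (\<Lambda> ! i)) = int ((n - 1 - i) * sum_list (\<Lambda> ! i))"
      by (simp add: algebra_simps)
  qed
  finally show ?thesis
    unfolding psum_norm_\<rho> p_pairing_def by (simp only: power_int_of_nat simp_thms if_True)
qed

lemma scalar_prod_theta:
  assumes f: "f \<in> Sym n" and g: "g \<in> Sym n"
  shows "scalar_prod n (theta f) (theta g) = pair \<rho> f g"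
proof -
  let ?c = "\<lambda>f \<Lambda>. Poly_Mapping.lookup f (parts_mset n \<Lambda>)"
  have sup: "p_support n (theta h) = {\<Lambda> \<in> multipartitions n. ?c h \<Lambda> \<noteq> 0}" if "h \<in> Sym n" for h
    using p_basis_representation[OF that] by (auto simp: p_support_def)
  have inj: "inj_on (parts_mset n) (multipartitions n)" by (auto intro!: inj_onI parts_mset_inj)
  have img: "parts_mset n ` {\<Lambda> \<in> multipartitions n. ?c h \<Lambda> \<noteq> 0} = Poly_Mapping.keys h" if "h \<in> Sym n" for h :: "qt_field pring"
  proof
    show "Poly_Mapping.keys h \<subseteq> parts_mset n ` {\<Lambda> \<in> multipartitions n. ?c h \<Lambda> \<noteq> 0}"
    proof
      fix C assume C: "C \<in> Poly_Mapping.keys h"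
      then have "C \<in> index_set n" using that by (auto simp: Sym_def)
      then obtain \<Lambda> where "\<Lambda> \<in> multipartitions n" "parts_mset n \<Lambda> = C" using parts_mset_surj by blast
      then show "C \<in> parts_mset n ` {\<Lambda> \<in> multipartitions n. ?c h \<Lambda> \<noteq> 0}" using C by (auto simp: in_keys_iff)
    qed
  qed (auto simp: in_keys_iff)
  let ?F = "{\<Lambda> \<in> multipartitions n. ?c f \<Lambda> \<noteq> 0}" and ?G = "{\<Lambda> \<in> multipartitions n. ?c g \<Lambda> \<noteq> 0}"
  have fin: "finite ?G"
    by (rule finite_imageD[of "parts_mset n"]) (use img[OF g] inj in \<open>auto intro: inj_on_subset\<close>)
  have "scalar_prod n (theta f) (theta g) = (\<Sum>\<Lambda>\<in>?F. \<Sum>M\<in>?G. ?c f \<Lambda> * ?c g M * p_pairing n \<Lambda> M)"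
    unfolding scalar_prod_def sup[OF f] sup[OF g]
    by (intro sum.cong refl) (simp add: p_basis_representation[OF f] p_basis_representation[OF g])
  also have "\<dots> = (\<Sum>\<Lambda>\<in>?F. ?c f \<Lambda> * ?c g \<Lambda> * psum_norm \<rho> (parts_mset n \<Lambda>))"
  proof (intro sum.cong refl)
    fix \<Lambda> assume \<Lambda>: "\<Lambda> \<in> ?F"
    have "(\<Sum>M\<in>?G. ?c f \<Lambda> * ?c g M * p_pairing n \<Lambda> M) = (\<Sum>M\<in>?G. if M = \<Lambda> then ?c f \<Lambda> * ?c g \<Lambda> * psum_norm \<rho> (parts_mset n \<Lambda>) else 0)"
      using \<Lambda> by (intro sum.cong refl) (auto simp: p_pairing_psum_norm, auto simp: p_pairing_def)
    also have "\<dots> = ?c f \<Lambda> * ?c g \<Lambda> * psum_norm \<rho> (parts_mset n \<Lambda>)"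
      unfolding sum.delta[OF fin] using \<Lambda> by auto
    finally show "(\<Sum>M\<in>?G. ?c f \<Lambda> * ?c g M * p_pairing n \<Lambda> M) = ?c f \<Lambda> * ?c g \<Lambda> * psum_norm \<rho> (parts_mset n \<Lambda>)" .
  qed
  also have "\<dots> = (\<Sum>C\<in>parts_mset n ` ?F. Poly_Mapping.lookup f C * Poly_Mapping.lookup g C * psum_norm \<rho> C)"
    by (rule sum.reindex_cong[symmetric]) (use inj in \<open>auto intro: inj_on_subset\<close>)
  finally show ?thesis unfolding img[OF f] pair_def .
qed

lemma theta_mono_sym: "\<Lambda> \<in> multipartitions n \<Longrightarrow> theta (mono_sym \<Lambda>) = multi_m n \<Lambda>"
  unfolding mono_sym_def multi_m_mono_series by (rule theta_amono_mono_series)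

lemma theta_Sym: "theta ` Sym n = msym n"
proof -
  have "multi_m n ` multipartitions n = theta ` mono_sym ` multipartitions n"
    unfolding image_image by (rule image_cong) (simp_all add: theta_mono_sym)
  then show ?thesis unfolding msym_def span_m[symmetric] by (simp only: theta_span)
qed

lemma theta_below:
  "theta ` below \<Lambda> = mfps.span (multi_m n ` {M \<in> multipartitions n. dominance_less n M \<Lambda>})"
proof -
  have "multi_m n ` {M \<in> multipartitions n. dominance_less n M \<Lambda>} = theta ` mono_sym ` {M \<in> multipartitions n. dominance_less n M \<Lambda>}"
    unfolding image_image by (rule image_cong) (simp_all add: theta_mono_sym)
  then show ?thesis unfolding below_def by (simp only: theta_span)
qed

definition is_macdonald_basis :: "(nat list list \<Rightarrow> mseries) \<Rightarrow> bool" where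
  "is_macdonald_basis P \<longleftrightarrow>
     P \<in> extensional (multipartitions n) \<and>
     is_basis_of (multipartitions n) P (msym n) \<and>
     (\<forall>\<Lambda>\<in>multipartitions n.
        P \<Lambda> - multi_m n \<Lambda>
          \<in> mfps.span (multi_m n ` {M \<in> multipartitions n. dominance_less n M \<Lambda>})) \<and>
     (\<forall>\<Lambda>\<in>multipartitions n. \<forall>M\<in>multipartitions n.
        \<Lambda> \<noteq> M \<longrightarrow> scalar_prod n (P \<Lambda>) (P M) = 0)"

lemma is_macdonald_basis_restrict:
  assumes gram_schmidt: "\<And>\<Lambda>. \<Lambda> \<in> multipartitions n \<Longrightarrow> gram_schmidt \<Lambda> (Q \<Lambda>)"
  shows "is_macdonald_basis (restrict (theta \<circ> Q) (multipartitions n))"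
proof -
  let ?P = "restrict (theta \<circ> Q) (multipartitions n)"
  have W: "Q \<Lambda> \<in> Sym n" if "\<Lambda> \<in> multipartitions n" for \<Lambda> using gram_schmidt_V[OF that gram_schmidt[OF that]] .
  have orth: "pair \<rho> (Q \<Lambda>) (Q M) = 0" if "\<Lambda> \<in> multipartitions n" "M \<in> multipartitions n" "\<Lambda> \<noteq> M" for \<Lambda> M
    by (rule gram_schmidt_orthogonal[OF gram_schmidt that])
  have basis: "inj_on Q (multipartitions n)" "pr.independent (Q ` multipartitions n)"
    "pr.span (Q ` multipartitions n) = Sym n"
    using gram_schmidt_basis[of Q] gram_schmidt orth by blast+
  have img: "?P ` multipartitions n = theta ` Q ` multipartitions n" by (auto simp: image_image)
  have "is_basis_of (multipartitions n) ?P (msym n)"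
    unfolding is_basis_of_def img
  proof (intro conjI)
    show "inj_on ?P (multipartitions n)"
    proof (rule inj_onI)
      fix \<Lambda> M assume *: "\<Lambda> \<in> multipartitions n" "M \<in> multipartitions n" "?P \<Lambda> = ?P M"
      then have "Q \<Lambda> = Q M" using theta_inj[OF W[OF *(1)] _ W[OF *(2)]] by simp
      then show "\<Lambda> = M" using basis(1) * by (auto dest: inj_onD)
    qed
    show "mfps.independent (theta ` Q ` multipartitions n)"
      by (rule theta_independent[of _ n, OF basis(2)]) (use W in auto)
    show "mfps.span (theta ` Q ` multipartitions n) = msym n"
      unfolding theta_span basis(3) by (rule theta_Sym)
  qed
  moreover have "?P \<Lambda> - multi_m n \<Lambda> \<in> theta ` below \<Lambda>" if \<Lambda>: "\<Lambda> \<in> multipartitions n" for \<Lambda>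
  proof -
    have "?P \<Lambda> - multi_m n \<Lambda> = theta (Q \<Lambda> - mono_sym \<Lambda>)"
      using \<Lambda> by (simp add: theta_mono_sym rhom_diff[OF rhom_theta])
    then show ?thesis using gram_schmidt[OF \<Lambda>] unfolding gram_schmidt_def by blast
  qed
  moreover have "scalar_prod n (?P \<Lambda>) (?P M) = 0"
    if "\<Lambda> \<in> multipartitions n" "M \<in> multipartitions n" "\<Lambda> \<noteq> M" for \<Lambda> M
    using that orth[OF that] by (simp add: scalar_prod_theta W)
  ultimately show ?thesis unfolding is_macdonald_basis_def theta_below by simp
qed

lemma is_macdonald_basis_unique:
  assumes P: "is_macdonald_basis P"
    and gram_schmidt: "\<And>\<Lambda>. \<Lambda> \<in> multipartitions n \<Longrightarrow> gram_schmidt \<Lambda> (Q \<Lambda>)"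
  shows "P = restrict (theta \<circ> Q) (multipartitions n)"
proof (rule extensionalityI)
  show "P \<in> extensional (multipartitions n)" using P by (simp add: is_macdonald_basis_def)
  have "\<exists>f. f - mono_sym \<Lambda> \<in> below \<Lambda> \<and> theta f = P \<Lambda>" if \<Lambda>: "\<Lambda> \<in> multipartitions n" for \<Lambda>
  proof -
    have "P \<Lambda> - multi_m n \<Lambda> \<in> theta ` below \<Lambda>"
      using P \<Lambda> unfolding is_macdonald_basis_def theta_below by blast
    then obtain g where g: "g \<in> below \<Lambda>" "P \<Lambda> - multi_m n \<Lambda> = theta g" by blast
    have "theta (g + mono_sym \<Lambda>) = P \<Lambda>"
      using g(2)[symmetric] by (simp add: rhom_add[OF rhom_theta] theta_mono_sym \<Lambda>)
    then show ?thesis using g(1) by (intro exI[of _ "g + mono_sym \<Lambda>"]) simp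
  qed
  then obtain R where R: "R \<Lambda> - mono_sym \<Lambda> \<in> below \<Lambda>" "theta (R \<Lambda>) = P \<Lambda>" if "\<Lambda> \<in> multipartitions n" for \<Lambda>
    by metis
  have W: "R \<Lambda> \<in> Sym n" if "\<Lambda> \<in> multipartitions n" for \<Lambda>
  proof -
    have "(R \<Lambda> - mono_sym \<Lambda>) + mono_sym \<Lambda> \<in> Sym n" using R(1)[OF that] below_V mono_sym_Sym[OF that] by (intro Sym_add) auto
    then show ?thesis by simp
  qed
  have "pair \<rho> (R \<Lambda>) (R M) = 0" if *: "\<Lambda> \<in> multipartitions n" "M \<in> multipartitions n" "\<Lambda> \<noteq> M" for \<Lambda> M
    using P * unfolding is_macdonald_basis_def scalar_prod_theta[OF W[OF *(1)] W[OF *(2)], symmetric] R(2)[OF *(1)] R(2)[OF *(2)]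
    by blast
  then have "gram_schmidt \<Lambda> (R \<Lambda>)" if "\<Lambda> \<in> multipartitions n" for \<Lambda>
    using orthogonal_imp_gram_schmidt[of R] R(1) that by blast
  then have "R \<Lambda> = Q \<Lambda>" if "\<Lambda> \<in> multipartitions n" for \<Lambda>
    using gram_schmidt_unique gram_schmidt that by blast
  then show "P \<Lambda> = restrict (theta \<circ> Q) (multipartitions n) \<Lambda>" if "\<Lambda> \<in> multipartitions n" for \<Lambda>
    using R(2)[OF that] that by simp
qed (rule restrict_extensional)

theorem unique_orthogonal_basis: "\<exists>!P. is_macdonald_basis P"
proof -
  define Q where "Q \<Lambda> = (SOME p. gram_schmidt \<Lambda> p)" for \<Lambda>
  have gram_schmidt: "gram_schmidt \<Lambda> (Q \<Lambda>)" if "\<Lambda> \<in> multipartitions n" for \<Lambda>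
    unfolding Q_def by (rule someI_ex[OF gram_schmidt_exists[OF that]])
  show ?thesis
  proof (rule ex1I)
    show "is_macdonald_basis (restrict (theta \<circ> Q) (multipartitions n))" by (rule is_macdonald_basis_restrict[OF gram_schmidt])
  qed (rule is_macdonald_basis_unique[OF _ gram_schmidt])
qed

end

theorem theorem1:
  fixes n :: nat
  assumes "n \<ge> 1"
  shows "\<exists>!P :: nat list list \<Rightarrow> mseries.
     P \<in> extensional (multipartitions n) \<and>
     is_basis_of (multipartitions n) P (msym n) \<and>
     (\<forall>\<Lambda>\<in>multipartitions n.
        P \<Lambda> - multi_m n \<Lambda>
          \<in> mfps.span (multi_m n ` {M \<in> multipartitions n. dominance_less n M \<Lambda>})) \<and>
     (\<forall>\<Lambda>\<in>multipartitions n. \<forall>M\<in>multipartitions n.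
        \<Lambda> \<noteq> M \<longrightarrow> scalar_prod n (P \<Lambda>) (P M) = 0)"
proof -
  interpret qt_macdonald n
    by unfold_locales (use assms qt_ge_2 in auto)
  show ?thesis using unique_orthogonal_basis unfolding is_macdonald_basis_def .
qed

end
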